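(* Let $\mathcal{H}$ be a family of Boolean functions on $2kN$ variables, each of which maps $\{-1,1\}^{2kN}$ into $[-1,1]$, and assume $\mathcal{H}$ is closed under restrictions. Then for every $H\in\mathcal{H}$, \[\left|\mathbb{E}_{z\sim\tilde{\mu}_0^{(k)}}[H(z)]-\mathbb{E}_{z\sim\tilde{\mu}_1^{(k)}}[H(z)]\right|\le O\!\left(\frac{L_{2k}(\mathcal{H})}{N^{k/2}}\right)+o\!\left(\frac{1}{N^{k/2}}\right).\]
   Context: Let $n\in\mathbb{N}$, $N=2^n$ sufficiently large, $k\in\mathbb{N}$ with $k=o(N^{1/50})$, and $\epsilon=\frac{1}{60k^2\ln N}$; asymptotic notation is as $N\to\infty$ with absolute constants. $H_N$ is the $N\times N$ matrix indexed by $a,b\in\{0,1\}^n$ with entries $H_N(a,b)=N^{-1/2}(-1)^{\sum_i a_ib_i}$. $\mathcal{G}$ is the distribution on $\mathbb{R}^{2N}$ of $(x,H_Nx)$ where $x_1,\dots,x_N\sim\mathcal{N}(0,\epsilon)$ independently; $\mathcal{U}$ is the uniform distribution on $\{-1,1\}^{2N}$. For a distribution $\mu$ on $\mathbb{R}^M$, the rounded distribution $\tilde\mu$ on $\{-1,1\}^M$ is obtained by sampling $z\sim\mu$ and then independently for each $i$ setting $z'_i=1$ with probability $\frac{1+trnc(z_i)}{2}$ and $z'_i=-1$ otherwise, where $trnc(a)=a$ for $a\in[-1,1]$ and $trnc(a)=\mathrm{sign}(a)$ otherwise. For distributions $\mathcal{P},\mathcal{Q}$ on $\mathbb{R}^{2N}$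 and $S\subseteq[k]$, $\mathcal{P}^S\mathcal{Q}^{\bar S}$ is the distribution of $(x_1,\dots,x_k)\in(\mathbb{R}^{2N})^k$ with the $x_j$ independent, $x_j\sim\mathcal{P}$ if $j\in S$ and $x_j\sim\mathcal{Q}$ if $j\notin S$. Define the mixtures $\tilde\mu_0^{(k)}=\frac{1}{2^{k-1}}\sum_{S\subseteq[k],|S|\text{ even}}\tilde{\mathcal{G}}^S\mathcal{U}^{\bar S}$ and $\tilde\mu_1^{(k)}=\frac{1}{2^{k-1}}\sum_{S\subseteq[k],|S|\text{ odd}}\tilde{\mathcal{G}}^S\mathcal{U}^{\bar S}$. Boolean functions $f:\{-1,1\}^M\to\mathbb{R}$ have Fourier expansion $f=\sum_S\hat f(S)\prod_{i\in S}x_i$; $L_{2k}(f)=\sum_{|S|=2k}|\hat f(S)|$ and $L_{2k}(\mathcal{H})=\sup_{H\in\mathcal{H}}L_{2k}(H)$. For $v\in\{-1,1,0\}^M$, $\rho_v(z)_j=z_j$ if $v_j=0$ and $\rho_v(z)_j=v_j$ otherwise; $\mathcal{H}$ is closed under restrictions if $H\circ\rho_v\in\mathcal{H}$ for all $H\in\mathcal{H}$ and all $v$. *)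

theory Defs
  imports "HOL-Probability.Probability" "HOL-Library.Landau_Symbols"
begin

section \<open>Boolean functions on a cube with coordinates in a finite index set\<close>

text \<open>
  The cube \<open>{-1,1}\<^sup>M\<close> is modelled with an arbitrary index set \<open>I\<close> of \<open>M\<close> coordinates. Points and
  functions on the cube are extensional (\<open>undefined\<close> off their domain), so that equality of
  HOL functions, as used in the closure condition below, is equality of functions on the cube.
\<close>

definition cube :: "'i set \<Rightarrow> ('i \<Rightarrow> real) set" where
  "cube I = (I \<rightarrow>\<^sub>E {-1, 1})"

definition fourier_coeff :: "'i set \<Rightarrow> (('i \<Rightarrow> real) \<Rightarrow> real) \<Rightarrow> 'i set \<Rightarrow> real" where
  "fourier_coeff I f S = (\<Sum>z\<in>cube I. f z * (\<Prod>i\<in>S. z i)) / 2 ^ card I"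

definition level_weight :: "'i set \<Rightarrow> nat \<Rightarrow> (('i \<Rightarrow> real) \<Rightarrow> real) \<Rightarrow> real" where
  "level_weight I l f = (\<Sum>S | S \<subseteq> I \<and> card S = l. \<bar>fourier_coeff I f S\<bar>)"

definition family_level_weight :: "'i set \<Rightarrow> nat \<Rightarrow> (('i \<Rightarrow> real) \<Rightarrow> real) set \<Rightarrow> real" where
  "family_level_weight I l \<H> = (SUP f\<in>\<H>. level_weight I l f)"

definition restriction :: "'i set \<Rightarrow> ('i \<Rightarrow> real) \<Rightarrow> ('i \<Rightarrow> real) \<Rightarrow> ('i \<Rightarrow> real)" where
  "restriction I v z = (\<lambda>j\<in>I. if v j = 0 then z j else v j)"

definition closed_under_restrictions :: "'i set \<Rightarrow> (('i \<Rightarrow> real) \<Rightarrow> real) set \<Rightarrow> bool" where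
  "closed_under_restrictions I \<H> \<longleftrightarrow>
     (\<forall>f\<in>\<H>. \<forall>v\<in>I \<rightarrow>\<^sub>E {-1, 1, 0}. restrict (f \<circ> restriction I v) (cube I) \<in> \<H>)"


section \<open>Rounding\<close>

definition trnc :: "real \<Rightarrow> real" where
  "trnc a = (if a \<in> {-1..1} then a else sgn a)"

definition round_coord :: "real \<Rightarrow> real pmf" where
  "round_coord a = map_pmf (\<lambda>b. if b then 1 else -1) (bernoulli_pmf ((1 + trnc a) / 2))"

definition round_point :: "'i set \<Rightarrow> ('i \<Rightarrow> real) \<Rightarrow> ('i \<Rightarrow> real) pmf" where
  "round_point I z = Pi_pmf I undefined (\<lambda>i. round_coord (z i))"

text \<open>
  \<open>\<mu>\<close> is a probability measure on \<open>\<real>\<^sup>I\<close>, i.e. on \<open>\<Pi>\<^sub>M i\<in>I. borel\<close>. Lemma \<open>measure_pmf_rounded\<close>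
  below shows that the \<open>Abs_pmf\<close> is legitimate.
\<close>

definition rounded :: "'i set \<Rightarrow> ('i \<Rightarrow> real) measure \<Rightarrow> ('i \<Rightarrow> real) pmf" where
  "rounded I \<mu> = Abs_pmf (\<mu> \<bind> (\<lambda>z. measure_pmf (round_point I z)))"


section \<open>The Forrelation distribution and its XOR mixtures\<close>

text \<open>
  A vector \<open>a \<in> {0,1}\<^sup>n\<close> is identified with the number \<open>a < 2 ^ n\<close> whose binary digits it lists.
\<close>

definition hadamard :: "nat \<Rightarrow> nat \<Rightarrow> nat \<Rightarrow> real" where
  "hadamard n a b = (-1) ^ (\<Sum>i<n. of_bool (bit a i) * of_bool (bit b i)) / sqrt (2 ^ n)"

definition eps :: "nat \<Rightarrow> nat \<Rightarrow> real" where
  "eps n k = 1 / (60 * (real k)\<^sup>2 * ln (2 ^ n))"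

text \<open>\<open>\<epsilon>\<close> is the variance, whereas \<open>normal_density\<close> takes the standard deviation.\<close>

definition forrelation :: "nat \<Rightarrow> real \<Rightarrow> (nat \<Rightarrow> real) measure" where
  "forrelation n \<epsilon> =
     distr (\<Pi>\<^sub>M a\<in>{..<2 ^ n}. density lborel (normal_density 0 (sqrt \<epsilon>)))
           (\<Pi>\<^sub>M i\<in>{..<2 * 2 ^ n}. borel)
           (\<lambda>x. \<lambda>i\<in>{..<2 * 2 ^ n}.
              if i < 2 ^ n then x i else (\<Sum>b<2 ^ n. hadamard n (i - 2 ^ n) b * x b))"

definition rounded_forrelation :: "nat \<Rightarrow> nat \<Rightarrow> (nat \<Rightarrow> real) pmf" where
  "rounded_forrelation n k = rounded {..<2 * 2 ^ n} (forrelation n (eps n k))"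

definition uniform_cube :: "nat \<Rightarrow> (nat \<Rightarrow> real) pmf" where
  "uniform_cube n = pmf_of_set (cube {..<2 * 2 ^ n})"

text \<open>
  The \<open>2kN\<close> coordinates of \<open>(x\<^sub>1, \<dots>, x\<^sub>k) \<in> (\<real>\<^sup>2\<^sup>N)\<^sup>k\<close> are indexed by pairs (block, position in block),
  with both components counted from 0.
\<close>

definition coords :: "nat \<Rightarrow> nat \<Rightarrow> (nat \<times> nat) set" where
  "coords n k = {..<k} \<times> {..<2 * 2 ^ n}"

definition flatten :: "nat \<Rightarrow> nat \<Rightarrow> (nat \<Rightarrow> nat \<Rightarrow> real) \<Rightarrow> (nat \<times> nat \<Rightarrow> real)" where
  "flatten n k x = (\<lambda>(j, i)\<in>coords n k. x j i)"

definition block_product ::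
    "nat \<Rightarrow> nat \<Rightarrow> (nat \<Rightarrow> real) pmf \<Rightarrow> (nat \<Rightarrow> real) pmf \<Rightarrow> nat set \<Rightarrow> (nat \<times> nat \<Rightarrow> real) pmf" where
  "block_product n k P Q S =
     map_pmf (flatten n k) (Pi_pmf {..<k} undefined (\<lambda>j. if j \<in> S then P else Q))"

definition mu0 :: "nat \<Rightarrow> nat \<Rightarrow> (nat \<times> nat \<Rightarrow> real) pmf" where
  "mu0 n k = bind_pmf (pmf_of_set {S. S \<subseteq> {..<k} \<and> even (card S)})
     (block_product n k (rounded_forrelation n k) (uniform_cube n))"

definition mu1 :: "nat \<Rightarrow> nat \<Rightarrow> (nat \<times> nat \<Rightarrow> real) pmf" where
  "mu1 n k = bind_pmf (pmf_of_set {S. S \<subseteq> {..<k} \<and> odd (card S)})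
     (block_product n k (rounded_forrelation n k) (uniform_cube n))"


section \<open>Consistency of the definitions\<close>

lemma finite_cube: "finite I \<Longrightarrow> finite (cube I)"
  unfolding cube_def by (intro finite_PiE) auto

lemma fourier_expansion:
  assumes I: "finite I" and z: "z \<in> cube I"
  shows "f z = (\<Sum>S\<in>Pow I. fourier_coeff I f S * (\<Prod>i\<in>S. z i))"
proof -
  have kernel: "(\<Sum>S\<in>Pow I. (\<Prod>i\<in>S. w i) * (\<Prod>i\<in>S. z i)) = (if w = z then 2 ^ card I else 0)"
    if w: "w \<in> cube I" for w
  proof -
    have "(\<Sum>S\<in>Pow I. (\<Prod>i\<in>S. w i) * (\<Prod>i\<in>S. z i)) = (\<Prod>i\<in>I. w i * z i + 1)"
      using I by (subst prod_add) (simp_all add: prod.distrib)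
    also have "\<dots> = (if w = z then 2 ^ card I else 0)"
    proof (cases "w = z")
      case True
      have "w i * z i + 1 = 2" if "i \<in> I" for i
        using z that True by (auto simp: cube_def dest!: PiE_mem)
      then show ?thesis using True by simp
    next
      case False
      then obtain i where i: "i \<in> I" "w i \<noteq> z i"
        using w z unfolding cube_def by (metis PiE_ext)
      then have "w i * z i + 1 = 0"
        using w z by (auto simp: cube_def dest!: PiE_mem)
      then show ?thesis using False i I by (auto intro!: prod_zero)
    qed
    finally show ?thesis .
  qed
  have "(\<Sum>S\<in>Pow I. fourier_coeff I f S * (\<Prod>i\<in>S. z i)) =
      (\<Sum>S\<in>Pow I. \<Sum>w\<in>cube I. f w * ((\<Prod>i\<in>S. w i) * (\<Prod>i\<in>S. z i)) / 2 ^ card I)"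
    by (simp add: fourier_coeff_def sum_divide_distrib sum_distrib_right mult.assoc)
  also have "\<dots> = (\<Sum>w\<in>cube I. f w * (\<Sum>S\<in>Pow I. (\<Prod>i\<in>S. w i) * (\<Prod>i\<in>S. z i)) / 2 ^ card I)"
    by (subst sum.swap) (simp add: sum_divide_distrib sum_distrib_left)
  also have "\<dots> = (\<Sum>w\<in>cube I. if w = z then f w else 0)"
    by (intro sum.cong refl) (simp add: kernel)
  also have "\<dots> = f z"
    using z finite_cube[OF I] by simp
  finally show ?thesis by simp
qed

lemma trnc_bounds: "0 \<le> (1 + trnc a) / 2" "(1 + trnc a) / 2 \<le> 1"
  by (auto simp: trnc_def sgn_if)

lemma pmf_round_coord:
  "pmf (round_coord a) y =
     (if y = 1 then (1 + trnc a) / 2 else if y = -1 then (1 - trnc a) / 2 else 0)"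
proof -
  have "pmf (round_coord a) y =
      measure (measure_pmf (bernoulli_pmf ((1 + trnc a) / 2))) ((\<lambda>b. if b then 1 else -1) -` {y})"
    unfolding round_coord_def by (rule pmf_map)
  also have "(\<lambda>b. if b then 1 else -1) -` {y} =
      (if y = 1 then {True} else if y = -1 then {False} else {})"
    by (auto split: if_splits)
  finally show ?thesis
    using trnc_bounds[of a] by (auto simp: measure_pmf_single field_simps)
qed

lemma set_round_point:
  assumes "finite I" shows "set_pmf (round_point I z) \<subseteq> cube I"
proof -
  have "set_pmf (round_coord a) \<subseteq> {-1, 1}" for a
    by (auto simp: round_coord_def)
  then show ?thesis
    using assms by (fastforce simp: round_point_def set_Pi_pmf PiE_dflt_def cube_def)
qed

lemma trnc_measurable [measurable]: "trnc \<in> borel_measurable borel"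
  unfolding trnc_def[abs_def] by measurable

lemma round_point_measurable:
  fixes \<mu> :: "('i \<Rightarrow> real) measure"
  assumes I: "finite I" and \<mu>: "sets \<mu> = sets (\<Pi>\<^sub>M i\<in>I. borel)"
  shows "(\<lambda>z. measure_pmf (round_point I z)) \<in> \<mu> \<rightarrow>\<^sub>M subprob_algebra (count_space UNIV)"
proof (rule measurable_subprob_algebra)
  fix A :: "('i \<Rightarrow> real) set"
  have eq: "emeasure (measure_pmf (round_point I z)) A =
      (\<Sum>y\<in>A \<inter> cube I. ennreal (\<Prod>i\<in>I. pmf (round_coord (z i)) (y i)))" for z
  proof -
    have "emeasure (measure_pmf (round_point I z)) A =
        emeasure (measure_pmf (round_point I z)) (A \<inter> cube I)"
      using set_round_point[OF I, of z] by (intro emeasure_eq_AE) (auto simp: AE_measure_pmf_iff)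
    also have "\<dots> = (\<Sum>y\<in>A \<inter> cube I. ennreal (pmf (round_point I z) y))"
      using finite_cube[OF I] by (subst emeasure_measure_pmf_finite) (auto simp: sum_ennreal)
    also have "\<dots> = (\<Sum>y\<in>A \<inter> cube I. ennreal (\<Prod>i\<in>I. pmf (round_coord (z i)) (y i)))"
      by (intro sum.cong refl)
         (auto simp: round_point_def pmf_Pi[OF I] cube_def PiE_def extensional_def)
    finally show ?thesis .
  qed
  have comp: "(\<lambda>z. z i) \<in> borel_measurable \<mu>" if "i \<in> I" for i
    using measurable_component_singleton[OF that, of "\<lambda>_. borel"] measurable_cong_sets[OF \<mu> refl]
    by blast
  have "(\<lambda>z. pmf (round_coord (z i)) y) \<in> borel_measurable \<mu>" if "i \<in> I" for i y
    unfolding pmf_round_coord using comp[OF that] by measurable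
  then show "(\<lambda>z. emeasure (measure_pmf (round_point I z)) A) \<in> borel_measurable \<mu>"
    unfolding eq by (intro borel_measurable_sum measurable_compose[OF _ measurable_ennreal]
      borel_measurable_prod) auto
qed (auto simp: measure_pmf.subprob_space_axioms)

lemma measure_pmf_rounded:
  fixes \<mu> :: "('i \<Rightarrow> real) measure"
  assumes I: "finite I" and \<mu>: "sets \<mu> = sets (\<Pi>\<^sub>M i\<in>I. borel)" and prob: "prob_space \<mu>"
  shows "measure_pmf (rounded I \<mu>) = \<mu> \<bind> (\<lambda>z. measure_pmf (round_point I z))"
proof -
  let ?K = "\<lambda>z. measure_pmf (round_point I z)"
  let ?M = "\<mu> \<bind> ?K"
  note K = round_point_measurable[OF I \<mu>]
  interpret \<mu>: prob_space \<mu> by fact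
  have sets: "sets ?M = UNIV"
    using sets_bind_measurable[OF K \<mu>.not_empty] by simp
  have prob_M: "prob_space ?M"
    using K by (intro \<mu>.prob_space_bind[where S = "count_space UNIV"])
               (auto simp: measure_pmf.prob_space_axioms)
  interpret M: prob_space ?M by fact
  have "AE y in ?M. y \<in> cube I"
    using set_round_point[OF I] by (subst AE_bind[OF K]) (auto simp: AE_measure_pmf_iff)
  moreover have "AE y in ?M. y \<notin> {y \<in> cube I. measure ?M {y} = 0}"
  proof (rule AE_not_in)
    have "{y \<in> cube I. measure ?M {y} = 0} = (\<Union>y\<in>{y \<in> cube I. measure ?M {y} = 0}. {y})"
      by auto
    also have "\<dots> \<in> null_sets ?M"
      using finite_cube[OF I] sets
      by (intro null_sets_UN' countable_finite) (auto simp: null_sets_def M.emeasure_eq_measure)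
    finally show "{y \<in> cube I. measure ?M {y} = 0} \<in> null_sets ?M" .
  qed
  ultimately have "AE y in ?M. measure ?M {y} \<noteq> 0"
    by eventually_elim auto
  then show ?thesis
    unfolding rounded_def using sets prob_M by (subst Abs_pmf_inverse) auto
qed

lemma forrelation_prob_space:
  assumes "\<epsilon> > 0" shows "prob_space (forrelation n \<epsilon>)"
proof -
  interpret prob_space "density lborel (normal_density 0 (sqrt \<epsilon>))"
    using assms by (intro prob_space_normal_density) simp
  interpret product_prob_space "\<lambda>a. density lborel (normal_density 0 (sqrt \<epsilon>))" "{..<2 ^ n :: nat}" ..
  show ?thesis
    unfolding forrelation_def
  proof (intro prob_space_distr measurable_restrict)
    fix i :: nat assume "i \<in> {..<2 * 2 ^ n}"
    show "(\<lambda>x. if i < 2 ^ n then x i else (\<Sum>b<2 ^ n. hadamard n (i - 2 ^ n) b * x b))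
        \<in> borel_measurable (\<Pi>\<^sub>M a\<in>{..<2 ^ n}. density lborel (normal_density 0 (sqrt \<epsilon>)))"
      (is "_ \<in> borel_measurable ?P")
    proof -
      have comp: "(\<lambda>x. x b) \<in> borel_measurable ?P" if "b < 2 ^ n" for b
        using measurable_component_singleton[of b "{..<2 ^ n}"
            "\<lambda>_. density lborel (normal_density 0 (sqrt \<epsilon>))"] that by simp
      show ?thesis
        by (cases "i < 2 ^ n") (auto intro!: borel_measurable_sum borel_measurable_times comp)
    qed
  qed
qed

lemma measure_pmf_rounded_forrelation:
  assumes "n > 0" "k > 0"
  shows "measure_pmf (rounded_forrelation n k) =
    forrelation n (eps n k) \<bind> (\<lambda>z. measure_pmf (round_point {..<2 * 2 ^ n} z))"
  unfolding rounded_forrelation_def using assms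
  by (intro measure_pmf_rounded forrelation_prob_space) (auto simp: forrelation_def eps_def)

lemma card_parity_subsets:
  assumes "k > 0"
  shows "card {S. S \<subseteq> {..<k} \<and> even (card S)} = 2 ^ (k - 1)"
    and "card {S. S \<subseteq> {..<k} \<and> odd (card S)} = 2 ^ (k - 1)"
proof -
  let ?E = "{S. S \<subseteq> {..<k} \<and> even (card S)}" and ?O = "{S. S \<subseteq> {..<k} \<and> odd (card S)}"
  let ?flip = "\<lambda>S. if 0 \<in> S then S - {0} else insert (0::nat) S"
  have fin: "finite S" if "S \<subseteq> {..<k}" for S
    using that finite_subset by blast
  have par: "even (card (?flip S)) \<longleftrightarrow> odd (card S)" if "S \<subseteq> {..<k}" for S
    using fin[OF that] by (cases "0 \<in> S") auto
  have "bij_betw ?flip ?E ?O"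
    using assms par by (intro bij_betwI[where g = ?flip]) (auto split: if_splits)
  then have eq: "card ?E = card ?O"
    by (rule bij_betw_same_card)
  have "card (Pow {..<k}) = card (?E \<union> ?O)"
    by (intro arg_cong[where f = card]) auto
  also have "\<dots> = card ?E + card ?O"
    by (rule card_Un_disjoint) auto
  finally have "card ?E + card ?O = 2 * 2 ^ (k - 1)"
    using assms by (cases k) (simp_all add: card_Pow)
  with eq show "card ?E = 2 ^ (k - 1)" "card ?O = 2 ^ (k - 1)"
    by simp_all
qed

lemma pmf_mixture:
  assumes "card A = 2 ^ m"
  shows "pmf (bind_pmf (pmf_of_set A) P) z = 1 / 2 ^ m * (\<Sum>S\<in>A. pmf (P S) z)"
proof -
  have "finite A" "A \<noteq> {}"
    using assms by (auto intro: card_ge_0_finite)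
  then show ?thesis
    using assms by (simp add: pmf_bind integral_pmf_of_set)
qed

lemma
  assumes "k > 0"
  shows pmf_mu0: "pmf (mu0 n k) z = 1 / 2 ^ (k - 1) * (\<Sum>S | S \<subseteq> {..<k} \<and> even (card S).
            pmf (block_product n k (rounded_forrelation n k) (uniform_cube n) S) z)"
    and pmf_mu1: "pmf (mu1 n k) z = 1 / 2 ^ (k - 1) * (\<Sum>S | S \<subseteq> {..<k} \<and> odd (card S).
            pmf (block_product n k (rounded_forrelation n k) (uniform_cube n) S) z)"
  using card_parity_subsets[OF assms] by (simp_all add: mu0_def mu1_def pmf_mixture)

end

theory Submission
  imports Defs
begin

text \<open>
  Extend \<open>H\<close> multilinearly to \<open>\<real>\<^sup>2\<^sup>k\<^sup>N\<close>. Its expectation under a rounded distribution is the expectation of the extension at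
  the truncated sample, and a uniform block amounts to evaluating at 0. If \<open>z\<^sub>j\<close> is the \<open>j\<close>-th Gaussian block and
  \<open>F(t) = E[H(\<surd>t\<^sub>1 z\<^sub>1, \<dots>, \<surd>t\<^sub>k z\<^sub>k)]\<close>, the difference of the two expectations is therefore, up to truncation and a
  factor \<open>\<plusminus>1/2\<^bsup>k - 1\<^esup>\<close>, the alternating sum of \<open>F\<close> over \<open>{0,1}\<^sup>k\<close>, i.e. the integral of the mixed derivative of \<open>F\<close> in
  all \<open>t\<^sub>j\<close> over the unit cube.

  By the heat equation, differentiating in \<open>t\<^sub>j\<close> inserts \<open>\<epsilon> \<Sum>\<^sub>a\<^sub>b H\<^sub>N(b,a) \<partial>\<^sub>a \<partial>\<^bsub>N + b\<^esub>\<close> in block \<open>j\<close>: only covariances between the two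
  halves count, as the extension is multilinear and \<open>H\<^sub>N\<close> orthogonal. Each entry of \<open>H\<^sub>N\<close> is \<open>\<plusminus>1/\<surd>N\<close>, so the integrand is
  at most \<open>\<epsilon>\<^sup>k N\<^bsup>-k/2\<^esup>\<close> times the sum of all absolute derivatives of order \<open>2k\<close>. At a point of \<open>[-1/2,1/2]\<^sup>2\<^sup>k\<^sup>N\<close> these
  are \<open>4\<^sup>k\<close> times average level-\<open>2k\<close> coefficients of random restrictions of \<open>H\<close>, hence sum to at most \<open>4\<^sup>k L\<^bsub>2k\<^esub>\<close>.

  Outside that box everything is at most \<open>\<Prod> max 1 \<bar>z\<^sub>i\<bar>\<close>, which is controlled by the polynomial
  \<open>\<Prod>(1 + (2z\<^sub>i)\<^sup>2\<^sup>m) - 1\<close> with \<open>m = 2k\<^sup>2n\<close>. All Gaussian input is polynomial, so Wick's formula suffices: it yields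
  the heat equation on monomials, and it shows that \<open>H\<^sub>Nx\<close> has the mixed moments of i.i.d. Gaussians.
\<close>

section \<open>Derivatives of the multilinear extension\<close>

text \<open>The value at \<open>v\<close> of the mixed partial derivative in the directions \<open>P\<close> of the multilinear extension of \<open>f\<close>;
  \<open>P = {}\<close> gives the extension itself.\<close>

definition deriv_ext :: "'i set \<Rightarrow> (('i \<Rightarrow> real) \<Rightarrow> real) \<Rightarrow> 'i set \<Rightarrow> ('i \<Rightarrow> real) \<Rightarrow> real" where
  "deriv_ext I f P v =
     (\<Sum>z\<in>cube I. f z * (\<Prod>i\<in>I. if i \<in> P then z i / 2 else (1 + z i * v i) / 2))"

text \<open>The factors \<open>z i * v i + 1\<close> off \<open>P\<close> multiply out to a sum over
  \<open>B \<subseteq> I - P\<close>, and \<open>T = P \<union> B\<close> turns it into a sum of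
  characters. This justifies reading \<open>deriv_ext\<close> as a partial derivative of the
  multilinear polynomial.\<close>

lemma deriv_ext_fourier:
  assumes I: "finite I" and P: "P \<subseteq> I"
  shows "deriv_ext I f P v =
    (\<Sum>T | P \<subseteq> T \<and> T \<subseteq> I. fourier_coeff I f T * (\<Prod>i\<in>T - P. v i))"
proof -
  have fP: "finite P" using I P finite_subset by blast
  have kernel: "(\<Prod>i\<in>I. if i \<in> P then z i / 2 else (1 + z i * v i) / 2) =
      (\<Sum>T | P \<subseteq> T \<and> T \<subseteq> I. (\<Prod>i\<in>T. z i) * (\<Prod>i\<in>T - P. v i)) / 2 ^ card I" for z
  proof -
    have "(\<Prod>i\<in>I. if i \<in> P then z i / 2 else (1 + z i * v i) / 2)
        = (\<Prod>i\<in>I. (if i \<in> P then z i else (z i * v i + 1)) / 2)"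
      by (intro prod.cong) auto
    also have "\<dots> = (\<Prod>i\<in>I. if i \<in> P then z i else (z i * v i + 1)) / 2 ^ card I"
      by (simp add: prod_dividef)
    also have "(\<Prod>i\<in>I. if i \<in> P then z i else (z i * v i + 1))
        = (\<Prod>i\<in>P. z i) * (\<Prod>i\<in>I - P. z i * v i + 1)"
      using I P by (subst prod.subset_diff[OF P I]) (simp add: mult.commute)
    also have "(\<Prod>i\<in>I - P. z i * v i + 1) = (\<Sum>B\<in>Pow (I - P). \<Prod>i\<in>B. z i * v i)"
      using I by (subst prod_add) auto
    also have "(\<Prod>i\<in>P. z i) * \<dots> = (\<Sum>B\<in>Pow (I - P). (\<Prod>i\<in>P \<union> B. z i) * (\<Prod>i\<in>(P \<union> B) - P. v i))"
      unfolding sum_distrib_left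
    proof (intro sum.cong refl)
      fix B assume B: "B \<in> Pow (I - P)"
      then have "finite B" "P \<inter> B = {}" "(P \<union> B) - P = B"
        using I finite_subset by blast+
      then show "(\<Prod>i\<in>P. z i) * (\<Prod>i\<in>B. z i * v i) = (\<Prod>i\<in>P \<union> B. z i) * (\<Prod>i\<in>(P \<union> B) - P. v i)"
        using fP by (simp add: prod.union_disjoint prod.distrib)
    qed
    also have "\<dots> = (\<Sum>T | P \<subseteq> T \<and> T \<subseteq> I. (\<Prod>i\<in>T. z i) * (\<Prod>i\<in>T - P. v i))"
      using P by (intro sum.reindex_bij_witness[where i = "\<lambda>T. T - P" and j = "\<lambda>B. P \<union> B"]) auto
    finally show ?thesis .
  qed
  have "deriv_ext I f P v = (\<Sum>z\<in>cube I. \<Sum>T | P \<subseteq> T \<and> T \<subseteq> I.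
      f z * ((\<Prod>i\<in>T. z i) * (\<Prod>i\<in>T - P. v i)) / 2 ^ card I)"
    by (simp add: deriv_ext_def kernel sum_distrib_left sum_divide_distrib)
  also have "\<dots> = (\<Sum>T | P \<subseteq> T \<and> T \<subseteq> I. \<Sum>z\<in>cube I.
      f z * ((\<Prod>i\<in>T. z i) * (\<Prod>i\<in>T - P. v i)) / 2 ^ card I)"
    by (rule sum.swap)
  also have "\<dots> = (\<Sum>T | P \<subseteq> T \<and> T \<subseteq> I. fourier_coeff I f T * (\<Prod>i\<in>T - P. v i))"
    by (simp add: fourier_coeff_def sum_divide_distrib sum_distrib_right mult.assoc)
  finally show ?thesis .
qed

text \<open>The absolute kernel factorises over the coordinates. One coordinate contributes 1 if it
  lies in \<open>P\<close>, and otherwise (|1 + v| + |1 - v|) / 2 = max 1 |v|. This crude bound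
  holds at every point and serves outside the box.\<close>

lemma abs_deriv_ext_le:
  assumes I: "finite I" and f: "\<And>z. z \<in> cube I \<Longrightarrow> \<bar>f z\<bar> \<le> 1"
  shows "\<bar>deriv_ext I f P v\<bar> \<le> (\<Prod>i\<in>I. max 1 \<bar>v i\<bar>)"
proof -
  let ?g = "\<lambda>i y. \<bar>if i \<in> P then y / 2 else (1 + y * v i) / 2\<bar> :: real"
  have "\<bar>deriv_ext I f P v\<bar> \<le> (\<Sum>z\<in>cube I. \<bar>f z * (\<Prod>i\<in>I. if i \<in> P then z i / 2 else (1 + z i * v i) / 2)\<bar>)"
    unfolding deriv_ext_def by (rule sum_abs)
  also have "\<dots> \<le> (\<Sum>z\<in>cube I. \<Prod>i\<in>I. ?g i (z i))"
    by (intro sum_mono) (auto simp: abs_mult abs_prod intro!: mult_left_le_one_le f prod_nonneg)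
  also have "\<dots> = (\<Prod>i\<in>I. \<Sum>y\<in>{-1, 1}. ?g i y)"
    unfolding cube_def using I by (subst prod_sum_PiE) auto
  also have "\<dots> \<le> (\<Prod>i\<in>I. max 1 \<bar>v i\<bar>)"
  proof (intro prod_mono conjI)
    fix i
    show "(\<Sum>y\<in>{-1, 1}. ?g i y) \<le> max 1 \<bar>v i\<bar>"
      by (cases "i \<in> P") (auto simp: max_def abs_if field_simps)
  qed (auto intro!: sum_nonneg)
  finally show ?thesis .
qed

text \<open>The random restriction leaves a coordinate free with probability \<open>1/2\<close> and otherwise fixes it to \<open>\<plusminus>1\<close>, with
  bias such that it contributes \<open>v i\<close> on average.\<close>

lemma deriv_ext_random_restriction:
  assumes I: "finite I" and P: "P \<subseteq> I"
  shows "(\<Sum>\<rho>\<in>I \<rightarrow>\<^sub>E {-1, 1, 0}. (\<Prod>i\<in>I. if \<rho> i = 0 then 1 / 2 else (1 / 2 + \<rho> i * v i) / 2) *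
            fourier_coeff I (restrict (f \<circ> restriction I \<rho>) (cube I)) P)
       = deriv_ext I f P v / 2 ^ card P"
proof -
  let ?R = "I \<rightarrow>\<^sub>E {-1, 1, 0 :: real}"
  let ?q = "\<lambda>i r. if r = 0 then 1 / 2 else (1 / 2 + r * v i) / 2 :: real"
  let ?c = "\<lambda>i y. (if i \<in> P then y else 1) / 2 :: real"
  have restr: "restriction I \<rho> z \<in> cube I" if "\<rho> \<in> ?R" "z \<in> cube I" for \<rho> z
    using that by (auto simp: restriction_def cube_def PiE_def Pi_def)
  have ind: "(if restriction I \<rho> z = w then 1 else 0) =
      (\<Prod>i\<in>I. if (if \<rho> i = 0 then z i else \<rho> i) = w i then 1 else 0 :: real)"
    if "w \<in> cube I" for \<rho> z w
  proof (cases "restriction I \<rho> z = w")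
    case True
    then have "(if \<rho> i = 0 then z i else \<rho> i) = w i" if "i \<in> I" for i
      using that by (auto simp: restriction_def)
    then show ?thesis using True by simp
  next
    case False
    have "\<exists>i\<in>I. (if \<rho> i = 0 then z i else \<rho> i) \<noteq> w i"
    proof (rule ccontr)
      assume "\<not> ?thesis"
      then have "restriction I \<rho> z = w"
        using \<open>w \<in> cube I\<close> by (intro ext) (auto simp: restriction_def cube_def PiE_def extensional_def)
      with False show False by simp
    qed
    then show ?thesis using False I by (auto intro!: prod_zero[symmetric])
  qed
  have fc: "fourier_coeff I (restrict (f \<circ> restriction I \<rho>) (cube I)) P =
      (\<Sum>z\<in>cube I. (\<Prod>i\<in>I. ?c i (z i)) * f (restriction I \<rho> z))" for \<rho>
  proof -
    have "(\<Prod>i\<in>I. ?c i (z i)) = (\<Prod>i\<in>P. z i) / 2 ^ card I" for z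
      using I P by (simp add: prod_dividef prod.If_cases Int_absorb1)
    then show ?thesis
      by (simp add: fourier_coeff_def sum_divide_distrib mult_ac)
  qed
  \<comment> \<open>The restricted value is written as a delta sum over \<open>w\<close>; by
    \<open>ind\<close> the delta is a product over coordinates, so for fixed \<open>w\<close> the
    sums over \<rho> and \<open>z\<close> factorise.\<close>
  have "(\<Sum>\<rho>\<in>?R. (\<Prod>i\<in>I. ?q i (\<rho> i)) * fourier_coeff I (restrict (f \<circ> restriction I \<rho>) (cube I)) P)
      = (\<Sum>\<rho>\<in>?R. \<Sum>z\<in>cube I. (\<Prod>i\<in>I. ?q i (\<rho> i)) * (\<Prod>i\<in>I. ?c i (z i)) *
          (\<Sum>w\<in>cube I. f w * (if restriction I \<rho> z = w then 1 else 0)))"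
    unfolding fc sum_distrib_left
    by (intro sum.cong refl) (simp add: restr finite_cube[OF I] if_distrib cong: if_cong)
  also have "\<dots> = (\<Sum>\<rho>\<in>?R. \<Sum>z\<in>cube I. \<Sum>w\<in>cube I. f w *
      (\<Prod>i\<in>I. ?q i (\<rho> i) * ?c i (z i) * (if (if \<rho> i = 0 then z i else \<rho> i) = w i then 1 else 0)))"
    unfolding sum_distrib_left prod.distrib by (intro sum.cong refl) (simp only: ind mult_ac)
  also have "\<dots> = (\<Sum>w\<in>cube I. f w * (\<Sum>\<rho>\<in>?R. \<Sum>z\<in>cube I.
      (\<Prod>i\<in>I. ?q i (\<rho> i) * ?c i (z i) * (if (if \<rho> i = 0 then z i else \<rho> i) = w i then 1 else 0))))"
    by (subst sum.swap[of _ "cube I" "cube I"], subst sum.swap[of _ _ ?R]) (simp add: sum_distrib_left)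
  also have "\<dots> = (\<Sum>w\<in>cube I. f w * (\<Prod>i\<in>I. \<Sum>r\<in>{-1, 1, 0}. \<Sum>y\<in>{-1, 1}.
      ?q i r * ?c i y * (if (if r = 0 then y else r) = w i then 1 else 0)))"
    unfolding cube_def using I by (simp only: prod_sum_PiE finite.intros)
  \<comment> \<open>For \<open>i \<in> P\<close> the fixed values \<open>r = 1\<close> and
    \<open>r = -1\<close> cancel in the sum over \<open>y\<close>. Only the free case survives, and
    its probability 1/2 is the source of the power of 2 in the claim.\<close>
  also have "\<dots> = (\<Sum>w\<in>cube I. f w *
      (\<Prod>i\<in>I. (if i \<in> P then w i / 2 else (1 + w i * v i) / 2) * (if i \<in> P then 1 / 2 else 1)))"
  proof (intro sum.cong refl arg_cong2[where f = times] prod.cong)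
    fix w i assume "w \<in> cube I" "i \<in> I"
    then have "w i = -1 \<or> w i = 1" by (auto simp: cube_def dest!: PiE_mem)
    then show "(\<Sum>r\<in>{-1, 1, 0}. \<Sum>y\<in>{-1, 1}.
        ?q i r * ?c i y * (if (if r = 0 then y else r) = w i then 1 else 0)) =
        (if i \<in> P then w i / 2 else (1 + w i * v i) / 2) * (if i \<in> P then 1 / 2 else 1)"
      by (elim disjE) (simp_all add: field_simps)
  qed
  also have "\<dots> = deriv_ext I f P v / 2 ^ card P"
    using I P by (simp add: deriv_ext_def prod.distrib[of _ "\<lambda>i. if i \<in> P then 1 / 2 else 1"]
      prod.If_cases[of I "\<lambda>i. i \<in> P" "\<lambda>_. 1 / 2"] Int_absorb1 sum_divide_distrib power_one_over)
  finally show ?thesis .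
qed

section \<open>Level weights control derivatives inside the box\<close>

lemma abs_fourier_coeff_le:
  assumes I: "finite I" and f: "\<And>z. z \<in> cube I \<Longrightarrow> \<bar>f z\<bar> \<le> 1" and S: "S \<subseteq> I"
  shows "\<bar>fourier_coeff I f S\<bar> \<le> 1"
proof -
  have "\<bar>\<Prod>i\<in>S. z i\<bar> = 1" if "z \<in> cube I" for z
  proof -
    have "\<bar>z i\<bar> = 1" if "i \<in> S" for i
      using \<open>z \<in> cube I\<close> that S by (auto simp: cube_def dest!: PiE_mem)
    then show ?thesis by (simp add: abs_prod)
  qed
  then have "\<bar>\<Sum>z\<in>cube I. f z * (\<Prod>i\<in>S. z i)\<bar> \<le> (\<Sum>z\<in>cube I. 1)"
    by (intro order_trans[OF sum_abs] sum_mono) (simp add: abs_mult f)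
  also have "\<dots> = 2 ^ card I"
    using I by (simp add: cube_def card_PiE numeral_2_eq_2)
  finally show ?thesis
    by (simp add: fourier_coeff_def)
qed

text \<open>A real supremum dominates the members only if they are bounded above. Boundedness by 1
  on the cube bounds every coefficient by 1, hence the level weight by the number of index sets of
  size \<open>l\<close>.\<close>

lemma level_weight_le_family:
  assumes I: "finite I" and \<H>: "\<H> \<subseteq> cube I \<rightarrow>\<^sub>E {-1..1}" and f: "f \<in> \<H>"
  shows "level_weight I l f \<le> family_level_weight I l \<H>"
  unfolding family_level_weight_def
proof (rule cSUP_upper[OF f])
  have "level_weight I l g \<le> (\<Sum>S | S \<subseteq> I \<and> card S = l. 1)" if "g \<in> \<H>" for g
    unfolding level_weight_def
  proof (intro sum_mono abs_fourier_coeff_le I)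
    fix z assume "z \<in> cube I"
    moreover have "g \<in> cube I \<rightarrow>\<^sub>E {-1..1}" using that \<H> by blast
    ultimately have "g z \<in> {-1..1}" by (rule PiE_mem[rotated])
    then show "\<bar>g z\<bar> \<le> 1" by auto
  qed auto
  then show "bdd_above (level_weight I l ` \<H>)"
    by (intro bdd_aboveI2)
qed

text \<open>For |v i| at most 1/2 the weights \<open>(1 / 2 + \<rho> i * v i) / 2\<close> are
  nonnegative, so each derivative is \<open>2 ^ l\<close> times a true average over restrictions.
  These stay in the family by closure, and the triangle inequality inside the average leaves their
  level weights.\<close>

lemma sum_abs_deriv_ext_le:
  assumes I: "finite I" and \<H>: "\<H> \<subseteq> cube I \<rightarrow>\<^sub>E {-1..1}"
    and closed: "closed_under_restrictions I \<H>" and f: "f \<in> \<H>"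
    and v: "\<And>i. i \<in> I \<Longrightarrow> \<bar>v i\<bar> \<le> 1 / 2"
  shows "(\<Sum>P | P \<subseteq> I \<and> card P = l. \<bar>deriv_ext I f P v\<bar>) \<le> 2 ^ l * family_level_weight I l \<H>"
proof -
  let ?R = "I \<rightarrow>\<^sub>E {-1, 1, 0 :: real}"
  let ?q = "\<lambda>i r. if r = 0 then 1 / 2 else (1 / 2 + r * v i) / 2 :: real"
  let ?Q = "\<lambda>\<rho>. \<Prod>i\<in>I. ?q i (\<rho> i)"
  let ?g = "\<lambda>\<rho>. restrict (f \<circ> restriction I \<rho>) (cube I)"
  let ?L = "{P. P \<subseteq> I \<and> card P = l}"
  have Q0: "?Q \<rho> \<ge> 0" if "\<rho> \<in> ?R" for \<rho>
  proof (intro prod_nonneg ballI)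
    fix i assume "i \<in> I"
    with that v[of i] show "0 \<le> ?q i (\<rho> i)"
      by (auto dest!: PiE_mem simp: abs_le_iff)
  qed
  have Q1: "(\<Sum>\<rho>\<in>?R. ?Q \<rho>) = 1"
    using I by (subst prod_sum_PiE[symmetric]) (auto simp: field_simps)
  have "(\<Sum>P\<in>?L. \<bar>deriv_ext I f P v\<bar>)
      = (\<Sum>P\<in>?L. 2 ^ l * \<bar>\<Sum>\<rho>\<in>?R. ?Q \<rho> * fourier_coeff I (?g \<rho>) P\<bar>)"
    by (intro sum.cong refl) (auto simp: deriv_ext_random_restriction[OF I])
  also have "\<dots> \<le> (\<Sum>P\<in>?L. 2 ^ l * (\<Sum>\<rho>\<in>?R. ?Q \<rho> * \<bar>fourier_coeff I (?g \<rho>) P\<bar>))"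
    by (intro sum_mono mult_left_mono order_trans[OF sum_abs]) (auto simp: abs_mult Q0 simp del: prod.If_cases)
  also have "\<dots> = 2 ^ l * (\<Sum>\<rho>\<in>?R. ?Q \<rho> * level_weight I l (?g \<rho>))"
    unfolding level_weight_def sum_distrib_left
    by (subst sum.swap) simp
  also have "\<dots> \<le> 2 ^ l * (\<Sum>\<rho>\<in>?R. ?Q \<rho> * family_level_weight I l \<H>)"
    using closed f by (intro mult_left_mono sum_mono level_weight_le_family I \<H> Q0)
      (auto simp: closed_under_restrictions_def)
  also have "\<dots> = 2 ^ l * family_level_weight I l \<H>"
    by (simp only: sum_distrib_right[symmetric] Q1 mult_1)
  finally show ?thesis .
qed

section \<open>Functions with finite absolute moments\<close>

text \<open>Unlike integrability, this is closed under products.\<close>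

definition finite_moments :: "'a measure \<Rightarrow> ('a \<Rightarrow> real) \<Rightarrow> bool" where
  "finite_moments M f \<longleftrightarrow> f \<in> borel_measurable M \<and> (\<forall>p. integrable M (\<lambda>x. \<bar>f x\<bar> ^ p))"

lemma finite_moments_measurable: "finite_moments M f \<Longrightarrow> f \<in> borel_measurable M"
  by (simp add: finite_moments_def)

lemma finite_moments_integrable: "finite_moments M f \<Longrightarrow> integrable M f"
  unfolding finite_moments_def using integrable_abs_cancel[of M f] by (auto dest: spec[of _ 1])

lemma finite_moments_bounded:
  assumes "prob_space M" and f: "f \<in> borel_measurable M" and B: "\<And>x. \<bar>f x\<bar> \<le> B"
  shows "finite_moments M f"
proof -
  interpret prob_space M by fact
  show ?thesis
    unfolding finite_moments_def
  proof (intro conjI allI f)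
    fix p
    show "integrable M (\<lambda>x. \<bar>f x\<bar> ^ p)"
      using f B by (intro integrable_const_bound[where B = "B ^ p"])
        (auto simp: power_abs intro!: power_mono)
  qed
qed

lemma finite_moments_const: "prob_space M \<Longrightarrow> finite_moments M (\<lambda>_. c)"
  by (rule finite_moments_bounded[where B = "\<bar>c\<bar>"]) auto

lemma finite_moments_add:
  assumes f: "finite_moments M f" and g: "finite_moments M g"
  shows "finite_moments M (\<lambda>x. f x + g x)"
  unfolding finite_moments_def
proof (intro conjI allI)
  note [measurable] = finite_moments_measurable[OF f] finite_moments_measurable[OF g]
  show "(\<lambda>x. f x + g x) \<in> borel_measurable M" by measurable
  fix p
  show "integrable M (\<lambda>x. \<bar>f x + g x\<bar> ^ p)"
  proof (rule Bochner_Integration.integrable_bound)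
    show "integrable M (\<lambda>x. 2 ^ p * (\<bar>f x\<bar> ^ p + \<bar>g x\<bar> ^ p))"
      using f g by (auto simp: finite_moments_def)
    have "\<bar>a + b\<bar> ^ p \<le> 2 ^ p * (\<bar>a\<bar> ^ p + \<bar>b\<bar> ^ p)" for a b :: real
    proof -
      have "\<bar>a + b\<bar> ^ p \<le> (2 * max \<bar>a\<bar> \<bar>b\<bar>) ^ p"
        by (intro power_mono) auto
      also have "\<dots> \<le> 2 ^ p * (\<bar>a\<bar> ^ p + \<bar>b\<bar> ^ p)"
        by (simp add: power_mult_distrib max_def)
      finally show ?thesis .
    qed
    then show "AE x in M. norm (\<bar>f x + g x\<bar> ^ p) \<le> norm (2 ^ p * (\<bar>f x\<bar> ^ p + \<bar>g x\<bar> ^ p))"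
      by simp
  qed measurable
qed

text \<open>The order-\<open>p\<close> moment of a product is controlled by the
  order-\<open>2 * p\<close> moments of the factors, which is why all orders are required at
  once.\<close>

lemma finite_moments_mult:
  assumes f: "finite_moments M f" and g: "finite_moments M g"
  shows "finite_moments M (\<lambda>x. f x * g x)"
  unfolding finite_moments_def
proof (intro conjI allI)
  note [measurable] = finite_moments_measurable[OF f] finite_moments_measurable[OF g]
  show "(\<lambda>x. f x * g x) \<in> borel_measurable M" by measurable
  fix p
  show "integrable M (\<lambda>x. \<bar>f x * g x\<bar> ^ p)"
  proof (rule Bochner_Integration.integrable_bound)
    show "integrable M (\<lambda>x. \<bar>f x\<bar> ^ (2 * p) + \<bar>g x\<bar> ^ (2 * p))"
      using f g by (simp add: finite_moments_def)
    have "(a * b) ^ p \<le> a ^ (2 * p) + b ^ (2 * p)" for a b :: real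
    proof -
      have "0 \<le> (a ^ p - b ^ p)\<^sup>2" "0 \<le> (a ^ p)\<^sup>2" "0 \<le> (b ^ p)\<^sup>2"
        by simp_all
      then have "a ^ p * b ^ p \<le> (a ^ p)\<^sup>2 + (b ^ p)\<^sup>2"
        unfolding power2_diff by linarith
      then show ?thesis by (simp add: power_mult_distrib power_mult[symmetric] mult.commute)
    qed
    from this[of "\<bar>f _\<bar>" "\<bar>g _\<bar>"]
    show "AE x in M. norm (\<bar>f x * g x\<bar> ^ p) \<le> norm (\<bar>f x\<bar> ^ (2 * p) + \<bar>g x\<bar> ^ (2 * p))"
      by (simp add: abs_mult)
  qed measurable
qed

lemma finite_moments_sum:
  assumes "prob_space M" "\<And>i. i \<in> A \<Longrightarrow> finite_moments M (f i)"
  shows "finite_moments M (\<lambda>x. \<Sum>i\<in>A. f i x)"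
  using assms(2) by (induction A rule: infinite_finite_induct)
    (auto intro: finite_moments_add finite_moments_const assms(1))

lemma finite_moments_prod:
  assumes "prob_space M" "\<And>i. i \<in> A \<Longrightarrow> finite_moments M (f i)"
  shows "finite_moments M (\<lambda>x. \<Prod>i\<in>A. f i x)"
  using assms(2) by (induction A rule: infinite_finite_induct)
    (auto intro: finite_moments_mult finite_moments_const assms(1))

lemma finite_moments_power:
  assumes "prob_space M" "finite_moments M f"
  shows "finite_moments M (\<lambda>x. f x ^ p)"
  using finite_moments_prod[OF assms(1), of "{..<p}" "\<lambda>_. f"] assms(2) by simp

lemma finite_moments_distr:
  assumes "distr M M' g = M'" "g \<in> M \<rightarrow>\<^sub>M M'" "finite_moments M' f"
  shows "finite_moments M (\<lambda>x. f (g x))"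
proof -
  have f: "f \<in> borel_measurable M'" using assms(3) by (rule finite_moments_measurable)
  have "integrable M (\<lambda>x. \<bar>f (g x)\<bar> ^ p)" for p
  proof -
    have "integrable (distr M M' g) (\<lambda>x. \<bar>f x\<bar> ^ p)"
      using assms(1,3) by (simp add: finite_moments_def)
    then show ?thesis
      using f assms(2) by (subst (asm) integrable_distr_eq) auto
  qed
  then show ?thesis
    using measurable_compose[OF assms(2) f] by (auto simp: finite_moments_def)
qed

lemma finite_moments_PiM_component:
  assumes "\<And>i. i \<in> I \<Longrightarrow> prob_space (M i)" "i \<in> I" "finite_moments (M i) f"
  shows "finite_moments (PiM I M) (\<lambda>x. f (x i))"
  using assms by (intro finite_moments_distr[OF distr_PiM_component]) auto

lemmas finite_moments_intros =
  finite_moments_const finite_moments_add finite_moments_mult finite_moments_sum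
  finite_moments_prod finite_moments_power

section \<open>Moments of Gaussian vectors\<close>

definition gauss :: "real \<Rightarrow> real measure" where
  "gauss \<epsilon> = density lborel (normal_density 0 (sqrt \<epsilon>))"

definition gauss_moment :: "real \<Rightarrow> nat \<Rightarrow> real" where
  "gauss_moment \<epsilon> q = (\<integral>x. x ^ q \<partial>gauss \<epsilon>)"

lemma sets_gauss [measurable_cong]: "sets (gauss \<epsilon>) = sets borel"
  by (simp add: gauss_def)

lemma prob_space_gauss: "\<epsilon> > 0 \<Longrightarrow> prob_space (gauss \<epsilon>)"
  unfolding gauss_def by (intro prob_space_normal_density) simp

lemma finite_moments_gauss:
  assumes "\<epsilon> > 0" shows "finite_moments (gauss \<epsilon>) (\<lambda>x. x)"
  unfolding finite_moments_def gauss_def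
  using integrable_normal_moment_abs[of "sqrt \<epsilon>" 0] assms
  by (auto simp: integrable_real_density normal_density_nonneg)

lemma gauss_moment_even:
  assumes "\<epsilon> > 0"
  shows "gauss_moment \<epsilon> (2 * p) = fact (2 * p) / ((2 / \<epsilon>) ^ p * fact p)"
  using integral_normal_moment_even[of "sqrt \<epsilon>" 0 p] assms
  by (simp add: gauss_moment_def gauss_def integral_real_density normal_density_nonneg)

lemma gauss_moment_odd:
  assumes "\<epsilon> > 0"
  shows "gauss_moment \<epsilon> (Suc (2 * p)) = 0"
  using integral_normal_moment_odd[of "sqrt \<epsilon>" 0 p] assms
  by (simp add: gauss_moment_def gauss_def integral_real_density normal_density_nonneg)

lemma gauss_moment_0 [simp]: "\<epsilon> > 0 \<Longrightarrow> gauss_moment \<epsilon> 0 = 1"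
  using gauss_moment_even[of \<epsilon> 0] by simp

lemma gauss_moment_Suc_Suc:
  assumes "\<epsilon> > 0"
  shows "gauss_moment \<epsilon> (Suc (Suc q)) = \<epsilon> * real (Suc q) * gauss_moment \<epsilon> q"
proof (cases "even q")
  case True
  then obtain p where q: "q = 2 * p" by blast
  have cancel: "2 * c * d * F / (2 / \<epsilon> * X * (c * G)) = \<epsilon> * d * (F / (X * G))" if "c > 0" for c d F X G :: real
    using that assms by simp
  have "fact (2 * Suc p) = 2 * real (Suc p) * real (Suc q) * fact (2 * p)"
    by (simp add: q algebra_simps)
  then show ?thesis
    using cancel[of "real (Suc p)" "real (Suc q)" "fact (2 * p)" "(2 / \<epsilon>) ^ p" "fact p"]
      gauss_moment_even[OF assms, of "Suc p"] gauss_moment_even[OF assms, of p] by (simp add: q mult.assoc)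
next
  case False
  then obtain p where q: "q = Suc (2 * p)" by (metis oddE Suc_eq_plus1)
  have "Suc (Suc q) = Suc (2 * Suc p)" using q by simp
  then show ?thesis
    unfolding q using assms by (simp only: gauss_moment_odd mult_zero_right)
qed

text \<open>Gaussian integration by parts on monomials. At \<open>q = 0\<close> the truncated
  \<open>q - 1\<close> is harmless because the factor \<open>real q\<close> vanishes.\<close>

lemma gauss_moment_Suc:
  assumes "\<epsilon> > 0"
  shows "gauss_moment \<epsilon> (Suc q) = \<epsilon> * real q * gauss_moment \<epsilon> (q - 1)"
  using gauss_moment_odd[OF assms, of 0] gauss_moment_Suc_Suc[OF assms] by (cases q) auto

text \<open>This is (2p - 1)!! \<le> p^p. The induction step needs (2p + 1) p^p \<le> (p + 1)^(p +
  1), which follows from (1 + 1/p)^p \<ge> 2, a case of Bernoulli's inequality.\<close>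

lemma gauss_moment_le:
  assumes "\<epsilon> > 0"
  shows "gauss_moment \<epsilon> (2 * p) \<le> (\<epsilon> * real p) ^ p"
proof (induction p)
  case 0
  then show ?case using assms by simp
next
  case (Suc p)
  have "gauss_moment \<epsilon> (2 * Suc p) = \<epsilon> * real (Suc (2 * p)) * gauss_moment \<epsilon> (2 * p)"
    using gauss_moment_Suc_Suc[OF assms, of "2 * p"] by simp
  also have "\<dots> \<le> \<epsilon> * real (Suc (2 * p)) * (\<epsilon> * real p) ^ p"
    using Suc assms by (intro mult_left_mono) auto
  also have "\<dots> = \<epsilon> ^ Suc p * (real (Suc (2 * p)) * real p ^ p)"
    by (simp add: power_mult_distrib)
  also have "\<dots> \<le> \<epsilon> ^ Suc p * real (Suc p) ^ Suc p"
  proof (intro mult_left_mono)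
    show "real (Suc (2 * p)) * real p ^ p \<le> real (Suc p) ^ Suc p"
    proof (cases "p = 0")
      case False
      have "2 * real p ^ p = (1 + real p * (1 / real p)) * real p ^ p"
        using False by simp
      also have "\<dots> \<le> (1 + 1 / real p) ^ p * real p ^ p"
        by (intro mult_right_mono Bernoulli_inequality) (auto intro: order_trans[of _ 0])
      also have "\<dots> = real (Suc p) ^ p"
        using False by (simp add: power_mult_distrib[symmetric] field_simps)
      finally have "real (Suc p) * (2 * real p ^ p) \<le> real (Suc p) * real (Suc p) ^ p"
        by (intro mult_left_mono) auto
      moreover have "real (Suc (2 * p)) * real p ^ p \<le> real (Suc p) * (2 * real p ^ p)"
        by (simp add: algebra_simps)
      ultimately show ?thesis unfolding power_Suc by linarith
    qed simp
  qed (use assms in auto)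
  also have "\<dots> = (\<epsilon> * real (Suc p)) ^ Suc p"
    by (simp add: power_mult_distrib)
  finally show ?case .
qed

section \<open>Wick's formula for linear forms in independent Gaussians\<close>

definition gauss_prod :: "nat \<Rightarrow> real \<Rightarrow> (nat \<Rightarrow> real) measure" where
  "gauss_prod N \<epsilon> = (\<Pi>\<^sub>M b\<in>{..<N}. gauss \<epsilon>)"

lemma prob_space_gauss_prod: "\<epsilon> > 0 \<Longrightarrow> prob_space (gauss_prod N \<epsilon>)"
  unfolding gauss_prod_def by (intro prob_space_PiM prob_space_gauss)

lemma finite_moments_gauss_prod:
  assumes "\<epsilon> > 0" "b < N" shows "finite_moments (gauss_prod N \<epsilon>) (\<lambda>x. x b)"
  unfolding gauss_prod_def using assms
  by (intro finite_moments_PiM_component[where f = "\<lambda>x. x"] prob_space_gauss finite_moments_gauss) auto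

lemma gauss_prod_monomial:
  assumes "\<epsilon> > 0"
  shows "(\<integral>x. (\<Prod>b<N. x b ^ e b) \<partial>gauss_prod N \<epsilon>) = (\<Prod>b<N. gauss_moment \<epsilon> (e b))"
proof -
  interpret product_sigma_finite "\<lambda>_. gauss \<epsilon>"
    by (intro product_sigma_finite.intro prob_space_imp_sigma_finite prob_space_gauss assms)
  show ?thesis
    unfolding gauss_prod_def gauss_moment_def
    using finite_moments_integrable[OF finite_moments_power[OF prob_space_gauss finite_moments_gauss]] assms
    by (intro product_integral_prod) auto
qed

lemma prod_coord_eq:
  fixes x :: "'b \<Rightarrow> real"
  assumes "finite J" "finite B" "f \<in> J \<rightarrow> B"
  shows "(\<Prod>j\<in>J. x (f j)) = (\<Prod>b\<in>B. x b ^ card {j\<in>J. f j = b})"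
proof -
  have "(\<Prod>j\<in>J. x (f j)) = (\<Prod>b\<in>B. \<Prod>j | j \<in> J \<and> f j = b. x (f j))"
    using assms by (intro prod.group[symmetric]) auto
  also have "\<dots> = (\<Prod>b\<in>B. x b ^ card {j\<in>J. f j = b})"
    by (intro prod.cong refl) simp
  finally show ?thesis .
qed

text \<open>Integration by parts in coordinate \<open>b\<close> alone: the factor c from lowering
  the exponent c of \<open>x b\<close> is spread over the c indices \<open>j\<close> with
  \<open>f j = b\<close>, so that it reads as a sum over contractions.\<close>

lemma wick_coord:
  assumes \<epsilon>: "\<epsilon> > 0" and J: "finite J" and f: "f \<in> J \<rightarrow> {..<N}" and b: "b < N"
  shows "(\<integral>x. x b * (\<Prod>j\<in>J. x (f j)) \<partial>gauss_prod N \<epsilon>) =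
    \<epsilon> * (\<Sum>j\<in>J. of_bool (f j = b) * (\<integral>x. (\<Prod>i\<in>J - {j}. x (f i)) \<partial>gauss_prod N \<epsilon>))"
proof -
  let ?c = "\<lambda>b'. card {j\<in>J. f j = b'}"
  let ?rest = "\<Prod>b'\<in>{..<N} - {b}. gauss_moment \<epsilon> (?c b')"
  have "x b * (\<Prod>j\<in>J. x (f j)) = (\<Prod>b'<N. x b' ^ (?c b' + of_bool (b' = b)))" for x :: "nat \<Rightarrow> real"
  proof -
    have "(\<Prod>b'<N. x b' ^ of_bool (b' = b)) = x b"
      using b by (subst prod.remove[of _ b]) auto
    then show ?thesis
      by (simp add: prod_coord_eq[OF J _ f] power_add prod.distrib)
  qed
  then have "(\<integral>x. x b * (\<Prod>j\<in>J. x (f j)) \<partial>gauss_prod N \<epsilon>)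
      = (\<Prod>b'<N. gauss_moment \<epsilon> (?c b' + of_bool (b' = b)))"
    by (simp add: gauss_prod_monomial[OF \<epsilon>])
  also have "\<dots> = gauss_moment \<epsilon> (Suc (?c b)) * ?rest"
    using b by (subst prod.remove[of _ b]) (auto intro!: prod.cong)
  also have "\<dots> = \<epsilon> * (real (?c b) * (gauss_moment \<epsilon> (?c b - 1) * ?rest))"
    by (simp add: gauss_moment_Suc[OF \<epsilon>])
  also have "real (?c b) * (gauss_moment \<epsilon> (?c b - 1) * ?rest) =
      (\<Sum>j | j \<in> J \<and> f j = b. gauss_moment \<epsilon> (?c b - 1) * ?rest)"
    by simp
  also have "\<dots> = (\<Sum>j | j \<in> J \<and> f j = b. (\<integral>x. (\<Prod>i\<in>J - {j}. x (f i)) \<partial>gauss_prod N \<epsilon>))"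
  proof (intro sum.cong refl)
    fix j assume "j \<in> {j. j \<in> J \<and> f j = b}"
    then have j: "j \<in> J" "f j = b" by auto
    \<comment> \<open>Removing \<open>j\<close> lowers only the exponent of coordinate
      \<open>b\<close>, and \<open>j\<close> itself shows that this exponent was positive, so the
      subtraction is exact.\<close>
    have card: "card {i\<in>J - {j}. f i = b'} = ?c b' - of_bool (b' = b)" for b'
    proof (cases "b' = b")
      case True
      then have "{i\<in>J - {j}. f i = b'} = {i\<in>J. f i = b'} - {j}" by auto
      then show ?thesis using True j J by (simp add: card_Diff_singleton)
    next
      case False
      then have "{i\<in>J - {j}. f i = b'} = {i\<in>J. f i = b'}" using j by auto
      then show ?thesis using False by simp
    qed
    have "(\<integral>x. (\<Prod>i\<in>J - {j}. x (f i)) \<partial>gauss_prod N \<epsilon>) = (\<Prod>b'<N. gauss_moment \<epsilon> (?c b' - of_bool (b' = b)))"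
      using J f by (subst prod_coord_eq[where B = "{..<N}"]) (auto simp only: gauss_prod_monomial[OF \<epsilon>] card)
    also have "\<dots> = gauss_moment \<epsilon> (?c b - 1) * ?rest"
      using b by (subst prod.remove[of _ b]) (auto intro!: prod.cong)
    finally show "gauss_moment \<epsilon> (?c b - 1) * ?rest = (\<integral>x. (\<Prod>i\<in>J - {j}. x (f i)) \<partial>gauss_prod N \<epsilon>)" ..
  qed
  also have "\<dots> = (\<Sum>j\<in>J. of_bool (f j = b) * (\<integral>x. (\<Prod>i\<in>J - {j}. x (f i)) \<partial>gauss_prod N \<epsilon>))"
    using J by (intro sum.mono_neutral_cong_left) auto
  finally show ?thesis .
qed

text \<open>Since \<open>g\<close> ignores coordinate \<open>j\<close>, prescribing
  \<open>f j\<close> removes that coordinate from the sum. This is how contracting \<open>j\<close>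
  drops its form from the product.\<close>

lemma sum_PiE_fixed_coord:
  fixes g :: "('a \<Rightarrow> 'b) \<Rightarrow> real"
  assumes "finite J" "finite B" "j \<in> J" "b \<in> B"
    and g: "\<And>f y. g (f(j := y)) = g f"
  shows "(\<Sum>f\<in>J \<rightarrow>\<^sub>E B. of_bool (f j = b) * g f) = (\<Sum>f\<in>J - {j} \<rightarrow>\<^sub>E B. g f)"
proof -
  have "J \<rightarrow>\<^sub>E B = insert j (J - {j}) \<rightarrow>\<^sub>E B"
    using assms(3) by (simp add: insert_absorb)
  also have "\<dots> = (\<lambda>(y, f). f(j := y)) ` (B \<times> (J - {j} \<rightarrow>\<^sub>E B))"
    by (rule PiE_insert_eq)
  finally have "(\<Sum>f\<in>J \<rightarrow>\<^sub>E B. of_bool (f j = b) * g f) =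
      (\<Sum>(y, f)\<in>B \<times> (J - {j} \<rightarrow>\<^sub>E B). of_bool (y = b) * g f)"
    using inj_combinator[of j "J - {j}" "\<lambda>_. B"]
    by (simp add: sum.reindex case_prod_unfold g)
  also have "\<dots> = (\<Sum>y\<in>B. of_bool (y = b) * (\<Sum>f\<in>J - {j} \<rightarrow>\<^sub>E B. g f))"
    by (simp add: sum.cartesian_product[symmetric] sum_distrib_left)
  also have "\<dots> = (\<Sum>f\<in>J - {j} \<rightarrow>\<^sub>E B. g f)"
    using assms(2,4) by (simp add: of_bool_def if_distrib[of "\<lambda>c. c * _"] cong: if_cong)
  finally show ?thesis .
qed

definition lin_form :: "nat \<Rightarrow> (nat \<Rightarrow> real) \<Rightarrow> (nat \<Rightarrow> real) \<Rightarrow> real" where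
  "lin_form N A x = (\<Sum>b<N. A b * x b)"

lemma prod_lin_form:
  assumes "finite J"
  shows "(\<Prod>j\<in>J. lin_form N (A j) x) =
    (\<Sum>f\<in>J \<rightarrow>\<^sub>E {..<N}. (\<Prod>j\<in>J. A j (f j)) * (\<Prod>j\<in>J. x (f j)))"
  unfolding lin_form_def using assms by (subst prod_sum_PiE) (auto simp: prod.distrib)

lemma finite_moments_lin_form:
  assumes "\<epsilon> > 0" shows "finite_moments (gauss_prod N \<epsilon>) (lin_form N A)"
  unfolding lin_form_def[abs_def] using assms
  by (intro finite_moments_intros prob_space_gauss_prod finite_moments_gauss_prod) auto

lemma integral_mult_prod_lin_form:
  assumes \<epsilon>: "\<epsilon> > 0" and J: "finite J" and g: "finite_moments (gauss_prod N \<epsilon>) g"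
  shows "(\<integral>x. g x * (\<Prod>j\<in>J. lin_form N (A j) x) \<partial>gauss_prod N \<epsilon>) =
    (\<Sum>f\<in>J \<rightarrow>\<^sub>E {..<N}. (\<Prod>j\<in>J. A j (f j)) * (\<integral>x. g x * (\<Prod>j\<in>J. x (f j)) \<partial>gauss_prod N \<epsilon>))"
proof -
  have int: "integrable (gauss_prod N \<epsilon>) (\<lambda>x. g x * (\<Prod>j\<in>J. x (f j)))" if "f \<in> J \<rightarrow>\<^sub>E {..<N}" for f
    using that \<epsilon> by (intro finite_moments_integrable finite_moments_intros g prob_space_gauss_prod
      finite_moments_gauss_prod) auto
  have "(\<integral>x. g x * (\<Prod>j\<in>J. lin_form N (A j) x) \<partial>gauss_prod N \<epsilon>) =
      (\<integral>x. (\<Sum>f\<in>J \<rightarrow>\<^sub>E {..<N}. (\<Prod>j\<in>J. A j (f j)) * (g x * (\<Prod>j\<in>J. x (f j)))) \<partial>gauss_prod N \<epsilon>)"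
    by (simp add: prod_lin_form[OF J] sum_distrib_left mult_ac)
  also have "\<dots> = (\<Sum>f\<in>J \<rightarrow>\<^sub>E {..<N}. (\<integral>x. (\<Prod>j\<in>J. A j (f j)) * (g x * (\<Prod>j\<in>J. x (f j))) \<partial>gauss_prod N \<epsilon>))"
    using int by (intro Bochner_Integration.integral_sum) auto
  finally show ?thesis by simp
qed

text \<open>Both sides are multilinear in the coefficient vectors, so expanding every form reduces
  the claim to \<open>wick_coord\<close>.\<close>

lemma wick:
  assumes \<epsilon>: "\<epsilon> > 0" and J: "finite J"
  shows "(\<integral>x. lin_form N B x * (\<Prod>j\<in>J. lin_form N (A j) x) \<partial>gauss_prod N \<epsilon>) =
    \<epsilon> * (\<Sum>j\<in>J. (\<Sum>b<N. B b * A j b) * (\<integral>x. (\<Prod>i\<in>J - {j}. lin_form N (A i) x) \<partial>gauss_prod N \<epsilon>))"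
proof -
  let ?E = "\<lambda>g. integral\<^sup>L (gauss_prod N \<epsilon>) g"
  note one = finite_moments_const[OF prob_space_gauss_prod[OF \<epsilon>], of _ 1]
  have coord: "?E (\<lambda>x. x b * (\<Prod>j\<in>J. lin_form N (A j) x)) =
      \<epsilon> * (\<Sum>j\<in>J. A j b * ?E (\<lambda>x. \<Prod>i\<in>J - {j}. lin_form N (A i) x))" if b: "b < N" for b
  proof -
    have "?E (\<lambda>x. x b * (\<Prod>j\<in>J. lin_form N (A j) x)) =
        (\<Sum>f\<in>J \<rightarrow>\<^sub>E {..<N}. (\<Prod>j\<in>J. A j (f j)) * ?E (\<lambda>x. x b * (\<Prod>j\<in>J. x (f j))))"
      by (intro integral_mult_prod_lin_form \<epsilon> J finite_moments_gauss_prod b)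
    also have "\<dots> = (\<Sum>f\<in>J \<rightarrow>\<^sub>E {..<N}. (\<Prod>j\<in>J. A j (f j)) *
        (\<epsilon> * (\<Sum>j\<in>J. of_bool (f j = b) * ?E (\<lambda>x. \<Prod>i\<in>J - {j}. x (f i)))))"
      by (intro sum.cong refl arg_cong2[where f = times] wick_coord \<epsilon> J b) (simp add: PiE_iff)
    also have "\<dots> = \<epsilon> * (\<Sum>j\<in>J. \<Sum>f\<in>J \<rightarrow>\<^sub>E {..<N}. of_bool (f j = b) *
        ((\<Prod>j\<in>J. A j (f j)) * ?E (\<lambda>x. \<Prod>i\<in>J - {j}. x (f i))))"
      by (subst sum.swap) (simp add: sum_distrib_left mult_ac)
    also have "\<dots> = \<epsilon> * (\<Sum>j\<in>J. A j b * ?E (\<lambda>x. \<Prod>i\<in>J - {j}. lin_form N (A i) x))"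
    proof (intro arg_cong2[where f = times] sum.cong refl)
      fix j assume j: "j \<in> J"
      have "(\<Sum>f\<in>J \<rightarrow>\<^sub>E {..<N}. of_bool (f j = b) *
          ((\<Prod>i\<in>J. A i (f i)) * ?E (\<lambda>x. \<Prod>i\<in>J - {j}. x (f i))))
          = (\<Sum>f\<in>J \<rightarrow>\<^sub>E {..<N}. of_bool (f j = b) *
          (A j b * ((\<Prod>i\<in>J - {j}. A i (f i)) * ?E (\<lambda>x. \<Prod>i\<in>J - {j}. x (f i)))))"
        using j J by (intro sum.cong refl) (auto simp: prod.remove of_bool_def)
      also have "\<dots> = (\<Sum>f\<in>J - {j} \<rightarrow>\<^sub>E {..<N}.
          A j b * ((\<Prod>i\<in>J - {j}. A i (f i)) * ?E (\<lambda>x. \<Prod>i\<in>J - {j}. x (f i))))"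
        using J j b by (intro sum_PiE_fixed_coord)
          (auto intro!: arg_cong2[where f = times] prod.cong Bochner_Integration.integral_cong)
      also have "\<dots> = A j b * ?E (\<lambda>x. \<Prod>i\<in>J - {j}. lin_form N (A i) x)"
        using integral_mult_prod_lin_form[OF \<epsilon> _ one, of "J - {j}" N A] J by (simp add: sum_distrib_left)
      finally show "(\<Sum>f\<in>J \<rightarrow>\<^sub>E {..<N}. of_bool (f j = b) *
          ((\<Prod>i\<in>J. A i (f i)) * ?E (\<lambda>x. \<Prod>i\<in>J - {j}. x (f i)))) =
          A j b * ?E (\<lambda>x. \<Prod>i\<in>J - {j}. lin_form N (A i) x)" .
    qed
    finally show ?thesis .
  qed
  have "?E (\<lambda>x. lin_form N B x * (\<Prod>j\<in>J. lin_form N (A j) x)) =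
      ?E (\<lambda>x. \<Sum>b<N. B b * (x b * (\<Prod>j\<in>J. lin_form N (A j) x)))"
    by (simp add: lin_form_def[of N B] sum_distrib_right mult.assoc)
  also have "\<dots> = (\<Sum>b<N. ?E (\<lambda>x. B b * (x b * (\<Prod>j\<in>J. lin_form N (A j) x))))"
    using \<epsilon> by (intro Bochner_Integration.integral_sum finite_moments_integrable finite_moments_intros
      prob_space_gauss_prod finite_moments_gauss_prod finite_moments_lin_form) auto
  also have "\<dots> = (\<Sum>b<N. B b * (\<epsilon> * (\<Sum>j\<in>J. A j b * ?E (\<lambda>x. \<Prod>i\<in>J - {j}. lin_form N (A i) x))))"
    by (intro sum.cong refl) (simp add: coord)
  also have "\<dots> = \<epsilon> * (\<Sum>j\<in>J. (\<Sum>b<N. B b * A j b) * ?E (\<lambda>x. \<Prod>i\<in>J - {j}. lin_form N (A i) x))"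
    unfolding sum_distrib_left sum_distrib_right by (subst sum.swap) (simp add: mult_ac)
  finally show ?thesis .
qed

section \<open>Orthonormal forms behave like independent Gaussians\<close>

text \<open>Wick's formula sees the coefficient vectors only through inner products and leads to
  smaller products, so induction applies. It lets orthonormal rows be exchanged for the standard
  basis.\<close>

lemma gauss_moments_determined_by_gram:
  assumes \<epsilon>: "\<epsilon> > 0" and J: "finite J"
    and gram: "\<And>i j. i \<in> J \<Longrightarrow> j \<in> J \<Longrightarrow> (\<Sum>b<N. A i b * A j b) = (\<Sum>b<N. A' i b * A' j b)"
  shows "(\<integral>x. (\<Prod>j\<in>J. lin_form N (A j) x) \<partial>gauss_prod N \<epsilon>) =
    (\<integral>x. (\<Prod>j\<in>J. lin_form N (A' j) x) \<partial>gauss_prod N \<epsilon>)"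
  using J gram
proof (induction J rule: finite_psubset_induct)
  case (psubset J)
  show ?case
  proof (cases "J = {}")
    case False
    then obtain i where i: "i \<in> J" by blast
    have fin: "finite (J - {i})" using psubset.hyps by simp
    have split: "(\<Prod>j\<in>J. lin_form N (C j) x) = lin_form N (C i) x * (\<Prod>j\<in>J - {i}. lin_form N (C j) x)"
      for C :: "'a \<Rightarrow> nat \<Rightarrow> real" and x
      using i psubset.hyps by (simp add: prod.remove)
    show ?thesis
      unfolding split wick[OF \<epsilon> fin]
    proof (intro arg_cong[where f = "times \<epsilon>"] sum.cong refl)
      fix j assume j: "j \<in> J - {i}"
      then have "(\<Sum>b<N. A i b * A j b) = (\<Sum>b<N. A' i b * A' j b)"
        using i by (intro psubset.prems) auto
      moreover have "(\<integral>x. (\<Prod>j\<in>J - {i} - {j}. lin_form N (A j) x) \<partial>gauss_prod N \<epsilon>) =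
          (\<integral>x. (\<Prod>j\<in>J - {i} - {j}. lin_form N (A' j) x) \<partial>gauss_prod N \<epsilon>)"
        using i by (intro psubset.IH psubset.prems) auto
      ultimately show "(\<Sum>b<N. A i b * A j b) * (\<integral>x. (\<Prod>j\<in>J - {i} - {j}. lin_form N (A j) x) \<partial>gauss_prod N \<epsilon>) =
          (\<Sum>b<N. A' i b * A' j b) * (\<integral>x. (\<Prod>j\<in>J - {i} - {j}. lin_form N (A' j) x) \<partial>gauss_prod N \<epsilon>)"
        by simp
    qed
  qed simp
qed

lemma orthonormal_moments:
  assumes \<epsilon>: "\<epsilon> > 0"
    and orth: "\<And>i j. i < N \<Longrightarrow> j < N \<Longrightarrow> (\<Sum>b<N. A i b * A j b) = of_bool (i = j)"
  shows "(\<integral>x. (\<Prod>i<N. lin_form N (A i) x ^ e i) \<partial>gauss_prod N \<epsilon>) = (\<Prod>i<N. gauss_moment \<epsilon> (e i))"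
proof -
  \<comment> \<open>The exponent \<open>e i\<close> is encoded as \<open>e i\<close> copies of the
    form with index \<open>i\<close>, because Wick's formula speaks of plain products.\<close>
  let ?J = "SIGMA i:{..<N}. {..<e i}"
  let ?I = "\<lambda>i b. of_bool (b = i) :: real"
  have eq: "(\<Prod>i<N. lin_form N (C i) x ^ e i) = (\<Prod>j\<in>?J. lin_form N (C (fst j)) x)" for C x
    using prod.Sigma[of "{..<N}" "\<lambda>i. {..<e i}" "\<lambda>i _. lin_form N (C i) x"]
    by (simp add: case_prod_unfold)
  have I: "lin_form N (?I i) x = x i" if "i < N" for i x
    using that by (simp add: lin_form_def)
  have "(\<integral>x. (\<Prod>i<N. lin_form N (A i) x ^ e i) \<partial>gauss_prod N \<epsilon>) =
      (\<integral>x. (\<Prod>i<N. lin_form N (?I i) x ^ e i) \<partial>gauss_prod N \<epsilon>)"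
    unfolding eq using \<epsilon> by (intro gauss_moments_determined_by_gram) (auto simp: orth)
  also have "\<dots> = (\<integral>x. (\<Prod>i<N. x i ^ e i) \<partial>gauss_prod N \<epsilon>)"
    by (intro Bochner_Integration.integral_cong refl prod.cong) (auto simp: I)
  finally show ?thesis
    by (simp add: gauss_prod_monomial[OF \<epsilon>])
qed

text \<open>Independence for polynomials: after distributing the product over the sums, each joint
  moment factorises by \<open>orthonormal_moments\<close>.\<close>

lemma orthonormal_prod_poly:
  assumes \<epsilon>: "\<epsilon> > 0" and D: "finite D"
    and orth: "\<And>i j. i < N \<Longrightarrow> j < N \<Longrightarrow> (\<Sum>b<N. A i b * A j b) = of_bool (i = j)"
  shows "(\<integral>x. (\<Prod>i<N. \<Sum>t\<in>D. c t * lin_form N (A i) x ^ e t) \<partial>gauss_prod N \<epsilon>) =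
    (\<Sum>t\<in>D. c t * gauss_moment \<epsilon> (e t)) ^ N"
proof -
  let ?E = "\<lambda>g. integral\<^sup>L (gauss_prod N \<epsilon>) g"
  have "?E (\<lambda>x. \<Prod>i<N. \<Sum>t\<in>D. c t * lin_form N (A i) x ^ e t) =
      ?E (\<lambda>x. \<Sum>g\<in>{..<N} \<rightarrow>\<^sub>E D. (\<Prod>i<N. c (g i)) * (\<Prod>i<N. lin_form N (A i) x ^ e (g i)))"
    using D by (simp add: prod_sum_PiE prod.distrib)
  also have "\<dots> = (\<Sum>g\<in>{..<N} \<rightarrow>\<^sub>E D. ?E (\<lambda>x. (\<Prod>i<N. c (g i)) * (\<Prod>i<N. lin_form N (A i) x ^ e (g i))))"
    using \<epsilon> by (intro Bochner_Integration.integral_sum finite_moments_integrable finite_moments_intros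
      prob_space_gauss_prod finite_moments_lin_form) auto
  also have "\<dots> = (\<Sum>g\<in>{..<N} \<rightarrow>\<^sub>E D. (\<Prod>i<N. c (g i) * gauss_moment \<epsilon> (e (g i))))"
    by (simp add: orthonormal_moments[OF \<epsilon> orth] prod.distrib)
  also have "\<dots> = (\<Prod>i<N. \<Sum>t\<in>D. c t * gauss_moment \<epsilon> (e t))"
    using D by (subst prod_sum_PiE) auto
  finally show ?thesis by simp
qed

section \<open>The Forrelation vector\<close>

lemma flip_bit_less:
  fixes b :: nat
  assumes "i < n" "b < 2 ^ n"
  shows "flip_bit i b < 2 ^ n"
proof -
  have "take_bit n (flip_bit i b) = flip_bit i b"
  proof (rule bit_eqI)
    fix j
    have "bit b j \<Longrightarrow> j < n"
      using assms(2) by (metis bit_take_bit_iff take_bit_nat_eq_self)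
    then show "bit (take_bit n (flip_bit i b)) j \<longleftrightarrow> bit (flip_bit i b) j"
      using assms(1) by (auto simp: bit_take_bit_iff bit_flip_bit_iff)
  qed
  then show ?thesis
    by (metis take_bit_nat_less_exp)
qed

text \<open>Two distinct rows differ in some bit \<open>i\<close>. Flipping bit \<open>i\<close> of
  the column index is an involution that negates the summand, so the sum equals its own
  negative.\<close>

lemma hadamard_orthonormal:
  assumes a: "a < 2 ^ n" and a': "a' < 2 ^ n"
  shows "(\<Sum>b<2 ^ n. hadamard n a b * hadamard n a' b) = of_bool (a = a')"
proof -
  define s where "s c b i = (-1 :: real) ^ (of_bool (bit c i) * of_bool (bit b i))" for c b i :: nat
  have h: "hadamard n c b = (\<Prod>i<n. s c b i) / sqrt (2 ^ n)" for c b
    unfolding hadamard_def s_def power_sum ..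
  have hh: "hadamard n a b * hadamard n a' b = (\<Prod>i<n. s a b i * s a' b i) / 2 ^ n" for b
    by (simp add: h prod.distrib)
  show ?thesis
  proof (cases "a = a'")
    case True
    have "s c b i * s c b i = 1" for c b i
      by (simp add: s_def power_add[symmetric] mult_2[symmetric])
    then show ?thesis using True unfolding hh by simp
  next
    case False
    have "\<exists>i<n. bit a i \<noteq> bit a' i"
    proof (rule ccontr)
      assume *: "\<not> ?thesis"
      have "bit c i \<Longrightarrow> i < n" if "c < 2 ^ n" for c i :: nat
        using that by (metis bit_take_bit_iff take_bit_nat_eq_self)
      then have "a = a'"
        using * a a' by (intro bit_eqI) metis
      with False show False by simp
    qed
    then obtain i where i: "i < n" "bit a i \<noteq> bit a' i" by blast
    let ?P = "\<lambda>b. \<Prod>i<n. s a b i * s a' b i"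
    have flip: "?P (flip_bit i b) = - ?P b" for b
    proof -
      have "?P c = (s a c i * s a' c i) * (\<Prod>j\<in>{..<n} - {i}. s a c j * s a' c j)" for c
        using i by (intro prod.remove) auto
      moreover have "(\<Prod>j\<in>{..<n} - {i}. s a (flip_bit i b) j * s a' (flip_bit i b) j) =
          (\<Prod>j\<in>{..<n} - {i}. s a b j * s a' b j)"
        by (intro prod.cong refl) (auto simp: s_def bit_flip_bit_iff)
      moreover have "s a (flip_bit i b) i * s a' (flip_bit i b) i = - (s a b i * s a' b i)"
        using i(2) by (auto simp: s_def bit_flip_bit_iff)
      ultimately show ?thesis by simp
    qed
    have invol: "flip_bit i (flip_bit i b) = b" for b :: nat
      by (rule bit_eqI) (auto simp: bit_flip_bit_iff)
    have "(\<Sum>b<2 ^ n. ?P b) = (\<Sum>b<2 ^ n. ?P (flip_bit i b))"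
      by (intro sum.reindex_bij_witness[where i = "flip_bit i" and j = "flip_bit i"])
        (simp_all add: invol flip_bit_less[OF i(1)])
    also have "\<dots> = - (\<Sum>b<2 ^ n. ?P b)"
      by (simp add: flip sum_negf)
    finally have "(\<Sum>b<2 ^ n. ?P b) = 0" by simp
    then show ?thesis
      unfolding hh using False by (simp add: sum_divide_distrib[symmetric])
  qed
qed

lemma abs_hadamard: "\<bar>hadamard n a b\<bar> = 1 / sqrt (2 ^ n)"
  by (simp add: hadamard_def power_abs)

section \<open>Covariances and moment recursion of the Forrelation vector\<close>

text \<open>Rows of the identity stacked on the Hadamard matrix: all 2N coordinates become linear
  forms in the same N Gaussians, so Wick's formula covers both halves jointly.\<close>

definition forr_row :: "nat \<Rightarrow> nat \<Rightarrow> nat \<Rightarrow> real" where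
  "forr_row n i b = (if i < 2 ^ n then of_bool (b = i) else hadamard n (i - 2 ^ n) b)"

definition forr_vec :: "nat \<Rightarrow> (nat \<Rightarrow> real) \<Rightarrow> nat \<Rightarrow> real" where
  "forr_vec n x i = lin_form (2 ^ n) (forr_row n i) x"

lemma forr_vec_eq:
  "forr_vec n x i = (if i < 2 ^ n then x i else (\<Sum>b<2 ^ n. hadamard n (i - 2 ^ n) b * x b))"
  by (simp add: forr_vec_def lin_form_def forr_row_def)

definition forr_moment :: "nat \<Rightarrow> real \<Rightarrow> nat set \<Rightarrow> real" where
  "forr_moment n \<epsilon> U = (\<integral>x. (\<Prod>i\<in>U. forr_vec n x i) \<partial>gauss_prod (2 ^ n) \<epsilon>)"

lemma forr_row_gram:
  fixes n
  defines "N \<equiv> 2 ^ n"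
  assumes "i < 2 * N" "j < 2 * N"
  shows "(\<Sum>b<N. forr_row n i b * forr_row n j b) =
    (if i < N \<longleftrightarrow> j < N then of_bool (i = j)
     else if i < N then hadamard n (j - N) i else hadamard n (i - N) j)"
proof -
  consider "i < N" "j < N" | "i < N" "\<not> j < N" | "\<not> i < N" "j < N" | "\<not> i < N" "\<not> j < N"
    by blast
  then show ?thesis
  proof cases
    case 4
    then have "(\<Sum>b<N. forr_row n i b * forr_row n j b) = of_bool (i - N = j - N)"
      using assms by (simp add: forr_row_def hadamard_orthonormal)
    then show ?thesis using 4 by auto
  qed (auto simp: forr_row_def N_def)
qed

text \<open>Wick's formula is applied with each element of \<open>U\<close> in the leading role and
  summed, hence \<open>card U\<close> on the left. As \<open>U\<close> contains no repetitions,
  pairs within one half have covariance 0. Each cross pair arises once from either side, which gives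
  the 2.\<close>

lemma forr_moment_rec:
  fixes n U
  defines "N \<equiv> 2 ^ n"
  assumes \<epsilon>: "\<epsilon> > 0" and U: "U \<subseteq> {..<2 * N}"
  shows "real (card U) * forr_moment n \<epsilon> U =
    2 * (\<Sum>(a, b)\<in>{..<N} \<times> {..<N}. of_bool (a \<in> U \<and> N + b \<in> U) *
          (\<epsilon> * (hadamard n b a * forr_moment n \<epsilon> (U - {a, N + b}))))"
proof -
  have fin: "finite U" using U finite_subset by blast
  let ?lo = "{i\<in>U. i < N}" and ?hi = "{i\<in>U. \<not> i < N}"
  \<comment> \<open>The contribution of contracting \<open>i\<close> with \<open>j\<close>.\<close>
  define g where "g i j = \<epsilon> * ((\<Sum>b<N. forr_row n i b * forr_row n j b) * forr_moment n \<epsilon> (U - {i, j}))" for i j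
  have step: "forr_moment n \<epsilon> U = (\<Sum>j\<in>U - {i}. g i j)" if i: "i \<in> U" for i
  proof -
    have "forr_moment n \<epsilon> U =
        (\<integral>x. lin_form N (forr_row n i) x * (\<Prod>j\<in>U - {i}. lin_form N (forr_row n j) x) \<partial>gauss_prod N \<epsilon>)"
      unfolding forr_moment_def forr_vec_def N_def using i fin by (simp add: prod.remove)
    also have "\<dots> = (\<Sum>j\<in>U - {i}. g i j)"
      using fin by (simp add: wick[OF \<epsilon>] g_def sum_distrib_left forr_moment_def
        forr_vec_def N_def Diff_insert2[of U i "{j}" for j])
    finally show ?thesis .
  qed
  have gram: "(\<Sum>b<N. forr_row n i b * forr_row n j b) =
    (if i < N \<longleftrightarrow> j < N then of_bool (i = j)
     else if i < N then hadamard n (j - N) i else hadamard n (i - N) j)" if "i \<in> U" "j \<in> U" for i j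
    using that U forr_row_gram[of i n j] unfolding N_def by blast
  have lo: "(\<Sum>j\<in>U - {i}. g i j) = (\<Sum>j\<in>?hi. g i j)" if "i \<in> ?lo" for i
    using fin that by (intro sum.mono_neutral_right) (auto simp: g_def gram)
  have hi: "(\<Sum>j\<in>U - {i}. g i j) = (\<Sum>j\<in>?lo. g i j)" if "i \<in> ?hi" for i
    using fin that by (intro sum.mono_neutral_right) (auto simp: g_def gram)
  have sym: "g i j = g j i" for i j
    by (simp add: g_def insert_commute mult.commute[of "forr_row n i _"])
  have "real (card U) * forr_moment n \<epsilon> U = (\<Sum>i\<in>U. \<Sum>j\<in>U - {i}. g i j)"
    by (simp add: step[symmetric])
  also have "\<dots> = (\<Sum>i\<in>?lo. \<Sum>j\<in>U - {i}. g i j) + (\<Sum>i\<in>?hi. \<Sum>j\<in>U - {i}. g i j)"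
    using fin by (subst sum.union_disjoint[symmetric]) (auto intro!: sum.cong)
  also have "\<dots> = (\<Sum>i\<in>?lo. \<Sum>j\<in>?hi. g i j) + (\<Sum>i\<in>?hi. \<Sum>j\<in>?lo. g i j)"
    by (intro arg_cong2[where f = plus] sum.cong refl lo hi)
  also have "(\<Sum>i\<in>?hi. \<Sum>j\<in>?lo. g i j) = (\<Sum>i\<in>?lo. \<Sum>j\<in>?hi. g i j)"
    by (subst sum.swap) (simp add: sym)
  also have "(\<Sum>i\<in>?lo. \<Sum>j\<in>?hi. g i j) = (\<Sum>(i, j)\<in>?lo \<times> ?hi. g i j)"
    by (rule sum.cartesian_product)
  also have "\<dots> = (\<Sum>(a, b)\<in>{(a, b). (a, b) \<in> {..<N} \<times> {..<N} \<and> a \<in> U \<and> N + b \<in> U}.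
      \<epsilon> * (hadamard n b a * forr_moment n \<epsilon> (U - {a, N + b})))"
    using U
    by (intro sum.reindex_bij_witness[where i = "\<lambda>(a, b). (a, N + b)" and j = "\<lambda>(a, b). (a, b - N)"])
      (auto simp: g_def gram)
  also have "\<dots> = (\<Sum>(a, b)\<in>{..<N} \<times> {..<N}. of_bool (a \<in> U \<and> N + b \<in> U) *
          (\<epsilon> * (hadamard n b a * forr_moment n \<epsilon> (U - {a, N + b}))))"
    by (intro sum.mono_neutral_cong_left) auto
  finally show ?thesis by simp
qed

text \<open>The scale \<open>s\<close> has density \<open>2 s\<close> on \<open>[0,1]\<close>, so that \<open>s\<^sup>2\<close> is uniform: averaging over \<open>s\<close> replaces
  integrating the heat equation over time.\<close>

definition scale_law :: "real measure" where
  "scale_law = density lborel (\<lambda>s. ennreal (2 * s * indicator {0..1} s))"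

text \<open>The law of the scale lives on all reals but is concentrated on [0,1]; clamping makes its
  bounds hold at every point, not just almost everywhere.\<close>

definition clamp :: "real \<Rightarrow> real" where
  "clamp s = (if s \<in> {0..1} then s else 0)"

lemma clamp_bounds: "0 \<le> clamp s" "clamp s \<le> 1"
  by (auto simp: clamp_def)

lemma clamp_measurable [measurable]: "clamp \<in> borel_measurable borel"
  unfolding clamp_def[abs_def] by measurable

lemma sets_scale_law [measurable_cong]: "sets scale_law = sets borel"
  by (simp add: scale_law_def)

text \<open>With q = |U| - 2 the value is 2 / |U|, exactly the factor that solves
  \<open>forr_moment_rec\<close> for the moment.\<close>

lemma integral_scale_law: "(\<integral>s. clamp s ^ q \<partial>scale_law) = 2 / (real q + 2)"
proof -
  have "(\<integral>s. clamp s ^ q \<partial>scale_law) = (\<integral>s. (2 * s * indicator {0..1} s) * clamp s ^ q \<partial>lborel)"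
    unfolding scale_law_def by (subst integral_real_density) (auto simp: indicator_def)
  also have "\<dots> = (\<integral>s. 2 * (s ^ Suc q * indicator {0..1} s) \<partial>lborel)"
    by (intro Bochner_Integration.integral_cong) (auto simp: clamp_def indicator_def)
  also have "\<dots> = 2 / (real q + 2)"
    using integral_power[of 0 1 "Suc q"] by (simp add: add.commute)
  finally show ?thesis .
qed

lemma prob_space_scale_law: "prob_space scale_law"
proof
  have "emeasure scale_law (space scale_law) = (\<integral>\<^sup>+s. ennreal (2 * s * indicator {0..1} s) \<partial>lborel)"
    by (simp add: scale_law_def emeasure_density)
  also have "\<dots> = ennreal (\<integral>s. 2 * s * indicator {0..1} s \<partial>lborel)"
  proof (rule nn_integral_eq_integral)
    have "integrable lborel (\<lambda>s. 2 * (s ^ 1 * indicator {0..1} s) :: real)"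
      by (intro integrable_mult_right borel_integrable_atLeastAtMost) auto
    then show "integrable lborel (\<lambda>s. 2 * s * indicator {0..1} s :: real)"
      by (simp add: mult.assoc)
  qed (auto simp: indicator_def)
  also have "(\<integral>s. 2 * s * indicator {0..1} s \<partial>lborel) = (1 :: real)"
    using integral_power[of 0 1 1] by (simp add: mult.assoc)
  finally show "emeasure scale_law (space scale_law) = 1" by simp
qed

section \<open>One block: an independent scale and Gaussian vector\<close>

definition block_law :: "nat \<Rightarrow> real \<Rightarrow> (real \<times> (nat \<Rightarrow> real)) measure" where
  "block_law n \<epsilon> = scale_law \<Otimes>\<^sub>M gauss_prod (2 ^ n) \<epsilon>"

lemma prob_space_block_law: "\<epsilon> > 0 \<Longrightarrow> prob_space (block_law n \<epsilon>)"
  unfolding block_law_def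
  using prob_space_scale_law prob_space_gauss_prod
  by (intro prob_space_pair)

lemma block_law_integral_mult:
  fixes f :: "real \<Rightarrow> real" and g :: "(nat \<Rightarrow> real) \<Rightarrow> real"
  assumes \<epsilon>: "\<epsilon> > 0" and f: "integrable scale_law f" and g: "integrable (gauss_prod (2 ^ n) \<epsilon>) g"
  shows "integrable (block_law n \<epsilon>) (\<lambda>w. f (fst w) * g (snd w))" (is ?int)
    and "(\<integral>w. f (fst w) * g (snd w) \<partial>block_law n \<epsilon>) =
    (\<integral>s. f s \<partial>scale_law) * (\<integral>x. g x \<partial>gauss_prod (2 ^ n) \<epsilon>)" (is ?eq)
proof -
  interpret S: prob_space scale_law by (rule prob_space_scale_law)
  interpret G: prob_space "gauss_prod (2 ^ n) \<epsilon>" by (rule prob_space_gauss_prod[OF \<epsilon>])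
  interpret pair_sigma_finite scale_law "gauss_prod (2 ^ n) \<epsilon>" ..
  have "integrable (scale_law \<Otimes>\<^sub>M gauss_prod (2 ^ n) \<epsilon>) (\<lambda>(s, x). f s * g x)"
    using f g by (intro Fubini_integrable) (auto simp: abs_mult)
  then show ?int ?eq
    unfolding block_law_def by (simp_all add: case_prod_unfold integral_fst'[symmetric])
qed

lemma block_law_finite_moments_fst:
  assumes \<epsilon>: "\<epsilon> > 0" and "f \<in> borel_measurable borel" "\<And>s. \<bar>f s\<bar> \<le> B"
  shows "finite_moments (block_law n \<epsilon>) (\<lambda>w. f (fst w))"
  using assms by (intro finite_moments_bounded[OF prob_space_block_law]) (auto simp: block_law_def)

lemma block_law_finite_moments_snd:
  assumes \<epsilon>: "\<epsilon> > 0" and "finite_moments (gauss_prod (2 ^ n) \<epsilon>) g"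
  shows "finite_moments (block_law n \<epsilon>) (\<lambda>w. g (snd w))"
proof -
  interpret S: prob_space scale_law by (rule prob_space_scale_law)
  have [measurable]: "g \<in> borel_measurable (gauss_prod (2 ^ n) \<epsilon>)"
    using assms(2) by (rule finite_moments_measurable)
  have "integrable (block_law n \<epsilon>) (\<lambda>w. \<bar>g (snd w)\<bar> ^ p)" for p
    using block_law_integral_mult(1)[OF \<epsilon>, of "\<lambda>_. 1" n "\<lambda>x. \<bar>g x\<bar> ^ p"] assms(2)
    by (simp add: finite_moments_def)
  moreover have "(\<lambda>w. g (snd w)) \<in> borel_measurable (block_law n \<epsilon>)"
    unfolding block_law_def by measurable
  ultimately show ?thesis by (simp add: finite_moments_def)
qed

lemma block_law_integral_snd:
  fixes g :: "(nat \<Rightarrow> real) \<Rightarrow> real"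
  assumes \<epsilon>: "\<epsilon> > 0" and g: "integrable (gauss_prod (2 ^ n) \<epsilon>) g"
  shows "(\<integral>w. g (snd w) \<partial>block_law n \<epsilon>) = (\<integral>x. g x \<partial>gauss_prod (2 ^ n) \<epsilon>)"
proof -
  interpret S: prob_space scale_law by (rule prob_space_scale_law)
  show ?thesis
    using block_law_integral_mult(2)[OF \<epsilon>, of "\<lambda>_. 1"] g by (simp add: S.prob_space)
qed

definition scaled_vec :: "nat \<Rightarrow> real \<times> (nat \<Rightarrow> real) \<Rightarrow> nat \<Rightarrow> real" where
  "scaled_vec n w i = clamp (fst w) * forr_vec n (snd w) i"

lemma finite_moments_forr_vec:
  assumes "\<epsilon> > 0" shows "finite_moments (gauss_prod (2 ^ n) \<epsilon>) (\<lambda>x. forr_vec n x i)"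
  unfolding forr_vec_def by (rule finite_moments_lin_form[OF assms])

lemma finite_moments_forr_vec_snd:
  assumes "\<epsilon> > 0" shows "finite_moments (block_law n \<epsilon>) (\<lambda>w. forr_vec n (snd w) i)"
  by (rule block_law_finite_moments_snd[OF assms finite_moments_forr_vec[OF assms]])

lemma finite_moments_clamp_fst:
  assumes "\<epsilon> > 0" shows "finite_moments (block_law n \<epsilon>) (\<lambda>w. clamp (fst w))"
  using clamp_bounds by (intro block_law_finite_moments_fst[OF assms, where B = 1]) (auto simp: abs_le_iff intro: order_trans[of _ 0])

lemma finite_moments_scaled_vec:
  assumes "\<epsilon> > 0" shows "finite_moments (block_law n \<epsilon>) (\<lambda>w. scaled_vec n w i)"
  unfolding scaled_vec_def using assms
  by (intro finite_moments_mult finite_moments_clamp_fst finite_moments_forr_vec_snd)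

lemma scaled_vec_moment:
  assumes \<epsilon>: "\<epsilon> > 0"
  shows "(\<integral>w. (\<Prod>i\<in>U. scaled_vec n w i) \<partial>block_law n \<epsilon>) = 2 / (real (card U) + 2) * forr_moment n \<epsilon> U"
proof -
  interpret S: prob_space scale_law by (rule prob_space_scale_law)
  have "integrable scale_law (\<lambda>s. clamp s ^ card U)"
    using clamp_bounds by (intro S.integrable_const_bound[where B = 1]) (auto simp: power_le_one)
  moreover have "integrable (gauss_prod (2 ^ n) \<epsilon>) (\<lambda>x. \<Prod>i\<in>U. forr_vec n x i)"
    using \<epsilon> by (intro finite_moments_integrable finite_moments_intros finite_moments_forr_vec prob_space_gauss_prod)
  ultimately show ?thesis
    using block_law_integral_mult(2)[OF \<epsilon>, of "\<lambda>s. clamp s ^ card U" n "\<lambda>x. \<Prod>i\<in>U. forr_vec n x i"]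
    by (simp add: scaled_vec_def prod.distrib integral_scale_law forr_moment_def)
qed

text \<open>One summand of the heat operator, in the directions \<open>fst p\<close> and
  \<open>2 ^ n + snd p\<close>, applied to the monomial of \<open>U\<close> and evaluated at the
  scaled vector. The indicator reflects that a derivative in an absent variable is 0.\<close>

definition pair_term :: "nat \<Rightarrow> real \<Rightarrow> nat set \<Rightarrow> nat \<times> nat \<Rightarrow> real \<times> (nat \<Rightarrow> real) \<Rightarrow> real" where
  "pair_term n \<epsilon> U p w = of_bool (fst p \<in> U \<and> 2 ^ n + snd p \<in> U) *
     (\<epsilon> * (hadamard n (snd p) (fst p) * (\<Prod>i\<in>U - {fst p, 2 ^ n + snd p}. scaled_vec n w i)))"

lemma finite_moments_pair_term:
  assumes "\<epsilon> > 0" shows "finite_moments (block_law n \<epsilon>) (pair_term n \<epsilon> U p)"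
  unfolding pair_term_def[abs_def] using assms
  by (intro finite_moments_intros finite_moments_scaled_vec prob_space_block_law)

text \<open>The integrated heat equation on one monomial. The left side is the moment minus the
  value at the origin, which is 1 for the empty monomial and 0 otherwise. On the right, the random
  scale supplies the factor 2 / |U| of the recursion.\<close>

lemma forr_moment_eq_pair_terms:
  assumes \<epsilon>: "\<epsilon> > 0" and U: "U \<subseteq> {..<2 * 2 ^ n}"
  shows "of_bool (U \<noteq> {}) * forr_moment n \<epsilon> U =
    (\<Sum>p\<in>{..<2 ^ n} \<times> {..<2 ^ n}. \<integral>w. pair_term n \<epsilon> U p w \<partial>block_law n \<epsilon>)"
proof (cases "U = {}")
  case True
  then show ?thesis by (simp add: pair_term_def)
next
  case False
  have fin: "finite U" using U finite_subset by blast
  then have card: "real (card U) > 0" using False by (simp add: card_gt_0_iff)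
  have "(\<integral>w. pair_term n \<epsilon> U (a, b) w \<partial>block_law n \<epsilon>) = 2 / real (card U) *
      (of_bool (a \<in> U \<and> 2 ^ n + b \<in> U) * (\<epsilon> * (hadamard n b a * forr_moment n \<epsilon> (U - {a, 2 ^ n + b}))))"
    if "a < 2 ^ n" for a b
  proof (cases "a \<in> U \<and> 2 ^ n + b \<in> U")
    case True
    \<comment> \<open>The two positions are distinct because \<open>a\<close> lies in the first
      half; hence exactly two factors disappear and the scale exponent is |U| - 2.\<close>
    have "card {a, 2 ^ n + b} = 2" using that by auto
    then have "card (U - {a, 2 ^ n + b}) = card U - 2" "2 \<le> card U"
      using True fin card_mono[of U "{a, 2 ^ n + b}"] by (auto simp: card_Diff_subset)
    then have "real (card (U - {a, 2 ^ n + b})) + 2 = real (card U)" by simp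
    then show ?thesis
      using scaled_vec_moment[OF \<epsilon>, of n "U - {a, 2 ^ n + b}"] by (simp add: pair_term_def)
  qed (auto simp: pair_term_def)
  then have "(\<Sum>p\<in>{..<2 ^ n} \<times> {..<2 ^ n}. \<integral>w. pair_term n \<epsilon> U p w \<partial>block_law n \<epsilon>) =
      (\<Sum>(a, b)\<in>{..<2 ^ n} \<times> {..<2 ^ n}. 2 / real (card U) *
      (of_bool (a \<in> U \<and> 2 ^ n + b \<in> U) * (\<epsilon> * (hadamard n b a * forr_moment n \<epsilon> (U - {a, 2 ^ n + b})))))"
    by (intro sum.cong) auto
  also have "\<dots> = 2 / real (card U) * (\<Sum>(a, b)\<in>{..<2 ^ n} \<times> {..<2 ^ n}.
      of_bool (a \<in> U \<and> 2 ^ n + b \<in> U) * (\<epsilon> * (hadamard n b a * forr_moment n \<epsilon> (U - {a, 2 ^ n + b}))))"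
    by (simp only: sum_distrib_left case_prod_unfold)
  also have "\<dots> = forr_moment n \<epsilon> U"
    using forr_moment_rec[OF \<epsilon> U] card by (simp add: field_simps)
  finally show ?thesis using False by simp
qed

section \<open>Moments of rounded and uniform distributions\<close>

text \<open>Finite supports turn both sides into finite sums, so independence becomes distributivity
  without integrability conditions.\<close>

lemma expectation_prod_Pi_pmf_finite_support:
  fixes f :: "'a \<Rightarrow> 'b \<Rightarrow> real"
  assumes A: "finite A" and B: "\<And>x. x \<in> A \<Longrightarrow> finite (set_pmf (p x))"
  shows "measure_pmf.expectation (Pi_pmf A undefined p) (\<lambda>y. \<Prod>x\<in>A. f x (y x)) =
    (\<Prod>x\<in>A. measure_pmf.expectation (p x) (f x))"
proof -
  let ?S = "PiE A (\<lambda>x. set_pmf (p x))"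
  have "set_pmf (Pi_pmf A undefined p) \<subseteq> ?S"
    using A by (auto simp: set_Pi_pmf PiE_dflt_def)
  then have "measure_pmf.expectation (Pi_pmf A undefined p) (\<lambda>y. \<Prod>x\<in>A. f x (y x)) =
      (\<Sum>y\<in>?S. (\<Prod>x\<in>A. f x (y x)) * pmf (Pi_pmf A undefined p) y)"
    using A B by (intro integral_measure_pmf_real finite_PiE) auto
  also have "\<dots> = (\<Sum>y\<in>?S. \<Prod>x\<in>A. f x (y x) * pmf (p x) (y x))"
  proof (intro sum.cong refl)
    fix y assume "y \<in> ?S"
    then have "pmf (Pi_pmf A undefined p) y = (\<Prod>x\<in>A. pmf (p x) (y x))"
      using A by (intro pmf_Pi') (auto simp: PiE_def extensional_def)
    then show "(\<Prod>x\<in>A. f x (y x)) * pmf (Pi_pmf A undefined p) y = (\<Prod>x\<in>A. f x (y x) * pmf (p x) (y x))"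
      by (simp add: prod.distrib)
  qed
  also have "\<dots> = (\<Prod>x\<in>A. \<Sum>y\<in>set_pmf (p x). f x y * pmf (p x) y)"
    using A B by (subst prod_sum_PiE) auto
  also have "\<dots> = (\<Prod>x\<in>A. measure_pmf.expectation (p x) (f x))"
    using B by (intro prod.cong refl integral_measure_pmf_real[symmetric]) auto
  finally show ?thesis .
qed

text \<open>Rounding acts independently on the coordinates and has mean \<open>trnc (z i)\<close> in
  each, so a multilinear monomial sees only the truncated point.\<close>

lemma expectation_round_point:
  assumes I: "finite I" and U: "U \<subseteq> I"
  shows "measure_pmf.expectation (round_point I z) (\<lambda>y. \<Prod>i\<in>U. y i) = (\<Prod>i\<in>U. trnc (z i))"
proof -
  have fin: "finite (set_pmf (round_coord a))" for a
    by (simp add: round_coord_def)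
  have exp: "measure_pmf.expectation (round_coord a) (\<lambda>y. y) = trnc a" for a
    using trnc_bounds[of a] by (simp add: round_coord_def field_simps)
  have ext: "(\<Prod>i\<in>U. y i) = (\<Prod>i\<in>I. if i \<in> U then y i else 1)" for y :: "'a \<Rightarrow> real"
    using I U by (simp add: prod.If_cases Int_absorb1)
  show ?thesis
    unfolding round_point_def ext using I fin
    by (subst expectation_prod_Pi_pmf_finite_support) (auto intro!: prod.cong simp: exp)
qed

lemma expectation_rounded:
  fixes \<mu> :: "('i \<Rightarrow> real) measure" and g :: "('i \<Rightarrow> real) \<Rightarrow> real"
  assumes I: "finite I" and \<mu>: "sets \<mu> = sets (\<Pi>\<^sub>M i\<in>I. borel)" and prob: "prob_space \<mu>"
  shows "measure_pmf.expectation (rounded I \<mu>) g = (\<integral>z. measure_pmf.expectation (round_point I z) g \<partial>\<mu>)"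
    and set_pmf_rounded: "set_pmf (rounded I \<mu>) \<subseteq> cube I"
proof -
  interpret \<mu>: prob_space \<mu> by fact
  note K = round_point_measurable[OF I \<mu>]
  note fin = finite_cube[OF I]
  have pmf: "pmf (rounded I \<mu>) y = (\<integral>z. pmf (round_point I z) y \<partial>\<mu>)" for y
  proof -
    have "pmf (rounded I \<mu>) y = measure (\<mu> \<bind> (\<lambda>z. measure_pmf (round_point I z))) {y}"
      by (simp add: measure_pmf_rounded[OF I \<mu> prob, symmetric] measure_pmf_single)
    also have "\<dots> = (\<integral>z. measure (measure_pmf (round_point I z)) {y} \<partial>\<mu>)"
      using K by (intro \<mu>.measure_bind) auto
    finally show ?thesis by (simp add: measure_pmf_single)
  qed
  have int: "integrable \<mu> (\<lambda>z. pmf (round_point I z) y)" for y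
  proof (intro \<mu>.integrable_const_bound[where B = 1])
    have "(\<lambda>z. measure (measure_pmf (round_point I z)) {y}) \<in> borel_measurable \<mu>"
      using measurable_compose[OF K measurable_measure_subprob_algebra] by simp
    then show "(\<lambda>z. pmf (round_point I z) y) \<in> borel_measurable \<mu>"
      by (simp add: measure_pmf_single)
  qed (auto simp: pmf_le_1)
  show set: "set_pmf (rounded I \<mu>) \<subseteq> cube I"
  proof
    fix y assume "y \<in> set_pmf (rounded I \<mu>)"
    then have "(\<integral>z. pmf (round_point I z) y \<partial>\<mu>) \<noteq> 0"
      by (simp add: set_pmf_iff pmf)
    then obtain z where "y \<in> set_pmf (round_point I z)"
      by (force simp: set_pmf_iff intro: ccontr)
    then show "y \<in> cube I"
      using set_round_point[OF I] by blast
  qed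
  have "measure_pmf.expectation (rounded I \<mu>) g = (\<Sum>y\<in>cube I. g y * pmf (rounded I \<mu>) y)"
    using set by (intro integral_measure_pmf_real fin) auto
  also have "\<dots> = (\<integral>z. (\<Sum>y\<in>cube I. g y * pmf (round_point I z) y) \<partial>\<mu>)"
    using int by (simp add: pmf)
  also have "\<dots> = (\<integral>z. measure_pmf.expectation (round_point I z) g \<partial>\<mu>)"
    using set_round_point[OF I]
    by (intro Bochner_Integration.integral_cong refl integral_measure_pmf_real[symmetric] fin) auto
  finally show "measure_pmf.expectation (rounded I \<mu>) g = (\<integral>z. measure_pmf.expectation (round_point I z) g \<partial>\<mu>)" .
qed

lemma forrelation_eq_distr:
  "forrelation n \<epsilon> = distr (gauss_prod (2 ^ n) \<epsilon>) (\<Pi>\<^sub>M i\<in>{..<2 * 2 ^ n}. borel)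
     (\<lambda>x. \<lambda>i\<in>{..<2 * 2 ^ n}. forr_vec n x i)"
  by (simp add: forrelation_def gauss_prod_def gauss_def forr_vec_eq)

lemma eps_pos: "n > 0 \<Longrightarrow> k > 0 \<Longrightarrow> eps n k > 0"
  by (simp add: eps_def)

text \<open>The integral is moved to \<open>block_law\<close>, whose second marginal is the Gaussian
  vector, so that truncated, plain and scaled vectors live on one space.\<close>

lemma rounded_forrelation_moment:
  assumes "n > 0" "k > 0" and U: "U \<subseteq> {..<2 * 2 ^ n}"
  shows "measure_pmf.expectation (rounded_forrelation n k) (\<lambda>z. \<Prod>i\<in>U. z i) =
      (\<integral>w. (\<Prod>i\<in>U. trnc (forr_vec n (snd w) i)) \<partial>block_law n (eps n k))"
    and "set_pmf (rounded_forrelation n k) \<subseteq> cube {..<2 * 2 ^ n}"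
proof -
  let ?I = "{..<2 * 2 ^ n :: nat}" and ?G = "gauss_prod (2 ^ n) (eps n k)"
  note \<epsilon> = eps_pos[OF assms(1,2)]
  have sets: "sets (forrelation n (eps n k)) = sets (\<Pi>\<^sub>M i\<in>?I. borel)"
    by (simp add: forrelation_def)
  note prob = forrelation_prob_space[OF \<epsilon>]
  have meas [measurable]: "(\<lambda>x. forr_vec n x i) \<in> borel_measurable ?G" for i
    using finite_moments_measurable[OF finite_moments_forr_vec[OF \<epsilon>]] .
  interpret G: prob_space ?G by (rule prob_space_gauss_prod[OF \<epsilon>])
  have "measure_pmf.expectation (rounded_forrelation n k) (\<lambda>z. \<Prod>i\<in>U. z i) =
      (\<integral>z. (\<Prod>i\<in>U. trnc (z i)) \<partial>forrelation n (eps n k))"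
    unfolding rounded_forrelation_def
    by (simp add: expectation_rounded[OF _ sets prob] expectation_round_point[OF _ U])
  also have "\<dots> = (\<integral>x. (\<Prod>i\<in>U. trnc ((\<lambda>i\<in>?I. forr_vec n x i) i)) \<partial>?G)"
    unfolding forrelation_eq_distr
  proof (intro integral_distr borel_measurable_prod)
    fix i assume "i \<in> U"
    then have "(\<lambda>z. z i) \<in> borel_measurable (\<Pi>\<^sub>M i\<in>?I. borel :: real measure)"
      using U by (intro measurable_component_singleton) auto
    then show "(\<lambda>z. trnc (z i)) \<in> borel_measurable (\<Pi>\<^sub>M i\<in>?I. borel :: real measure)"
      by measurable
  qed (intro measurable_restrict meas)
  also have "\<dots> = (\<integral>x. (\<Prod>i\<in>U. trnc (forr_vec n x i)) \<partial>?G)"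
    using U by (intro Bochner_Integration.integral_cong prod.cong refl) auto
  also have "\<dots> = (\<integral>w. (\<Prod>i\<in>U. trnc (forr_vec n (snd w) i)) \<partial>block_law n (eps n k))"
  proof (intro block_law_integral_snd[OF \<epsilon>, symmetric] G.integrable_const_bound[where B = 1])
    have "\<bar>trnc a\<bar> \<le> 1" for a using trnc_bounds[of a] by (auto simp: abs_le_iff)
    then show "AE x in ?G. norm (\<Prod>i\<in>U. trnc (forr_vec n x i)) \<le> 1"
      by (auto simp: abs_prod intro!: prod_le_1)
  qed measurable
  finally show "measure_pmf.expectation (rounded_forrelation n k) (\<lambda>z. \<Prod>i\<in>U. z i) =
      (\<integral>w. (\<Prod>i\<in>U. trnc (forr_vec n (snd w) i)) \<partial>block_law n (eps n k))" .
  show "set_pmf (rounded_forrelation n k) \<subseteq> cube ?I"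
    unfolding rounded_forrelation_def by (rule set_pmf_rounded[OF _ sets prob]) simp
qed

lemma cube_nonempty: "cube I \<noteq> {}"
  by (simp add: cube_def PiE_eq_empty_iff)

text \<open>Every coordinate in \<open>U\<close> contributes a factor -1 + 1 = 0. These are also the
  monomial values at the origin, so a uniform block can be replaced by the point 0.\<close>

lemma uniform_cube_moment:
  assumes U: "U \<subseteq> {..<2 * 2 ^ n}"
  shows "measure_pmf.expectation (uniform_cube n) (\<lambda>z. \<Prod>i\<in>U. z i) = of_bool (U = {})"
    and "set_pmf (uniform_cube n) = cube {..<2 * 2 ^ n}"
proof -
  let ?I = "{..<2 * 2 ^ n :: nat}"
  have fin: "finite (cube ?I)" by (rule finite_cube) simp
  show "set_pmf (uniform_cube n) = cube ?I"
    unfolding uniform_cube_def using fin by (simp add: cube_nonempty)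
  have "(\<Sum>z\<in>cube ?I. \<Prod>i\<in>U. z i) = (\<Sum>z\<in>cube ?I. \<Prod>i\<in>?I. if i \<in> U then z i else 1)"
    using U by (simp add: prod.If_cases Int_absorb1)
  also have "\<dots> = (\<Prod>i\<in>?I. \<Sum>y\<in>{-1, 1}. if i \<in> U then y else 1)"
    unfolding cube_def by (subst prod_sum_PiE) auto
  also have "\<dots> = (\<Prod>i\<in>?I. if i \<in> U then 0 else 2)"
    by (intro prod.cong) auto
  also have "\<dots> = of_bool (U = {}) * 2 ^ card ?I"
    using U by (cases "U = {}") (auto intro!: prod_zero)
  finally have "(\<Sum>z\<in>cube ?I. \<Prod>i\<in>U. z i) = of_bool (U = {}) * 2 ^ card ?I" .
  moreover have "card (cube ?I) = 2 ^ card ?I"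
    by (simp add: cube_def card_PiE numeral_2_eq_2)
  ultimately show "measure_pmf.expectation (uniform_cube n) (\<lambda>z. \<Prod>i\<in>U. z i) = of_bool (U = {})"
    unfolding uniform_cube_def using fin by (simp add: integral_pmf_of_set cube_nonempty)
qed

text \<open>The image of \<open>{j}\<close> under the relation \<open>T\<close> is the slice of
  \<open>T\<close> in block \<open>j\<close>; this splitting turns independence of blocks into
  products of block moments.\<close>

lemma prod_blocks:
  fixes k :: nat
  assumes "T \<subseteq> {..<k} \<times> B" "finite B"
  shows "(\<Prod>c\<in>T. h (fst c) (snd c)) = (\<Prod>j<k. \<Prod>i\<in>T `` {j}. (h j i :: real))"
proof -
  have "finite (T `` {j})" for j
    using assms by (auto intro: finite_subset[of _ B])
  then have "(\<Prod>j<k. \<Prod>i\<in>T `` {j}. h j i) = (\<Prod>(j, i)\<in>(SIGMA j:{..<k}. T `` {j}). h j i)"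
    by (intro prod.Sigma) auto
  also have "(SIGMA j:{..<k}. T `` {j}) = T" using assms by auto
  finally show ?thesis by (simp add: case_prod_unfold)
qed

text \<open>After Fourier expansion each monomial splits into one factor per block, and the blocks
  are independent.\<close>

lemma expectation_block_product:
  assumes P: "set_pmf P \<subseteq> cube {..<2 * 2 ^ n}" and Q: "set_pmf Q \<subseteq> cube {..<2 * 2 ^ n}"
  shows "measure_pmf.expectation (block_product n k P Q S) H =
    (\<Sum>T\<in>Pow (coords n k). fourier_coeff (coords n k) H T *
      (\<Prod>j<k. measure_pmf.expectation (if j \<in> S then P else Q) (\<lambda>z. \<Prod>i\<in>T `` {j}. z i)))"
proof -
  let ?I = "{..<2 * 2 ^ n :: nat}"
  let ?R = "\<lambda>j. if j \<in> S then P else Q"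
  let ?\<Pi> = "Pi_pmf {..<k} undefined ?R"
  have R: "set_pmf (?R j) \<subseteq> cube ?I" for j using P Q by auto
  have finR: "finite (set_pmf (?R j))" for j
    using R finite_cube[of ?I] finite_subset by blast
  have fin\<Pi>: "finite (set_pmf ?\<Pi>)"
    using finR by (intro finite_subset[OF _ finite_PiE[of "{..<k}" "\<lambda>j. set_pmf (?R j)"]])
      (auto simp: set_Pi_pmf PiE_dflt_def)
  have finC: "finite (coords n k)" by (simp add: coords_def)
  have expand: "H (flatten n k x) = (\<Sum>T\<in>Pow (coords n k). fourier_coeff (coords n k) H T *
      (\<Prod>j<k. \<Prod>i\<in>T `` {j}. x j i))" if x: "x \<in> set_pmf ?\<Pi>" for x
  proof -
    have xj: "x j \<in> cube ?I" if "j < k" for j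
      using x that R[of j] by (auto simp: set_Pi_pmf PiE_dflt_def)
    have "flatten n k x \<in> cube (coords n k)"
      unfolding cube_def
    proof (rule PiE_I)
      fix c assume "c \<in> coords n k"
      then show "flatten n k x c \<in> {-1, 1}"
        using xj[of "fst c"] unfolding flatten_def coords_def cube_def
        by (auto simp: case_prod_unfold dest: PiE_mem)
    qed (auto simp: flatten_def)
    then have "H (flatten n k x) = (\<Sum>T\<in>Pow (coords n k). fourier_coeff (coords n k) H T *
        (\<Prod>c\<in>T. flatten n k x c))"
      by (rule fourier_expansion[OF finC])
    also have "\<dots> = (\<Sum>T\<in>Pow (coords n k). fourier_coeff (coords n k) H T *
        (\<Prod>j<k. \<Prod>i\<in>T `` {j}. x j i))"
    proof (intro sum.cong refl arg_cong2[where f = times])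
      fix T assume T: "T \<in> Pow (coords n k)"
      then have "(\<Prod>c\<in>T. flatten n k x c) = (\<Prod>c\<in>T. x (fst c) (snd c))"
        by (intro prod.cong refl) (auto simp: flatten_def)
      also have "\<dots> = (\<Prod>j<k. \<Prod>i\<in>T `` {j}. x j i)"
        using T by (intro prod_blocks[where B = ?I]) (auto simp: coords_def)
      finally show "(\<Prod>c\<in>T. flatten n k x c) = (\<Prod>j<k. \<Prod>i\<in>T `` {j}. x j i)" .
    qed
    finally show ?thesis .
  qed
  have "measure_pmf.expectation (block_product n k P Q S) H =
      measure_pmf.expectation ?\<Pi> (\<lambda>x. H (flatten n k x))"
    by (simp add: block_product_def)
  also have "\<dots> = measure_pmf.expectation ?\<Pi> (\<lambda>x. \<Sum>T\<in>Pow (coords n k). fourier_coeff (coords n k) H T *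
      (\<Prod>j<k. \<Prod>i\<in>T `` {j}. x j i))"
    by (intro integral_cong_AE) (auto simp: AE_measure_pmf_iff expand)
  also have "\<dots> = (\<Sum>T\<in>Pow (coords n k). fourier_coeff (coords n k) H T *
      measure_pmf.expectation ?\<Pi> (\<lambda>x. \<Prod>j<k. \<Prod>i\<in>T `` {j}. x j i))"
    by (simp add: Bochner_Integration.integral_sum integrable_measure_pmf_finite[OF fin\<Pi>])
  also have "\<dots> = (\<Sum>T\<in>Pow (coords n k). fourier_coeff (coords n k) H T *
      (\<Prod>j<k. measure_pmf.expectation (?R j) (\<lambda>z. \<Prod>i\<in>T `` {j}. z i)))"
    using expectation_prod_Pi_pmf_finite_support[of "{..<k}" ?R "\<lambda>j z. \<Prod>i\<in>T `` {j}. z i" for T] finR by simp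
  finally show ?thesis .
qed

section \<open>Independent blocks and the truncation error\<close>

definition blocks_law :: "nat \<Rightarrow> real \<Rightarrow> nat \<Rightarrow> (nat \<Rightarrow> real \<times> (nat \<Rightarrow> real)) measure" where
  "blocks_law n \<epsilon> k = (\<Pi>\<^sub>M j\<in>{..<k}. block_law n \<epsilon>)"

lemma prob_space_blocks_law: "\<epsilon> > 0 \<Longrightarrow> prob_space (blocks_law n \<epsilon> k)"
  unfolding blocks_law_def by (intro prob_space_PiM prob_space_block_law)

lemma finite_moments_blocks_law:
  assumes "\<epsilon> > 0" "finite_moments (block_law n \<epsilon>) f" "j < k"
  shows "finite_moments (blocks_law n \<epsilon> k) (\<lambda>w. f (w j))"
  unfolding blocks_law_def using assms
  by (intro finite_moments_PiM_component prob_space_block_law) auto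

lemma blocks_law_integral_prod:
  assumes \<epsilon>: "\<epsilon> > 0" and f: "\<And>j. j < k \<Longrightarrow> finite_moments (block_law n \<epsilon>) (f j)"
  shows "(\<integral>w. (\<Prod>j<k. f j (w j)) \<partial>blocks_law n \<epsilon> k) = (\<Prod>j<k. \<integral>w. f j w \<partial>block_law n \<epsilon>)"
proof -
  interpret product_sigma_finite "\<lambda>_. block_law n \<epsilon>"
    by (intro product_sigma_finite.intro prob_space_imp_sigma_finite prob_space_block_law \<epsilon>)
  show ?thesis
    unfolding blocks_law_def using f finite_moments_integrable by (intro product_integral_prod) auto
qed

text \<open>The counterpart of \<open>expectation_block_product\<close> for continuous blocks, in
  the same Fourier form, so that the two can be compared term by term. The free choice of
  \<open>g\<close> covers truncated, untruncated and zero blocks.\<close>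

lemma blocks_law_integral_deriv_ext:
  assumes \<epsilon>: "\<epsilon> > 0" and g: "\<And>j i. j < k \<Longrightarrow> finite_moments (block_law n \<epsilon>) (\<lambda>w. g j w i)"
  shows "(\<integral>w. deriv_ext (coords n k) f {} (\<lambda>c. g (fst c) (w (fst c)) (snd c)) \<partial>blocks_law n \<epsilon> k) =
    (\<Sum>T\<in>Pow (coords n k). fourier_coeff (coords n k) f T *
      (\<Prod>j<k. \<integral>w. (\<Prod>i\<in>T `` {j}. g j w i) \<partial>block_law n \<epsilon>))"
    and "finite_moments (blocks_law n \<epsilon> k)
      (\<lambda>w. deriv_ext (coords n k) f {} (\<lambda>c. g (fst c) (w (fst c)) (snd c)))"
proof -
  note prob = prob_space_block_law[OF \<epsilon>] prob_space_blocks_law[OF \<epsilon>]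
  have fin: "finite (coords n k)" by (simp add: coords_def)
  have fm: "finite_moments (block_law n \<epsilon>) (\<lambda>w. \<Prod>i\<in>U. g j w i)" if "j < k" for j U
    using that by (intro finite_moments_intros prob g)
  have eq: "deriv_ext (coords n k) f {} (\<lambda>c. g (fst c) (w (fst c)) (snd c)) =
      (\<Sum>T\<in>Pow (coords n k). fourier_coeff (coords n k) f T * (\<Prod>j<k. \<Prod>i\<in>T `` {j}. g j (w j) i))" for w
  proof -
    have "deriv_ext (coords n k) f {} (\<lambda>c. g (fst c) (w (fst c)) (snd c)) =
        (\<Sum>T\<in>Pow (coords n k). fourier_coeff (coords n k) f T * (\<Prod>c\<in>T. g (fst c) (w (fst c)) (snd c)))"
      by (simp add: deriv_ext_fourier[OF fin] Pow_def)
    also have "\<dots> = (\<Sum>T\<in>Pow (coords n k). fourier_coeff (coords n k) f T * (\<Prod>j<k. \<Prod>i\<in>T `` {j}. g j (w j) i))"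
      by (intro sum.cong refl arg_cong2[where f = times] prod_blocks[where B = "{..<2 * 2 ^ n}"])
        (auto simp: coords_def)
    finally show ?thesis .
  qed
  have fm': "finite_moments (blocks_law n \<epsilon> k) (\<lambda>w. \<Prod>j<k. \<Prod>i\<in>T `` {j}. g j (w j) i)" for T
    using g by (intro finite_moments_prod prob finite_moments_blocks_law[OF \<epsilon>, of n "\<lambda>w. g j w i" for j i]) auto
  show "finite_moments (blocks_law n \<epsilon> k)
      (\<lambda>w. deriv_ext (coords n k) f {} (\<lambda>c. g (fst c) (w (fst c)) (snd c)))"
    unfolding eq by (intro finite_moments_intros(1,3,4) fm' prob)
  show "(\<integral>w. deriv_ext (coords n k) f {} (\<lambda>c. g (fst c) (w (fst c)) (snd c)) \<partial>blocks_law n \<epsilon> k) =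
    (\<Sum>T\<in>Pow (coords n k). fourier_coeff (coords n k) f T *
      (\<Prod>j<k. \<integral>w. (\<Prod>i\<in>T `` {j}. g j w i) \<partial>block_law n \<epsilon>))"
    unfolding eq using fm
    by (simp add: Bochner_Integration.integral_sum finite_moments_integrable[OF fm']
      blocks_law_integral_prod[OF \<epsilon>, of k n "\<lambda>j w. \<Prod>i\<in>T `` {j}. g j w i" for T])
qed

text \<open>A quantity that dominates \<open>\<Prod> max 1 \<bar>z\<^sub>i\<bar>\<close> (up to a factor 2) as soon as some \<open>\<bar>z\<^sub>i\<bar>\<close> exceeds \<open>1/2\<close>, yet has tiny
  expectation; being polynomial, it only involves Gaussian moments.\<close>

definition excess :: "'i set \<Rightarrow> nat \<Rightarrow> ('i \<Rightarrow> real) \<Rightarrow> real" where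
  "excess I m z = (\<Prod>i\<in>I. 1 + (2 * z i) ^ (2 * m)) - 1"

lemma excess_nonneg: "0 \<le> excess I m z"
  unfolding excess_def by (simp add: prod_ge_1)

text \<open>The one large coordinate alone makes the product of the factors
  \<open>1 + (2 * z j) ^ (2 * m)\<close> at least 2, so subtracting 1 costs at most half of it.
  Every factor dominates the corresponding maximum.\<close>

lemma prod_max_le_excess:
  assumes I: "finite I" and m: "m > 0" and i: "i \<in> I" "\<bar>z i\<bar> > 1 / 2"
  shows "(\<Prod>i\<in>I. max 1 \<bar>z i\<bar>) \<le> 2 * excess I m z"
proof -
  let ?a = "\<lambda>i. (2 * z i) ^ (2 * m)"
  have max: "max 1 \<bar>z j\<bar> \<le> 1 + ?a j" for j
  proof (cases "\<bar>z j\<bar> \<le> 1")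
    case False
    then have "\<bar>z j\<bar> \<le> \<bar>2 * z j\<bar> ^ 1" by simp
    also have "\<dots> \<le> \<bar>2 * z j\<bar> ^ (2 * m)"
      using False m by (intro power_increasing) auto
    finally show ?thesis using False by (simp add: power_even_abs)
  qed simp
  have "1 \<le> \<bar>2 * z i\<bar> ^ (2 * m)"
    using i(2) by (intro one_le_power) auto
  then have "2 \<le> (1 + ?a i) * 1" by (simp add: power_even_abs)
  also have "\<dots> \<le> (1 + ?a i) * (\<Prod>j\<in>I - {i}. 1 + ?a j)"
    by (intro mult_left_mono prod_ge_1) auto
  also have "\<dots> = (\<Prod>j\<in>I. 1 + ?a j)"
    using I i(1) by (simp add: prod.remove)
  finally have "2 \<le> (\<Prod>j\<in>I. 1 + ?a j)" .
  moreover have "(\<Prod>i\<in>I. max 1 \<bar>z i\<bar>) \<le> (\<Prod>j\<in>I. 1 + ?a j)"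
    by (intro prod_mono conjI max) auto
  ultimately show ?thesis by (simp add: excess_def)
qed

lemma excess_mono:
  assumes "\<And>i. i \<in> I \<Longrightarrow> \<bar>z i\<bar> \<le> \<bar>z' i\<bar>"
  shows "excess I m z \<le> excess I m z'"
proof -
  have "(2 * z i) ^ (2 * m) \<le> (2 * z' i) ^ (2 * m)" if "i \<in> I" for i
    using power_mono[of "\<bar>2 * z i\<bar>" "\<bar>2 * z' i\<bar>" "2 * m"] assms[OF that] by (simp add: power_even_abs abs_mult)
  then show ?thesis
    unfolding excess_def by (intro diff_right_mono prod_mono) auto
qed

section \<open>Cost of replacing truncated by plain Gaussian samples\<close>

lemma abs_trnc: "\<bar>trnc a\<bar> \<le> 1" "\<bar>trnc a\<bar> \<le> \<bar>a\<bar>"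
  by (auto simp: trnc_def sgn_if)

text \<open>Inside the box truncation is the identity. Outside it each of the two extensions is at
  most twice the excess, hence the 4.\<close>

lemma trnc_error_le_excess:
  assumes I: "finite I" and f: "\<And>z. z \<in> cube I \<Longrightarrow> \<bar>f z\<bar> \<le> 1" and m: "m > 0"
  shows "\<bar>deriv_ext I f {} (\<lambda>i. trnc (v i)) - deriv_ext I f {} v\<bar> \<le> 4 * excess I m v"
proof (cases "\<exists>i\<in>I. \<bar>v i\<bar> > 1 / 2")
  case True
  then obtain i where i: "i \<in> I" "\<bar>v i\<bar> > 1 / 2" by blast
  have "(\<Prod>i\<in>I. max 1 \<bar>trnc (v i)\<bar>) \<le> (\<Prod>i\<in>I. max 1 \<bar>v i\<bar>)"
    by (intro prod_mono conjI max.mono abs_trnc) auto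
  then show ?thesis
    using abs_deriv_ext_le[of I f "{}" "\<lambda>i. trnc (v i)", OF I f]
      abs_deriv_ext_le[of I f "{}" v, OF I f] prod_max_le_excess[where z = v, OF I m i] by simp
next
  case False
  then have "trnc (v i) = v i" if "i \<in> I" for i
    using that by (force simp: trnc_def abs_le_iff)
  then have "deriv_ext I f {} (\<lambda>i. trnc (v i)) = deriv_ext I f {} v"
    unfolding deriv_ext_def by (intro sum.cong prod.cong arg_cong2[where f = times] refl) auto
  then show ?thesis using excess_nonneg[of I m v] by simp
qed

definition blocks_vec :: "nat \<Rightarrow> (nat \<Rightarrow> real \<times> (nat \<Rightarrow> real)) \<Rightarrow> nat \<times> nat \<Rightarrow> real" where
  "blocks_vec n w c = forr_vec n (snd (w (fst c))) (snd c)"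

definition total_excess :: "nat \<Rightarrow> real \<Rightarrow> nat \<Rightarrow> nat \<Rightarrow> real" where
  "total_excess n \<epsilon> k m = (\<integral>w. excess (coords n k) m (blocks_vec n w) \<partial>blocks_law n \<epsilon> k)"

lemma integrable_excess:
  assumes \<epsilon>: "\<epsilon> > 0"
  shows "integrable (blocks_law n \<epsilon> k) (\<lambda>w. excess (coords n k) m (blocks_vec n w))"
proof -
  have "finite_moments (blocks_law n \<epsilon> k) (\<lambda>w. blocks_vec n w c)" if "c \<in> coords n k" for c
    unfolding blocks_vec_def using that
    by (intro finite_moments_blocks_law[OF \<epsilon>, where f = "\<lambda>w. forr_vec n (snd w) (snd c)"]
      finite_moments_forr_vec_snd[OF \<epsilon>]) (auto simp: coords_def)
  then show ?thesis
    unfolding excess_def diff_conv_add_uminus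
    by (intro finite_moments_integrable finite_moments_intros prob_space_blocks_law[OF \<epsilon>])
qed

lemma expectation_block_product_approx:
  assumes n: "n > 0" and k: "k > 0" and m: "m > 0"
    and H: "\<And>z. z \<in> cube (coords n k) \<Longrightarrow> \<bar>H z\<bar> \<le> 1"
  shows "\<bar>measure_pmf.expectation (block_product n k (rounded_forrelation n k) (uniform_cube n) S) H -
      (\<Sum>T\<in>Pow (coords n k). fourier_coeff (coords n k) H T *
        (\<Prod>j<k. if j \<in> S then forr_moment n (eps n k) (T `` {j}) else of_bool (T `` {j} = {})))\<bar>
    \<le> 4 * total_excess n (eps n k) k m"
proof -
  let ?\<epsilon> = "eps n k" and ?I = "{..<2 * 2 ^ n :: nat}"
  note \<epsilon> = eps_pos[OF n k]
  let ?\<Omega> = "blocks_law n ?\<epsilon> k"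
  \<comment> \<open>A block outside \<open>S\<close> is uniform and is represented by the
    origin.\<close>
  define u where "u j w i = (if j \<in> S then forr_vec n (snd w) i else 0)" for j i and w :: "real \<times> (nat \<Rightarrow> real)"
  define v where "v w c = u (fst c) (w (fst c)) (snd c)" for w and c :: "nat \<times> nat"
  have sub: "T `` {j} \<subseteq> ?I" if "T \<in> Pow (coords n k)" for T j
    using that by (auto simp: coords_def)
  have fin: "finite (T `` {j})" if "T \<in> Pow (coords n k)" for T j
    using sub[OF that] finite_subset by blast
  have finC: "finite (coords n k)" by (simp add: coords_def)
  have empty: "(\<Prod>i\<in>U. 0 :: real) = of_bool (U = {})" if "finite U" for U :: "nat set"
    using that by auto
  interpret B: prob_space "block_law n ?\<epsilon>" by (rule prob_space_block_law[OF \<epsilon>])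
  have fmu: "finite_moments (block_law n ?\<epsilon>) (\<lambda>w. u j w i)" for j i
    unfolding u_def by (cases "j \<in> S")
      (auto intro: finite_moments_forr_vec_snd[OF \<epsilon>] finite_moments_const B.prob_space_axioms)
  have fmt: "finite_moments (block_law n ?\<epsilon>) (\<lambda>w. trnc (u j w i))" for j i
    using finite_moments_measurable[OF fmu]
    by (intro finite_moments_bounded[where B = 1] B.prob_space_axioms abs_trnc) auto
  note intu = blocks_law_integral_deriv_ext[OF \<epsilon>, where g = u and f = H, OF fmu, of k, folded v_def]
  note intt = blocks_law_integral_deriv_ext[OF \<epsilon>, where g = "\<lambda>j w i. trnc (u j w i)" and f = H, OF fmt, of k, folded v_def]
  have "measure_pmf.expectation (block_product n k (rounded_forrelation n k) (uniform_cube n) S) H =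
      (\<integral>w. deriv_ext (coords n k) H {} (\<lambda>c. trnc (v w c)) \<partial>?\<Omega>)"
    unfolding intt(1)
  proof (subst expectation_block_product)
    show "set_pmf (rounded_forrelation n k) \<subseteq> cube ?I"
      using rounded_forrelation_moment(2)[OF n k, of "{}"] by simp
    show "set_pmf (uniform_cube n) \<subseteq> cube ?I"
      using uniform_cube_moment(2)[of "{}" n] by simp
    show "(\<Sum>T\<in>Pow (coords n k). fourier_coeff (coords n k) H T *
        (\<Prod>j<k. measure_pmf.expectation (if j \<in> S then rounded_forrelation n k else uniform_cube n) (\<lambda>z. \<Prod>i\<in>T `` {j}. z i)))
      = (\<Sum>T\<in>Pow (coords n k). fourier_coeff (coords n k) H T *
        (\<Prod>j<k. \<integral>w. (\<Prod>i\<in>T `` {j}. trnc (u j w i)) \<partial>block_law n ?\<epsilon>))"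
    proof (intro sum.cong prod.cong arg_cong2[where f = times] refl)
      fix T j assume T: "T \<in> Pow (coords n k)"
      show "measure_pmf.expectation (if j \<in> S then rounded_forrelation n k else uniform_cube n) (\<lambda>z. \<Prod>i\<in>T `` {j}. z i)
          = (\<integral>w. (\<Prod>i\<in>T `` {j}. trnc (u j w i)) \<partial>block_law n ?\<epsilon>)"
      proof (cases "j \<in> S")
        case True
        then show ?thesis using rounded_forrelation_moment(1)[OF n k sub[OF T]] by (simp add: u_def)
      next
        case False
        moreover have "trnc 0 = 0" by (simp add: trnc_def)
        ultimately show ?thesis
          using uniform_cube_moment(1)[OF sub[OF T]] empty[OF fin[OF T]] by (simp add: u_def B.prob_space del: prod_constant)
      qed
    qed
  qed
  moreover have "(\<Sum>T\<in>Pow (coords n k). fourier_coeff (coords n k) H T *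
        (\<Prod>j<k. if j \<in> S then forr_moment n ?\<epsilon> (T `` {j}) else of_bool (T `` {j} = {}))) =
      (\<integral>w. deriv_ext (coords n k) H {} (v w) \<partial>?\<Omega>)"
    unfolding v_def[abs_def] intu(1)[unfolded v_def[abs_def]]
  proof (intro sum.cong prod.cong arg_cong2[where f = times] refl)
    fix T j assume T: "T \<in> Pow (coords n k)"
    show "(if j \<in> S then forr_moment n ?\<epsilon> (T `` {j}) else of_bool (T `` {j} = {})) =
        (\<integral>w. (\<Prod>i\<in>T `` {j}. u j w i) \<partial>block_law n ?\<epsilon>)"
    proof (cases "j \<in> S")
      case True
      have "integrable (gauss_prod (2 ^ n) ?\<epsilon>) (\<lambda>x. \<Prod>i\<in>T `` {j}. forr_vec n x i)"
        by (intro finite_moments_integrable finite_moments_intros finite_moments_forr_vec \<epsilon> prob_space_gauss_prod)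
      then show ?thesis
        using True by (simp add: u_def forr_moment_def block_law_integral_snd[OF \<epsilon>, of n "\<lambda>x. \<Prod>i\<in>T `` {j}. forr_vec n x i"])
    qed (simp add: u_def empty[OF fin[OF T]] B.prob_space del: prod_constant)
  qed
  moreover have "\<bar>(\<integral>w. deriv_ext (coords n k) H {} (\<lambda>c. trnc (v w c)) \<partial>?\<Omega>) -
      (\<integral>w. deriv_ext (coords n k) H {} (v w) \<partial>?\<Omega>)\<bar> \<le> 4 * total_excess n ?\<epsilon> k m"
  proof -
    have int: "integrable ?\<Omega> (\<lambda>w. deriv_ext (coords n k) H {} (\<lambda>c. trnc (v w c)))"
      "integrable ?\<Omega> (\<lambda>w. deriv_ext (coords n k) H {} (v w))"
      using finite_moments_integrable[OF intt(2)] finite_moments_integrable[OF intu(2)]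
      unfolding v_def[abs_def] by auto
    have "\<bar>(\<integral>w. deriv_ext (coords n k) H {} (\<lambda>c. trnc (v w c)) \<partial>?\<Omega>) -
      (\<integral>w. deriv_ext (coords n k) H {} (v w) \<partial>?\<Omega>)\<bar> \<le>
      (\<integral>w. \<bar>deriv_ext (coords n k) H {} (\<lambda>c. trnc (v w c)) - deriv_ext (coords n k) H {} (v w)\<bar> \<partial>?\<Omega>)"
      using int integral_abs_bound by (subst Bochner_Integration.integral_diff[symmetric])
    also have "\<dots> \<le> (\<integral>w. 4 * excess (coords n k) m (blocks_vec n w) \<partial>?\<Omega>)"
    proof (intro integral_mono)
      fix w
      have "\<bar>deriv_ext (coords n k) H {} (\<lambda>c. trnc (v w c)) - deriv_ext (coords n k) H {} (v w)\<bar>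
          \<le> 4 * excess (coords n k) m (v w)"
        by (rule trnc_error_le_excess[OF finC H m])
      \<comment> \<open>Zeroing blocks only shrinks coordinates, so a single error bound serves all
        \<open>S\<close>.\<close>
      also have "\<dots> \<le> 4 * excess (coords n k) m (blocks_vec n w)"
        by (intro mult_left_mono excess_mono) (auto simp: v_def u_def blocks_vec_def)
      finally show "\<bar>deriv_ext (coords n k) H {} (\<lambda>c. trnc (v w c)) - deriv_ext (coords n k) H {} (v w)\<bar>
          \<le> 4 * excess (coords n k) m (blocks_vec n w)" .
    qed (use int integrable_excess[OF \<epsilon>] in auto)
    finally show ?thesis by (simp add: total_excess_def)
  qed
  ultimately show ?thesis by simp
qed

section \<open>The alternating sum\<close>

text \<open>The \<open>2 * k\<close> directions of differentiation when one cross pair is chosen in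
  each block.\<close>

definition pair_set :: "nat \<Rightarrow> nat \<Rightarrow> (nat \<Rightarrow> nat \<times> nat) \<Rightarrow> (nat \<times> nat) set" where
  "pair_set n k p = (SIGMA j:{..<k}. {fst (p j), 2 ^ n + snd (p j)})"

abbreviation pair_choices :: "nat \<Rightarrow> nat \<Rightarrow> (nat \<Rightarrow> nat \<times> nat) set" where
  "pair_choices n k \<equiv> {..<k} \<rightarrow>\<^sub>E {..<2 ^ n} \<times> {..<2 ^ n}"

lemma pair_choices_less:
  assumes "p \<in> pair_choices n k" "j < k"
  shows "fst (p j) < 2 ^ n" "snd (p j) < 2 ^ n"
  using PiE_mem[OF assms(1), of j] assms(2) by (auto simp: mem_Times_iff)

lemma pair_set_subset: "p \<in> pair_choices n k \<Longrightarrow> pair_set n k p \<subseteq> coords n k"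
  using pair_choices_less[of p k n] by (fastforce simp: pair_set_def coords_def)

lemma card_pair_set:
  assumes "p \<in> pair_choices n k" shows "card (pair_set n k p) = 2 * k"
proof -
  have "card {fst (p j), 2 ^ n + snd (p j)} = 2" if "j < k" for j
    using pair_choices_less[OF assms that] by auto
  then show ?thesis
    by (simp add: pair_set_def card_SigmaI del: card_insert_disjoint)
qed

text \<open>In each slice one element is below \<open>2 ^ n\<close> and the other is not, so the
  pair can be recovered. Summing over choices therefore counts every set of directions at most
  once.\<close>

lemma inj_on_pair_set: "inj_on (pair_set n k) (pair_choices n k)"
proof (rule inj_onI)
  fix p q assume p: "p \<in> pair_choices n k" and q: "q \<in> pair_choices n k"
    and eq: "pair_set n k p = pair_set n k q"
  show "p = q"
  proof (rule PiE_ext[OF p q])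
    fix j assume "j \<in> {..<k}"
    then have j: "j < k" by simp
    have "pair_set n k p `` {j} = pair_set n k q `` {j}" by (simp add: eq)
    then have "{fst (p j), 2 ^ n + snd (p j)} = {fst (q j), 2 ^ n + snd (q j)}"
      using j by (auto simp: pair_set_def)
    then have "fst (p j) = fst (q j)" "snd (p j) = snd (q j)"
      using pair_choices_less[OF p j] pair_choices_less[OF q j] by (auto simp: doubleton_eq_iff)
    then show "p j = q j" by (simp add: prod_eq_iff)
  qed
qed

text \<open>Inside the box the sum runs over distinct sets of size \<open>2 * k\<close> and is
  bounded by the level weight. Outside, each of the \<open>(2 ^ n) ^ (2 * k)\<close> choices costs
  at most twice the excess. Adding both bounds gives one that holds everywhere and can be
  integrated.\<close>

lemma sum_pairs_abs_deriv_ext_le: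
  assumes \<H>: "\<H> \<subseteq> cube (coords n k) \<rightarrow>\<^sub>E {-1..1}"
    and closed: "closed_under_restrictions (coords n k) \<H>" and f: "f \<in> \<H>" and m: "m > 0"
  shows "(\<Sum>p\<in>pair_choices n k. \<bar>deriv_ext (coords n k) f (pair_set n k p) v\<bar>)
    \<le> 4 ^ k * family_level_weight (coords n k) (2 * k) \<H> + 2 * (2 ^ n) ^ (2 * k) * excess (coords n k) m v"
proof -
  let ?I = "coords n k" and ?L = "family_level_weight (coords n k) (2 * k) \<H>"
  have I: "finite ?I" by (simp add: coords_def)
  have bound: "\<bar>f z\<bar> \<le> 1" if "z \<in> cube ?I" for z
  proof -
    have "f \<in> cube ?I \<rightarrow>\<^sub>E {-1..1}" using f \<H> by blast
    from PiE_mem[OF this that] show ?thesis by auto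
  qed
  \<comment> \<open>The supremum inherits nonnegativity from the member \<open>f\<close>.\<close>
  have "0 \<le> level_weight ?I (2 * k) f"
    by (simp add: level_weight_def sum_nonneg)
  then have L: "0 \<le> ?L"
    using level_weight_le_family[OF I \<H> f, of "2 * k"] by linarith
  show ?thesis
  proof (cases "\<exists>i\<in>?I. \<bar>v i\<bar> > 1 / 2")
    case True
    then obtain i where i: "i \<in> ?I" "\<bar>v i\<bar> > 1 / 2" by blast
    have "(\<Sum>p\<in>pair_choices n k. \<bar>deriv_ext ?I f (pair_set n k p) v\<bar>)
        \<le> (\<Sum>p\<in>pair_choices n k. 2 * excess ?I m v)"
      by (intro sum_mono order_trans[OF abs_deriv_ext_le prod_max_le_excess[where i = i]] I m i bound)
    also have "\<dots> = 2 * (2 ^ n) ^ (2 * k) * excess ?I m v"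
      by (simp add: card_PiE power_mult power2_eq_square)
    finally show ?thesis using L by (simp add: add_increasing)
  next
    case False
    have "(\<Sum>p\<in>pair_choices n k. \<bar>deriv_ext ?I f (pair_set n k p) v\<bar>)
        = (\<Sum>P\<in>pair_set n k ` pair_choices n k. \<bar>deriv_ext ?I f P v\<bar>)"
      by (simp add: sum.reindex[OF inj_on_pair_set])
    also have "\<dots> \<le> (\<Sum>P | P \<subseteq> ?I \<and> card P = 2 * k. \<bar>deriv_ext ?I f P v\<bar>)"
      using I pair_set_subset card_pair_set by (intro sum_mono2) auto
    also have "\<dots> \<le> 2 ^ (2 * k) * ?L"
      using False by (intro sum_abs_deriv_ext_le I \<H> closed f) (auto simp: not_less)
    also have "\<dots> = 4 ^ k * ?L" by (simp add: power_mult)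
    finally show ?thesis using excess_nonneg[of ?I m v] by (simp add: add_increasing2)
  qed
qed

text \<open>The product vanishes unless \<open>T\<close> contains every chosen pair; otherwise it
  leaves the monomial of the remaining coordinates, which is a Fourier term of the derivative in the
  directions \<open>pair_set n k p\<close>.\<close>

lemma prod_pair_term:
  assumes p: "p \<in> pair_choices n k" and T: "T \<subseteq> coords n k"
  shows "(\<Prod>j<k. pair_term n \<epsilon> (T `` {j}) (p j) (w j)) =
    of_bool (pair_set n k p \<subseteq> T) * ((\<Prod>j<k. \<epsilon> * hadamard n (snd (p j)) (fst (p j))) *
      (\<Prod>c\<in>T - pair_set n k p. scaled_vec n (w (fst c)) (snd c)))"
proof (cases "pair_set n k p \<subseteq> T")
  case True
  have "(\<Prod>c\<in>T - pair_set n k p. scaled_vec n (w (fst c)) (snd c)) =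
      (\<Prod>j<k. \<Prod>i\<in>(T - pair_set n k p) `` {j}. scaled_vec n (w j) i)"
    using T by (intro prod_blocks[where B = "{..<2 * 2 ^ n}"]) (auto simp: coords_def)
  also have "\<dots> = (\<Prod>j<k. \<Prod>i\<in>T `` {j} - {fst (p j), 2 ^ n + snd (p j)}. scaled_vec n (w j) i)"
    by (intro prod.cong refl) (auto simp: pair_set_def)
  finally show ?thesis
    using True by (simp add: pair_term_def prod.distrib pair_set_def subset_iff mult.assoc)
next
  case False
  then obtain j where "j < k" "\<not> (fst (p j) \<in> T `` {j} \<and> 2 ^ n + snd (p j) \<in> T `` {j})"
    by (auto simp: pair_set_def)
  then have "\<exists>j\<in>{..<k}. pair_term n \<epsilon> (T `` {j}) (p j) (w j) = 0"
    by (intro bexI[of _ j]) (auto simp: pair_term_def)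
  then show ?thesis using False by (simp add: prod_zero)
qed

lemma finite_moments_deriv_ext_scaled:
  assumes \<epsilon>: "\<epsilon> > 0"
  shows "finite_moments (blocks_law n \<epsilon> k)
    (\<lambda>w. deriv_ext (coords n k) f P (\<lambda>c. scaled_vec n (w (fst c)) (snd c)))"
proof -
  note prob = prob_space_blocks_law[OF \<epsilon>]
  have fm: "finite_moments (blocks_law n \<epsilon> k) (\<lambda>w. scaled_vec n (w (fst c)) (snd c))" if "c \<in> coords n k" for c
    using that by (intro finite_moments_blocks_law[OF \<epsilon>, of n "\<lambda>w. scaled_vec n w i" for i]
      finite_moments_scaled_vec[OF \<epsilon>]) (auto simp: coords_def)
  have "finite_moments (blocks_law n \<epsilon> k) (\<lambda>w. if c \<in> P then z c / 2
      else (1 + z c * scaled_vec n (w (fst c)) (snd c)) / 2)" if "c \<in> coords n k" for c and z :: "nat \<times> nat \<Rightarrow> real"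
  proof (cases "c \<in> P")
    case False
    have "finite_moments (blocks_law n \<epsilon> k) (\<lambda>w. (1 + z c * scaled_vec n (w (fst c)) (snd c)) * (1 / 2))"
      by (intro finite_moments_intros prob fm that)
    then show ?thesis using False by simp
  qed (simp add: finite_moments_const prob)
  then show ?thesis
    unfolding deriv_ext_def by (intro finite_moments_intros(1,3,4,5) prob) auto
qed

section \<open>The alternating sum as an average of mixed derivatives\<close>

text \<open>Multiplying \<open>forr_moment_eq_pair_terms\<close> over the blocks and distributing
  gives a sum over one cross pair per block. For each choice, the Fourier terms that survive
  reassemble into the mixed derivative.\<close>

lemma alternating_sum_eq_integral:
  assumes \<epsilon>: "\<epsilon> > 0"
  shows "(\<Sum>T\<in>Pow (coords n k). fourier_coeff (coords n k) f T *
      (\<Prod>j<k. of_bool (T `` {j} \<noteq> {}) * forr_moment n \<epsilon> (T `` {j}))) =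
    (\<Sum>p\<in>pair_choices n k. (\<Prod>j<k. \<epsilon> * hadamard n (snd (p j)) (fst (p j))) *
      (\<integral>w. deriv_ext (coords n k) f (pair_set n k p) (\<lambda>c. scaled_vec n (w (fst c)) (snd c)) \<partial>blocks_law n \<epsilon> k))"
proof -
  let ?I = "coords n k" and ?\<Omega> = "blocks_law n \<epsilon> k"
  let ?Q = "{..<2 ^ n} \<times> {..<2 ^ n} :: (nat \<times> nat) set"
  have I: "finite ?I" by (simp add: coords_def)
  have int: "integrable ?\<Omega> (\<lambda>w. \<Prod>j<k. pair_term n \<epsilon> (T `` {j}) (p j) (w j))" for T p
    by (intro finite_moments_integrable finite_moments_prod prob_space_blocks_law[OF \<epsilon>]
      finite_moments_blocks_law[OF \<epsilon> finite_moments_pair_term[OF \<epsilon>]]) auto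
  have "(\<Prod>j<k. of_bool (T `` {j} \<noteq> {}) * forr_moment n \<epsilon> (T `` {j})) =
      (\<Sum>p\<in>pair_choices n k. \<integral>w. (\<Prod>j<k. pair_term n \<epsilon> (T `` {j}) (p j) (w j)) \<partial>?\<Omega>)" if T: "T \<in> Pow ?I" for T
  proof -
    have "(\<Prod>j<k. of_bool (T `` {j} \<noteq> {}) * forr_moment n \<epsilon> (T `` {j})) =
        (\<Prod>j<k. \<Sum>q\<in>?Q. \<integral>w. pair_term n \<epsilon> (T `` {j}) q w \<partial>block_law n \<epsilon>)"
      using T by (intro prod.cong refl forr_moment_eq_pair_terms[OF \<epsilon>]) (auto simp: coords_def)
    also have "\<dots> = (\<Sum>p\<in>pair_choices n k. \<Prod>j<k. \<integral>w. pair_term n \<epsilon> (T `` {j}) (p j) w \<partial>block_law n \<epsilon>)"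
      by (intro prod_sum_PiE) auto
    also have "\<dots> = (\<Sum>p\<in>pair_choices n k. \<integral>w. (\<Prod>j<k. pair_term n \<epsilon> (T `` {j}) (p j) (w j)) \<partial>?\<Omega>)"
      by (intro sum.cong refl blocks_law_integral_prod[symmetric] \<epsilon> finite_moments_pair_term)
    finally show ?thesis .
  qed
  then have "(\<Sum>T\<in>Pow ?I. fourier_coeff ?I f T * (\<Prod>j<k. of_bool (T `` {j} \<noteq> {}) * forr_moment n \<epsilon> (T `` {j}))) =
      (\<Sum>T\<in>Pow ?I. fourier_coeff ?I f T * (\<Sum>p\<in>pair_choices n k. \<integral>w. (\<Prod>j<k. pair_term n \<epsilon> (T `` {j}) (p j) (w j)) \<partial>?\<Omega>))"
    by (intro sum.cong refl arg_cong2[where f = times])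
  also have "\<dots> = (\<Sum>p\<in>pair_choices n k. \<Sum>T\<in>Pow ?I. fourier_coeff ?I f T * (\<integral>w. (\<Prod>j<k. pair_term n \<epsilon> (T `` {j}) (p j) (w j)) \<partial>?\<Omega>))"
    unfolding sum_distrib_left by (rule sum.swap)
  also have "\<dots> = (\<Sum>p\<in>pair_choices n k. \<integral>w. (\<Sum>T\<in>Pow ?I. fourier_coeff ?I f T * (\<Prod>j<k. pair_term n \<epsilon> (T `` {j}) (p j) (w j))) \<partial>?\<Omega>)"
    by (simp add: Bochner_Integration.integral_sum int)
  also have "\<dots> = (\<Sum>p\<in>pair_choices n k. \<integral>w. (\<Prod>j<k. \<epsilon> * hadamard n (snd (p j)) (fst (p j))) *
      deriv_ext ?I f (pair_set n k p) (\<lambda>c. scaled_vec n (w (fst c)) (snd c)) \<partial>?\<Omega>)"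
  proof (intro sum.cong refl Bochner_Integration.integral_cong)
    fix p w assume p: "p \<in> pair_choices n k"
    let ?V = "\<lambda>T. \<Prod>c\<in>T - pair_set n k p. scaled_vec n (w (fst c)) (snd c)"
    let ?h = "\<Prod>j<k. \<epsilon> * hadamard n (snd (p j)) (fst (p j))"
    have "(\<Sum>T\<in>Pow ?I. fourier_coeff ?I f T * (\<Prod>j<k. pair_term n \<epsilon> (T `` {j}) (p j) (w j))) =
        (\<Sum>T\<in>Pow ?I. fourier_coeff ?I f T * (of_bool (pair_set n k p \<subseteq> T) * (?h * ?V T)))"
      by (intro sum.cong refl arg_cong2[where f = times] prod_pair_term p) auto
    also have "\<dots> = (\<Sum>T | pair_set n k p \<subseteq> T \<and> T \<subseteq> ?I. ?h * (fourier_coeff ?I f T * ?V T))"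
      using I by (intro sum.mono_neutral_cong_right) auto
    also have "\<dots> = ?h * deriv_ext ?I f (pair_set n k p) (\<lambda>c. scaled_vec n (w (fst c)) (snd c))"
      by (simp only: deriv_ext_fourier[OF I pair_set_subset[OF p]] sum_distrib_left)
    finally show "(\<Sum>T\<in>Pow ?I. fourier_coeff ?I f T * (\<Prod>j<k. pair_term n \<epsilon> (T `` {j}) (p j) (w j))) =
        ?h * deriv_ext ?I f (pair_set n k p) (\<lambda>c. scaled_vec n (w (fst c)) (snd c))" .
  qed
  finally show ?thesis by simp
qed

text \<open>All Hadamard entries have the same modulus, so the coefficient of every choice of pairs
  is (\<epsilon> / sqrt N)^k in absolute value and can be pulled out. The absolute derivatives are
  then summed pointwise before integrating.\<close>

lemma abs_alternating_sum_le:
  assumes \<epsilon>: "\<epsilon> > 0" and \<H>: "\<H> \<subseteq> cube (coords n k) \<rightarrow>\<^sub>E {-1..1}"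
    and closed: "closed_under_restrictions (coords n k) \<H>" and f: "f \<in> \<H>" and m: "m > 0"
  shows "\<bar>\<Sum>T\<in>Pow (coords n k). fourier_coeff (coords n k) f T *
      (\<Prod>j<k. of_bool (T `` {j} \<noteq> {}) * forr_moment n \<epsilon> (T `` {j}))\<bar>
    \<le> (\<epsilon> / sqrt (2 ^ n)) ^ k * (4 ^ k * family_level_weight (coords n k) (2 * k) \<H> +
        2 * (2 ^ n) ^ (2 * k) * total_excess n \<epsilon> k m)"
proof -
  let ?I = "coords n k" and ?\<Omega> = "blocks_law n \<epsilon> k"
  let ?L = "family_level_weight (coords n k) (2 * k) \<H>"
  let ?d = "\<lambda>p w. deriv_ext ?I f (pair_set n k p) (\<lambda>c. scaled_vec n (w (fst c)) (snd c))"
  interpret \<Omega>: prob_space ?\<Omega> by (rule prob_space_blocks_law[OF \<epsilon>])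
  have int: "integrable ?\<Omega> (?d p)" for p
    by (intro finite_moments_integrable finite_moments_deriv_ext_scaled \<epsilon>)
  have h: "\<bar>\<Prod>j<k. \<epsilon> * hadamard n (snd (p j)) (fst (p j))\<bar> = (\<epsilon> / sqrt (2 ^ n)) ^ k" for p
    using \<epsilon> by (simp add: abs_prod abs_mult abs_hadamard)
  have "\<bar>\<Sum>T\<in>Pow ?I. fourier_coeff ?I f T * (\<Prod>j<k. of_bool (T `` {j} \<noteq> {}) * forr_moment n \<epsilon> (T `` {j}))\<bar>
      \<le> (\<Sum>p\<in>pair_choices n k. (\<epsilon> / sqrt (2 ^ n)) ^ k * \<bar>\<integral>w. ?d p w \<partial>?\<Omega>\<bar>)"
    unfolding alternating_sum_eq_integral[OF \<epsilon>]
    by (rule order_trans[OF sum_abs]) (simp add: abs_mult h)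
  also have "\<dots> \<le> (\<Sum>p\<in>pair_choices n k. (\<epsilon> / sqrt (2 ^ n)) ^ k * (\<integral>w. \<bar>?d p w\<bar> \<partial>?\<Omega>))"
    using \<epsilon> by (intro sum_mono mult_left_mono integral_abs_bound) auto
  also have "\<dots> = (\<epsilon> / sqrt (2 ^ n)) ^ k * (\<integral>w. (\<Sum>p\<in>pair_choices n k. \<bar>?d p w\<bar>) \<partial>?\<Omega>)"
    by (simp add: Bochner_Integration.integral_sum int sum_distrib_left)
  also have "\<dots> \<le> (\<epsilon> / sqrt (2 ^ n)) ^ k *
      (\<integral>w. 4 ^ k * ?L + 2 * (2 ^ n) ^ (2 * k) * excess ?I m (blocks_vec n w) \<partial>?\<Omega>)"
  proof (intro mult_left_mono integral_mono)
    fix w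
    have "(\<Sum>p\<in>pair_choices n k. \<bar>?d p w\<bar>) \<le>
        4 ^ k * ?L + 2 * (2 ^ n) ^ (2 * k) * excess ?I m (\<lambda>c. scaled_vec n (w (fst c)) (snd c))"
      by (rule sum_pairs_abs_deriv_ext_le[OF \<H> closed f m])
    also have "\<dots> \<le> 4 ^ k * ?L + 2 * (2 ^ n) ^ (2 * k) * excess ?I m (blocks_vec n w)"
      using clamp_bounds by (intro add_left_mono mult_left_mono excess_mono)
        (auto simp: scaled_vec_def blocks_vec_def abs_mult mult_left_le_one_le)
    finally show "(\<Sum>p\<in>pair_choices n k. \<bar>?d p w\<bar>) \<le>
        4 ^ k * ?L + 2 * (2 ^ n) ^ (2 * k) * excess ?I m (blocks_vec n w)" .
  qed (use \<epsilon> int integrable_excess[OF \<epsilon>] in auto)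
  also have "\<dots> = (\<epsilon> / sqrt (2 ^ n)) ^ k * (4 ^ k * ?L + 2 * (2 ^ n) ^ (2 * k) * total_excess n \<epsilon> k m)"
    using integrable_excess[OF \<epsilon>] by (simp add: total_excess_def \<Omega>.prob_space)
  finally show ?thesis .
qed

text \<open>For fixed \<open>T\<close> the signed sum over \<open>S\<close> is the expansion of a
  product of differences. Each factor is the value at the origin minus the block moment: 0 for an
  empty slice and minus the moment otherwise.\<close>

lemma alternating_sum_expand:
  assumes \<epsilon>: "\<epsilon> > 0"
  shows "(\<Sum>S\<in>Pow {..<k}. (-1) ^ card S * (\<Sum>T\<in>Pow (coords n k). fourier_coeff (coords n k) f T *
        (\<Prod>j<k. if j \<in> S then forr_moment n \<epsilon> (T `` {j}) else of_bool (T `` {j} = {})))) =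
    (-1) ^ k * (\<Sum>T\<in>Pow (coords n k). fourier_coeff (coords n k) f T *
      (\<Prod>j<k. of_bool (T `` {j} \<noteq> {}) * forr_moment n \<epsilon> (T `` {j})))"
proof -
  interpret G: prob_space "gauss_prod (2 ^ n) \<epsilon>" by (rule prob_space_gauss_prod[OF \<epsilon>])
  have empty: "forr_moment n \<epsilon> {} = 1" by (simp add: forr_moment_def G.prob_space)
  have T: "(\<Sum>S\<in>Pow {..<k}. (-1) ^ card S * (\<Prod>j<k. if j \<in> S then a j else b j)) = (\<Prod>j<k. - a j + b j)"
    for a b :: "nat \<Rightarrow> real"
  proof -
    have "(\<Prod>j<k. if j \<in> S then a j else b j) = (\<Prod>j\<in>S. a j) * (\<Prod>j\<in>{..<k} - S. b j)" if "S \<subseteq> {..<k}" for S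
      using that by (simp add: prod.If_cases Int_absorb1 Diff_eq)
    then show ?thesis
      by (subst prod_add) (auto simp: prod_uminus mult.assoc intro!: sum.cong)
  qed
  have "(\<Sum>S\<in>Pow {..<k}. (-1) ^ card S * (\<Sum>T\<in>Pow (coords n k). fourier_coeff (coords n k) f T *
        (\<Prod>j<k. if j \<in> S then forr_moment n \<epsilon> (T `` {j}) else of_bool (T `` {j} = {})))) =
      (\<Sum>T\<in>Pow (coords n k). fourier_coeff (coords n k) f T * (\<Sum>S\<in>Pow {..<k}. (-1) ^ card S *
        (\<Prod>j<k. if j \<in> S then forr_moment n \<epsilon> (T `` {j}) else of_bool (T `` {j} = {}))))"
    unfolding sum_distrib_left by (subst sum.swap) (simp only: mult.left_commute)
  also have "\<dots> = (\<Sum>T\<in>Pow (coords n k). fourier_coeff (coords n k) f T *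
      (\<Prod>j<k. - (of_bool (T `` {j} \<noteq> {}) * forr_moment n \<epsilon> (T `` {j}))))"
    unfolding T by (intro sum.cong prod.cong arg_cong2[where f = times] refl) (auto simp: empty)
  also have "\<dots> = (\<Sum>T\<in>Pow (coords n k). fourier_coeff (coords n k) f T *
      ((-1) ^ k * (\<Prod>j<k. of_bool (T `` {j} \<noteq> {}) * forr_moment n \<epsilon> (T `` {j}))))"
    unfolding prod_uminus card_lessThan ..
  finally show ?thesis
    unfolding sum_distrib_left by (simp only: mult.left_commute)
qed

lemma expectation_mu_diff:
  fixes H :: "(nat \<times> nat \<Rightarrow> real) \<Rightarrow> real"
  assumes n: "n > 0" and k: "k > 0"
  shows "measure_pmf.expectation (mu0 n k) H - measure_pmf.expectation (mu1 n k) H =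
    (\<Sum>S\<in>Pow {..<k}. (-1) ^ card S *
      measure_pmf.expectation (block_product n k (rounded_forrelation n k) (uniform_cube n) S) H) / 2 ^ (k - 1)"
proof -
  let ?B = "block_product n k (rounded_forrelation n k) (uniform_cube n)"
  let ?e = "\<lambda>S. measure_pmf.expectation (?B S) H"
  let ?E = "{S. S \<subseteq> {..<k} \<and> even (card S)}" and ?O = "{S. S \<subseteq> {..<k} \<and> odd (card S)}"
  have finB: "finite (set_pmf (?B S))" for S
  proof -
    have "finite (set_pmf (rounded_forrelation n k))" "finite (set_pmf (uniform_cube n))"
      using rounded_forrelation_moment(2)[OF n k, of "{}"] uniform_cube_moment(2)[of "{}" n]
        finite_cube[of "{..<2 * 2 ^ n :: nat}"] by (auto intro: finite_subset)
    then have "finite (set_pmf (if j \<in> S then rounded_forrelation n k else uniform_cube n))" for j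
      by simp
    then have "finite (set_pmf (Pi_pmf {..<k} undefined (\<lambda>j. if j \<in> S then rounded_forrelation n k else uniform_cube n)))"
      by (intro finite_subset[OF _ finite_PiE[of "{..<k}"
          "\<lambda>j. set_pmf (if j \<in> S then rounded_forrelation n k else uniform_cube n)"]])
        (auto simp: set_Pi_pmf PiE_dflt_def)
    then show ?thesis by (simp add: block_product_def)
  qed
  have mix: "measure_pmf.expectation (bind_pmf (pmf_of_set A) ?B) H = (\<Sum>S\<in>A. ?e S) / 2 ^ (k - 1)"
    if "card A = 2 ^ (k - 1)" for A
  proof -
    have "finite A" "A \<noteq> {}" using that by (auto intro: card_ge_0_finite)
    then show ?thesis
      using that finB by (subst pmf_expectation_bind_pmf_of_set)
        (simp_all add: divide_inverse sum_distrib_left mult.commute)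
  qed
  have "(\<Sum>S\<in>Pow {..<k}. (-1) ^ card S * ?e S) = (\<Sum>S\<in>?E \<union> ?O. (-1) ^ card S * ?e S)"
    by (intro sum.cong) auto
  also have "\<dots> = (\<Sum>S\<in>?E. (-1) ^ card S * ?e S) + (\<Sum>S\<in>?O. (-1) ^ card S * ?e S)"
    by (intro sum.union_disjoint) auto
  also have "\<dots> = (\<Sum>S\<in>?E. ?e S) - (\<Sum>S\<in>?O. ?e S)"
    by (simp add: sum_negf)
  finally show ?thesis
    unfolding mu0_def mu1_def mix[OF card_parity_subsets(1)[OF k]] mix[OF card_parity_subsets(2)[OF k]]
    by (simp add: diff_divide_distrib)
qed

text \<open>Each of the \<open>2 ^ k\<close> sets \<open>S\<close> contributes one truncation error;
  the main parts combine, signs included, into the alternating sum.\<close>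

lemma abs_expectation_mu_diff_le:
  assumes n: "n > 0" and k: "k > 0" and m: "m > 0"
    and \<H>: "\<H> \<subseteq> cube (coords n k) \<rightarrow>\<^sub>E {-1..1}"
    and closed: "closed_under_restrictions (coords n k) \<H>" and H: "H \<in> \<H>"
  shows "\<bar>measure_pmf.expectation (mu0 n k) H - measure_pmf.expectation (mu1 n k) H\<bar> \<le>
    (2 ^ k * (4 * total_excess n (eps n k) k m) +
     (eps n k / sqrt (2 ^ n)) ^ k * (4 ^ k * family_level_weight (coords n k) (2 * k) \<H> +
        2 * (2 ^ n) ^ (2 * k) * total_excess n (eps n k) k m)) / 2 ^ (k - 1)"
proof -
  let ?B = "block_product n k (rounded_forrelation n k) (uniform_cube n)"
  let ?e = "\<lambda>S. measure_pmf.expectation (?B S) H"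
  let ?g = "\<lambda>S. \<Sum>T\<in>Pow (coords n k). fourier_coeff (coords n k) H T *
        (\<Prod>j<k. if j \<in> S then forr_moment n (eps n k) (T `` {j}) else of_bool (T `` {j} = {}))"
  let ?x = "total_excess n (eps n k) k m"
  note \<epsilon> = eps_pos[OF n k]
  have bound: "\<bar>H z\<bar> \<le> 1" if "z \<in> cube (coords n k)" for z
  proof -
    have "H \<in> cube (coords n k) \<rightarrow>\<^sub>E {-1..1}" using H \<H> by blast
    from PiE_mem[OF this that] show ?thesis by auto
  qed
  have "\<bar>\<Sum>S\<in>Pow {..<k}. (-1) ^ card S * ?e S\<bar> =
      \<bar>(\<Sum>S\<in>Pow {..<k}. (-1) ^ card S * (?e S - ?g S)) + (\<Sum>S\<in>Pow {..<k}. (-1) ^ card S * ?g S)\<bar>"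
    by (simp add: sum.distrib[symmetric] algebra_simps)
  also have "\<dots> \<le> (\<Sum>S\<in>Pow {..<k}. \<bar>?e S - ?g S\<bar>) + \<bar>\<Sum>S\<in>Pow {..<k}. (-1) ^ card S * ?g S\<bar>"
    by (intro order_trans[OF abs_triangle_ineq] add_right_mono order_trans[OF sum_abs])
      (simp add: abs_mult power_abs)
  also have "(\<Sum>S\<in>Pow {..<k}. \<bar>?e S - ?g S\<bar>) \<le> (\<Sum>S\<in>Pow {..<k}. 4 * ?x)"
    by (intro sum_mono expectation_block_product_approx n k m bound) auto
  also have "\<dots> = 2 ^ k * (4 * ?x)" by (simp add: card_Pow)
  also have "\<bar>\<Sum>S\<in>Pow {..<k}. (-1) ^ card S * ?g S\<bar> \<le> (eps n k / sqrt (2 ^ n)) ^ k *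
      (4 ^ k * family_level_weight (coords n k) (2 * k) \<H> + 2 * (2 ^ n) ^ (2 * k) * ?x)"
    unfolding alternating_sum_expand[OF \<epsilon>] abs_mult power_abs
    using abs_alternating_sum_le[OF \<epsilon> \<H> closed H m] by simp
  finally show ?thesis
    unfolding expectation_mu_diff[OF n k] by (simp add: divide_right_mono)
qed

section \<open>Size of the error terms\<close>

text \<open>The square is a polynomial 1 + 2 y + y^2 with y = 4^m x^(2m), so
  \<open>orthonormal_prod_poly\<close> evaluates it through two Gaussian moments; \<open>c\<close>
  lists its coefficients.\<close>

lemma orthonormal_growth:
  assumes \<epsilon>: "\<epsilon> > 0"
    and orth: "\<And>i j. i < N \<Longrightarrow> j < N \<Longrightarrow> (\<Sum>b<N. A i b * A j b) = of_bool (i = j)"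
  shows "(\<integral>x. (\<Prod>i<N. 1 + (2 * lin_form N (A i) x) ^ (2 * m))\<^sup>2 \<partial>gauss_prod N \<epsilon>) =
    (1 + (2 * 4 ^ m * gauss_moment \<epsilon> (2 * m) + 16 ^ m * gauss_moment \<epsilon> (2 * (2 * m)))) ^ N"
proof -
  define c :: "nat \<Rightarrow> real" where "c t = (if t = 0 then 1 else if t = 1 then 2 * 4 ^ m else 16 ^ m)" for t
  have "(1 + (2 * x) ^ (2 * m))\<^sup>2 = (\<Sum>t\<in>{0, 1, 2}. c t * x ^ (2 * (t * m)))" for x :: real
  proof -
    have u: "(2 * x) ^ (2 * m) = 4 ^ m * x ^ (2 * m)"
      by (simp add: power_mult_distrib power_mult)
    have u2: "(4 ^ m * x ^ (2 * m))\<^sup>2 = 16 ^ m * x ^ (2 * (2 * m))"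
    proof -
      have "(4 ^ m)\<^sup>2 = (16 :: real) ^ m" by (simp add: power2_eq_square power_mult_distrib[symmetric])
      moreover have "(x ^ (2 * m))\<^sup>2 = x ^ (2 * (2 * m))" by (simp add: power_mult[symmetric] mult.commute)
      ultimately show ?thesis by (simp only: power_mult_distrib)
    qed
    have "(1 + y)\<^sup>2 = 1 + 2 * y + y\<^sup>2" for y :: real
      by (simp add: power2_sum)
    then have "(1 + (2 * x) ^ (2 * m))\<^sup>2 = 1 + 2 * (4 ^ m * x ^ (2 * m)) + 16 ^ m * x ^ (2 * (2 * m))"
      unfolding u u2[symmetric] .
    then show ?thesis by (simp add: c_def)
  qed
  then have "(\<integral>x. (\<Prod>i<N. 1 + (2 * lin_form N (A i) x) ^ (2 * m))\<^sup>2 \<partial>gauss_prod N \<epsilon>) =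
      (\<integral>x. (\<Prod>i<N. \<Sum>t\<in>{0, 1, 2}. c t * lin_form N (A i) x ^ (2 * (t * m))) \<partial>gauss_prod N \<epsilon>)"
    by (simp only: prod_power_distrib)
  also have "\<dots> = (\<Sum>t\<in>{0, 1, 2}. c t * gauss_moment \<epsilon> (2 * (t * m))) ^ N"
    by (intro orthonormal_prod_poly \<epsilon> orth) auto
  finally show ?thesis using \<epsilon> by (simp add: c_def)
qed

text \<open>Both halves of a block consist of i.i.d. Gaussians; AM-GM decouples them.\<close>

lemma block_growth_le:
  assumes \<epsilon>: "\<epsilon> > 0"
  shows "(\<integral>w. (\<Prod>i<2 * 2 ^ n. 1 + (2 * forr_vec n (snd w) i) ^ (2 * m)) \<partial>block_law n \<epsilon>) \<le>
    (1 + (2 * 4 ^ m * gauss_moment \<epsilon> (2 * m) + 16 ^ m * gauss_moment \<epsilon> (2 * (2 * m)))) ^ 2 ^ n"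
    (is "_ \<le> ?b")
proof -
  let ?N = "2 ^ n :: nat"
  let ?G = "gauss_prod ?N \<epsilon>"
  let ?X = "\<lambda>x. \<Prod>i<?N. 1 + (2 * lin_form ?N (forr_row n i) x) ^ (2 * m)"
  let ?Y = "\<lambda>x. \<Prod>i<?N. 1 + (2 * lin_form ?N (forr_row n (?N + i)) x) ^ (2 * m)"
  have XY: "finite_moments ?G ?X" "finite_moments ?G ?Y"
    by (intro finite_moments_intros prob_space_gauss_prod finite_moments_lin_form \<epsilon>)+
  have split: "(\<Prod>i<2 * ?N. g i) = (\<Prod>i<?N. g i) * (\<Prod>i<?N. g (?N + i))" for g :: "nat \<Rightarrow> real"
  proof -
    have "(\<Prod>i<2 * ?N. g i) = (\<Prod>i\<in>{..<?N}. g i) * (\<Prod>i\<in>{?N..<?N + ?N}. g i)"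
      by (subst prod.union_disjoint[symmetric]) (auto intro!: prod.cong)
    also have "(\<Prod>i\<in>{?N..<?N + ?N}. g i) = (\<Prod>i<?N. g (?N + i))"
      by (intro prod.reindex_bij_witness[where i = "\<lambda>i. ?N + i" and j = "\<lambda>i. i - ?N"]) auto
    finally show ?thesis .
  qed
  have eq: "(\<Prod>i<2 * ?N. 1 + (2 * forr_vec n x i) ^ (2 * m)) = ?X x * ?Y x" for x
    unfolding split forr_vec_def ..
  have "(\<integral>w. (\<Prod>i<2 * ?N. 1 + (2 * forr_vec n (snd w) i) ^ (2 * m)) \<partial>block_law n \<epsilon>) = (\<integral>x. ?X x * ?Y x \<partial>?G)"
    unfolding eq by (intro block_law_integral_snd[OF \<epsilon>] finite_moments_integrable finite_moments_mult XY)
  also have "\<dots> \<le> (\<integral>x. ((?X x)\<^sup>2 + (?Y x)\<^sup>2) / 2 \<partial>?G)"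
  proof (rule integral_mono)
    show "integrable ?G (\<lambda>x. ?X x * ?Y x)"
      by (intro finite_moments_integrable finite_moments_mult XY)
    show "integrable ?G (\<lambda>x. ((?X x)\<^sup>2 + (?Y x)\<^sup>2) / 2)"
      by (intro integrable_divide finite_moments_integrable finite_moments_add finite_moments_power XY
        prob_space_gauss_prod \<epsilon>)
    fix x
    show "?X x * ?Y x \<le> ((?X x)\<^sup>2 + (?Y x)\<^sup>2) / 2"
      using sum_squares_bound[of "?X x" "?Y x"] by simp
  qed
  also have "\<dots> = ((\<integral>x. (?X x)\<^sup>2 \<partial>?G) + (\<integral>x. (?Y x)\<^sup>2 \<partial>?G)) / 2"
  proof -
    have "integrable ?G (\<lambda>x. (?X x)\<^sup>2)" "integrable ?G (\<lambda>x. (?Y x)\<^sup>2)"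
      by (intro finite_moments_integrable finite_moments_power XY prob_space_gauss_prod \<epsilon>)+
    then show ?thesis
      by (simp only: integral_divide_zero Bochner_Integration.integral_add)
  qed
  also have "\<dots> = (?b + ?b) / 2"
    by (subst (1 2) orthonormal_growth[OF \<epsilon>]) (auto simp: forr_row_gram)
  finally show ?thesis by simp
qed

lemma total_excess_le_growth:
  assumes \<epsilon>: "\<epsilon> > 0"
  shows "total_excess n \<epsilon> k m \<le>
    (1 + (2 * 4 ^ m * gauss_moment \<epsilon> (2 * m) + 16 ^ m * gauss_moment \<epsilon> (2 * (2 * m)))) ^ (2 ^ n * k) - 1"
    (is "_ \<le> ?b ^ (2 ^ n * k) - 1")
proof -
  let ?\<Omega> = "blocks_law n \<epsilon> k"
  let ?P = "\<lambda>w. \<Prod>i<2 * 2 ^ n. 1 + (2 * forr_vec n (snd w) i) ^ (2 * m)"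
  interpret \<Omega>: prob_space ?\<Omega> by (rule prob_space_blocks_law[OF \<epsilon>])
  have fm: "finite_moments (block_law n \<epsilon>) ?P"
    by (intro finite_moments_intros prob_space_block_law finite_moments_forr_vec_snd \<epsilon>)
  have int: "integrable ?\<Omega> (\<lambda>w. \<Prod>j<k. ?P (w j))"
    by (intro finite_moments_integrable finite_moments_prod \<Omega>.prob_space_axioms
      finite_moments_blocks_law[OF \<epsilon> fm]) auto
  have "excess (coords n k) m (blocks_vec n w) = (\<Prod>j<k. ?P (w j)) - 1" for w
    by (simp add: excess_def coords_def blocks_vec_def prod.cartesian_product case_prod_unfold)
  then have "total_excess n \<epsilon> k m = (\<integral>w. (\<Prod>j<k. ?P (w j)) \<partial>?\<Omega>) - 1"
    using int by (simp add: total_excess_def \<Omega>.prob_space)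
  also have "(\<integral>w. (\<Prod>j<k. ?P (w j)) \<partial>?\<Omega>) = (\<integral>w. ?P w \<partial>block_law n \<epsilon>) ^ k"
    by (subst blocks_law_integral_prod[OF \<epsilon> fm]) simp
  also have "\<dots> \<le> (?b ^ 2 ^ n) ^ k"
    by (intro power_mono block_growth_le[OF \<epsilon>] Bochner_Integration.integral_nonneg prod_nonneg) auto
  finally show ?thesis by (simp add: power_mult)
qed

text \<open>The choice m = 2 k^2 n cancels the k^2 ln N in the variance: \<epsilon> m is the
  constant 1 / (30 ln 2), at most 1/20. The moments then beat the powers 4^m and 16^m and leave
  \<open>q\<close>, which is N^(-4 k^2).\<close>

lemma total_excess_le:
  assumes n: "n > 0" and k: "k > 0" and kn: "k \<le> 2 ^ n"
  shows "total_excess n (eps n k) k (2 * k\<^sup>2 * n) \<le> 6 * real k * 2 ^ n / (2 ^ n) ^ (4 * k\<^sup>2)"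
proof -
  let ?\<epsilon> = "eps n k" and ?m = "2 * k\<^sup>2 * n"
  let ?d = "2 * 4 ^ ?m * gauss_moment ?\<epsilon> (2 * ?m) + 16 ^ ?m * gauss_moment ?\<epsilon> (2 * (2 * ?m))"
  define q :: real where "q = 1 / (2 ^ n) ^ (4 * k\<^sup>2)"
  note \<epsilon> = eps_pos[OF n k]
  have q: "q = (1 / 4) ^ ?m" "q = (1 / 2) ^ (2 * ?m)"
  proof -
    show "q = (1 / 2) ^ (2 * ?m)"
      by (simp add: q_def power_one_over power_mult[symmetric] mult.commute)
    also have "\<dots> = ((1 / 2)\<^sup>2) ^ ?m" by (rule power_mult)
    also have "(1 / 2)\<^sup>2 = (1 / 4 :: real)" by (simp add: power2_eq_square)
    finally show "q = (1 / 4) ^ ?m" .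
  qed
  have "?\<epsilon> * real ?m = 2 / (60 * ln 2)"
    using n k by (simp add: eps_def ln_realpow field_simps)
  also have "\<dots> \<le> 2 / (60 * (2 / 3))"
    using ln2_ge_two_thirds by (intro divide_left_mono) auto
  finally have em: "?\<epsilon> * real ?m \<le> 1 / 20" by simp
  have em0: "0 \<le> ?\<epsilon> * real ?m" using \<epsilon> by simp
  have "4 ^ ?m * gauss_moment ?\<epsilon> (2 * ?m) \<le> 4 ^ ?m * (?\<epsilon> * real ?m) ^ ?m"
    by (intro mult_left_mono gauss_moment_le \<epsilon>) auto
  also have "\<dots> = (4 * (?\<epsilon> * real ?m)) ^ ?m" by (simp only: power_mult_distrib)
  also have "\<dots> \<le> (1 / 4) ^ ?m" using em em0 by (intro power_mono) auto
  finally have a: "4 ^ ?m * gauss_moment ?\<epsilon> (2 * ?m) \<le> q" by (simp add: q)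
  have "16 ^ ?m * gauss_moment ?\<epsilon> (2 * (2 * ?m)) \<le> 4 ^ (2 * ?m) * (?\<epsilon> * real (2 * ?m)) ^ (2 * ?m)"
    using gauss_moment_le[OF \<epsilon>, of "2 * ?m"] by (simp add: power_mult)
  also have "\<dots> = (4 * (?\<epsilon> * real (2 * ?m))) ^ (2 * ?m)" by (simp only: power_mult_distrib)
  also have "\<dots> \<le> (1 / 2) ^ (2 * ?m)" using em em0 by (intro power_mono) auto
  finally have b: "16 ^ ?m * gauss_moment ?\<epsilon> (2 * (2 * ?m)) \<le> q" by (simp add: q(2))
  have d: "?d \<le> 3 * q" using a b by simp
  have mom: "0 \<le> gauss_moment ?\<epsilon> (2 * p)" for p
    using \<epsilon> by (simp add: gauss_moment_even)
  have d0: "0 \<le> ?d" by (intro add_nonneg_nonneg mult_nonneg_nonneg mom) auto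
  let ?M = "real (2 ^ n * k)"
  \<comment> \<open>For y in [0,1], exp y \<le> 1 + y + y^2 \<le> 1 + 2 y. With y =
    \<open>?M * (3 * q)\<close> this accounts for the 6 in the claim.\<close>
  have Mq: "?M * (3 * q) \<le> 1"
  proof -
    have "(2::real) ^ n * 2 ^ n * (2 ^ n) ^ 2 \<le> (2 ^ n) ^ (4 * k\<^sup>2)"
    proof -
      have "(2::real) ^ n * 2 ^ n * (2 ^ n) ^ 2 = (2 ^ n) ^ 4"
        by (simp add: power_numeral_reduce)
      also have "\<dots> \<le> (2 ^ n) ^ (4 * k\<^sup>2)" using k by (intro power_increasing) auto
      finally show ?thesis .
    qed
    moreover have "(3::real) \<le> (2 ^ n) ^ 2"
      using power_increasing[of 1 n "2::real"] n power_mono[of 2 "2 ^ n :: real" 2] by simp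
    then have "2 ^ n * real k * 3 \<le> 2 ^ n * 2 ^ n * (2 ^ n) ^ 2"
      using kn by (intro mult_mono) auto
    ultimately have "2 ^ n * real k * 3 \<le> (2 ^ n) ^ (4 * k\<^sup>2)"
      by linarith
    then show ?thesis by (simp add: q_def)
  qed
  have "total_excess n ?\<epsilon> k ?m \<le> (1 + ?d) ^ (2 ^ n * k) - 1"
    by (rule total_excess_le_growth[OF \<epsilon>])
  also have "\<dots> \<le> exp (3 * q) ^ (2 ^ n * k) - 1"
  proof (intro diff_right_mono power_mono)
    show "1 + ?d \<le> exp (3 * q)" using d exp_ge_add_one_self[of "3 * q"] by linarith
    show "0 \<le> 1 + ?d" using d0 by linarith
  qed
  also have "exp (3 * q) ^ (2 ^ n * k) = exp (?M * (3 * q))"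
    by (simp add: exp_of_nat_mult[symmetric])
  also have "\<dots> \<le> 1 + ?M * (3 * q) + (?M * (3 * q))\<^sup>2"
    using Mq by (intro exp_bound) (auto simp: q_def)
  also have "(?M * (3 * q))\<^sup>2 \<le> ?M * (3 * q)"
    unfolding power2_eq_square using Mq by (intro mult_left_le) (auto simp: q_def)
  finally show ?thesis by (simp add: q_def mult_ac)
qed

section \<open>Combining the bounds for fixed n\<close>

lemma mu_diff_bound:
  assumes n: "n > 0" and k: "k > 0" and kn: "k \<le> 2 ^ n"
    and \<H>: "\<H> \<subseteq> cube (coords n k) \<rightarrow>\<^sub>E {-1..1}"
    and closed: "closed_under_restrictions (coords n k) \<H>" and H: "H \<in> \<H>"
  defines "X \<equiv> 6 * real k * 2 ^ n / (2 ^ n) ^ (4 * k\<^sup>2)"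
  shows "\<bar>measure_pmf.expectation (mu0 n k) H - measure_pmf.expectation (mu1 n k) H\<bar>
    \<le> 2 * (family_level_weight (coords n k) (2 * k) \<H> / (2 ^ n) powr (real k / 2)) +
      (8 * X + 2 * (2 ^ n) ^ (2 * k) * X / (2 ^ n) powr (real k / 2))"
proof -
  let ?\<epsilon> = "eps n k" and ?L = "family_level_weight (coords n k) (2 * k) \<H>"
  let ?s = "sqrt (2 ^ n) ^ k" and ?x = "total_excess n (eps n k) k (2 * k\<^sup>2 * n)"
  note \<epsilon> = eps_pos[OF n k]
  have I: "finite (coords n k)" by (simp add: coords_def)
  have s: "(2 ^ n) powr (real k / 2) = ?s"
    by (simp add: powr_half_sqrt[symmetric] powr_powr powr_realpow[symmetric])
  have s0: "?s > 0" by simp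
  have x: "?x \<le> X" unfolding X_def by (rule total_excess_le[OF n k kn])
  have x0: "0 \<le> ?x" unfolding total_excess_def by (intro Bochner_Integration.integral_nonneg excess_nonneg)
  have "0 \<le> level_weight (coords n k) (2 * k) H"
    by (simp add: level_weight_def sum_nonneg)
  then have L: "0 \<le> ?L"
    using level_weight_le_family[OF I \<H> H, of "2 * k"] by linarith
  \<comment> \<open>The normalisation turns 4^k \<epsilon>^k / 2^(k - 1) into 2 (2 \<epsilon>)^k, so
    this keeps the constant independent of \<open>k\<close>.\<close>
  have e: "2 * ?\<epsilon> \<le> 1"
  proof -
    have "1 \<le> real k ^ 2 * real n" using n k by (simp add: Suc_leI one_le_power mult_ge1_I)
    moreover have "(1::real) \<le> 30 * ln 2" using ln2_ge_two_thirds by simp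
    ultimately have "1 * 1 \<le> (real k ^ 2 * real n) * (30 * ln 2)"
      by (intro mult_mono) auto
    then show ?thesis using n k by (simp add: eps_def ln_realpow field_simps)
  qed
  have two: "(2::real) ^ k = 2 * 2 ^ (k - 1)" using k by (cases k) auto
  have "\<bar>measure_pmf.expectation (mu0 n k) H - measure_pmf.expectation (mu1 n k) H\<bar> \<le>
      (2 ^ k * (4 * ?x) + (?\<epsilon> / sqrt (2 ^ n)) ^ k * (4 ^ k * ?L + 2 * (2 ^ n) ^ (2 * k) * ?x)) / 2 ^ (k - 1)"
    using n k by (intro abs_expectation_mu_diff_le \<H> closed H) auto
  also have "\<dots> = 8 * ?x + 2 * ((2 * ?\<epsilon>) ^ k * ?L / ?s) + ?\<epsilon> ^ k / 2 ^ (k - 1) * (2 * (2 ^ n) ^ (2 * k) * ?x / ?s)"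
  proof -
    have "(4::real) ^ k = 2 ^ k * 2 ^ k" by (simp add: power_mult_distrib[symmetric])
    then have four: "(4::real) ^ k = 4 * 2 ^ (k - 1) * 2 ^ (k - 1)" by (simp add: two)
    have "(2 * p * (4 * x) + e / s * (4 * p * p * L + Y)) / p = 8 * x + 2 * (2 * p * e * L / s) + e / p * (Y / s)"
      if "p > 0" "s > 0" for p s e x L Y :: real
      using that by (simp add: field_simps)
    then show ?thesis
      unfolding power_divide power_mult_distrib four two by simp
  qed
  also have "\<dots> \<le> 8 * X + 2 * (1 * ?L / ?s) + 1 * (2 * (2 ^ n) ^ (2 * k) * X / ?s)"
  proof (intro add_mono mult_left_mono mult_mono divide_right_mono mult_right_mono x)
    show "(2 * ?\<epsilon>) ^ k \<le> 1" using e \<epsilon> by (intro power_le_one) auto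
    have "?\<epsilon> ^ k \<le> 1" using e \<epsilon> by (intro power_le_one) auto
    then have "?\<epsilon> ^ k / 2 ^ (k - 1) \<le> 1 / 1" using \<epsilon> by (intro frac_le) auto
    then show "?\<epsilon> ^ k / 2 ^ (k - 1) \<le> 1" by simp
  qed (use L x0 s0 in auto)
  finally show ?thesis by (simp add: s algebra_simps)
qed

section \<open>Asymptotics\<close>

theorem theorem3p1:
  shows "\<exists>C>0. \<forall>k::nat \<Rightarrow> nat.
    (\<forall>n. k n > 0) \<longrightarrow> (\<lambda>n. real (k n)) \<in> o(\<lambda>n. (2 ^ n :: real) powr (1 / 50)) \<longrightarrow>
    (\<exists>r :: nat \<Rightarrow> real. r \<in> o(\<lambda>n. 1 / (2 ^ n :: real) powr (real (k n) / 2)) \<and>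
      (\<forall>\<^sub>F n in sequentially.
        \<forall>\<H>. \<H> \<subseteq> (cube (coords n (k n)) \<rightarrow>\<^sub>E {-1..1}) \<longrightarrow>
          closed_under_restrictions (coords n (k n)) \<H> \<longrightarrow>
          (\<forall>H\<in>\<H>.
            \<bar>measure_pmf.expectation (mu0 n (k n)) H - measure_pmf.expectation (mu1 n (k n)) H\<bar>
            \<le> C * (family_level_weight (coords n (k n)) (2 * k n) \<H>
                     / (2 ^ n :: real) powr (real (k n) / 2)) + r n)))"
proof (intro exI[of _ "2 :: real"] conjI allI impI)
  fix k :: "nat \<Rightarrow> nat"
  assume k: "\<forall>n. k n > 0" and small: "(\<lambda>n. real (k n)) \<in> o(\<lambda>n. (2 ^ n :: real) powr (1 / 50))"
  have root_le: "(2 ^ n :: real) powr (1 / 50) \<le> 2 ^ n" for n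
    using powr_mono[of "1 / 50" 1 "2 ^ n :: real"] by simp
  define X where "X n = 6 * real (k n) * 2 ^ n / (2 ^ n) ^ (4 * (k n)\<^sup>2)" for n
  \<comment> \<open>Both the constant 2 and this error are read off from
    \<open>mu_diff_bound\<close>.\<close>
  define r where "r n = 8 * X n + 2 * (2 ^ n) ^ (2 * k n) * X n / (2 ^ n) powr (real (k n) / 2)" for n
  have X: "0 \<le> X n" "(2 ^ n) ^ (2 * k n) * X n \<le> 6 * (real (k n) / 2 ^ n)" for n
  proof -
    show "0 \<le> X n" by (simp add: X_def)
    \<comment> \<open>The exponent 4 k^2 is at least 2 k + 2: one N pays for the N in
      \<open>X\<close>, the other leaves the decaying quotient k / N.\<close>
    have "(2 ^ n :: real) ^ (2 * k n) * 2 ^ n * 2 ^ n = (2 ^ n) ^ (2 * k n + 2)"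
      by (simp add: power_add power2_eq_square)
    also have "\<dots> \<le> (2 ^ n) ^ (4 * (k n)\<^sup>2)"
    proof (rule power_increasing)
      have "k n \<le> k n * k n" "1 \<le> k n" using k by (auto simp: Suc_leI)
      then show "2 * k n + 2 \<le> 4 * (k n)\<^sup>2" unfolding power2_eq_square by linarith
    qed simp
    finally have "(2 ^ n :: real) ^ (2 * k n) * 2 ^ n / (2 ^ n) ^ (4 * (k n)\<^sup>2) \<le> 1 / 2 ^ n"
      by (simp add: field_simps)
    then have "6 * real (k n) * ((2 ^ n :: real) ^ (2 * k n) * 2 ^ n / (2 ^ n) ^ (4 * (k n)\<^sup>2)) \<le> 6 * real (k n) * (1 / 2 ^ n)"
      by (intro mult_left_mono) auto
    then show "(2 ^ n) ^ (2 * k n) * X n \<le> 6 * (real (k n) / 2 ^ n)"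
      by (simp add: X_def mult_ac)
  qed
  have r0: "0 \<le> r n" for n unfolding r_def using X(1)[of n] by simp
  have r_le: "r n * (2 ^ n) powr (real (k n) / 2) \<le> 60 * (real (k n) / 2 ^ n)" for n
  proof -
    let ?s = "(2 ^ n :: real) powr (real (k n) / 2)"
    have "?s \<le> (2 ^ n) powr real (2 * k n)" by (intro powr_mono) auto
    \<comment> \<open>Multiplying \<open>r n\<close> by N^(k/2) thus stays within the factor N^(2k)
      that the bound on \<open>X\<close> already absorbs.\<close>
    then have s: "?s \<le> (2 ^ n) ^ (2 * k n)" by (simp only: powr_realpow zero_less_power zero_less_numeral)
    have "r n * ?s = 8 * (?s * X n) + 2 * ((2 ^ n) ^ (2 * k n) * X n)"
      by (simp add: r_def field_simps)
    also have "\<dots> \<le> 8 * ((2 ^ n) ^ (2 * k n) * X n) + 2 * ((2 ^ n) ^ (2 * k n) * X n)"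
      using s X(1) by (intro add_mono mult_left_mono mult_right_mono) auto
    also have "\<dots> \<le> 60 * (real (k n) / 2 ^ n)" using X(2)[of n] by linarith
    finally show ?thesis .
  qed
  have "(\<lambda>n. real (k n) / (2 ^ n) powr (1 / 50)) \<longlonglongrightarrow> 0"
    by (rule smalloD_tendsto[OF small])
  then have "(\<lambda>n. 60 * (real (k n) / (2 ^ n) powr (1 / 50))) \<longlonglongrightarrow> 0"
    by (rule tendsto_mult_right_zero)
  then have "(\<lambda>n. r n * (2 ^ n) powr (real (k n) / 2)) \<longlonglongrightarrow> 0"
  proof (rule tendsto_sandwich[rotated 3])
    show "(\<lambda>_. 0) \<longlonglongrightarrow> (0 :: real)" by simp
    show "\<forall>\<^sub>F n in sequentially. 0 \<le> r n * (2 ^ n) powr (real (k n) / 2)"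
      using r0 by simp
    \<comment> \<open>The growth condition makes the right side tend to 0, and N is at least its
      root.\<close>
    have "real (k n) / 2 ^ n \<le> real (k n) / (2 ^ n) powr (1 / 50)" for n
      using root_le[of n] by (intro divide_left_mono) auto
    then show "\<forall>\<^sub>F n in sequentially. r n * (2 ^ n) powr (real (k n) / 2) \<le> 60 * (real (k n) / (2 ^ n) powr (1 / 50))"
      using r_le by (intro always_eventually allI) (smt (verit))
  qed
  then have "r \<in> o(\<lambda>n. 1 / (2 ^ n :: real) powr (real (k n) / 2))"
    by (intro smalloI_tendsto) auto
  \<comment> \<open>The growth condition enters a second time, to give the side condition k \<le> N
    of \<open>mu_diff_bound\<close> eventually.\<close>
  moreover have "\<forall>\<^sub>F n in sequentially. n > 0 \<and> k n \<le> 2 ^ n"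
  proof -
    have "\<forall>\<^sub>F n in sequentially. norm (real (k n)) \<le> 1 * norm ((2 ^ n :: real) powr (1 / 50))"
      by (rule landau_o.smallD[OF small]) simp
    then show ?thesis
      using eventually_gt_at_top[of 0]
    proof eventually_elim
      case (elim n)
      then have "real (k n) \<le> 2 ^ n"
        using root_le[of n] by (simp del: of_nat_le_numeral_power_cancel_iff)
      then show ?case using elim by simp
    qed
  qed
  then have "\<forall>\<^sub>F n in sequentially.
        \<forall>\<H>. \<H> \<subseteq> (cube (coords n (k n)) \<rightarrow>\<^sub>E {-1..1}) \<longrightarrow>
          closed_under_restrictions (coords n (k n)) \<H> \<longrightarrow>
          (\<forall>H\<in>\<H>.
            \<bar>measure_pmf.expectation (mu0 n (k n)) H - measure_pmf.expectation (mu1 n (k n)) H\<bar>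
            \<le> 2 * (family_level_weight (coords n (k n)) (2 * k n) \<H>
                     / (2 ^ n :: real) powr (real (k n) / 2)) + r n)"
  proof eventually_elim
    case (elim n)
    then show ?case unfolding r_def X_def using k by (intro allI impI ballI mu_diff_bound) auto
  qed
  ultimately show "\<exists>r :: nat \<Rightarrow> real. r \<in> o(\<lambda>n. 1 / (2 ^ n :: real) powr (real (k n) / 2)) \<and>
      (\<forall>\<^sub>F n in sequentially.
        \<forall>\<H>. \<H> \<subseteq> (cube (coords n (k n)) \<rightarrow>\<^sub>E {-1..1}) \<longrightarrow>
          closed_under_restrictions (coords n (k n)) \<H> \<longrightarrow>
          (\<forall>H\<in>\<H>.
            \<bar>measure_pmf.expectation (mu0 n (k n)) H - measure_pmf.expectation (mu1 n (k n)) H\<bar>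
            \<le> 2 * (family_level_weight (coords n (k n)) (2 * k n) \<H>
                     / (2 ^ n :: real) powr (real (k n) / 2)) + r n))"
    by blast
qed simp

end
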